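(* Let $\rho_0:\mathbb{T}\to[0,1]$ be a $C^1$ function with $0<\rho_-\le\rho_0(u)\le\rho_+<1$ for all $u\in\mathbb{T}$, and let $T>0$ be such that the equation $$\partial_t\rho+\partial_u\big(\rho(1-\rho)\big)=0,\qquad \rho(0,u)=\rho_0(u),$$ has a (unique) classical $C^1$ solution $\rho(t,u)$ on $[0,T]\times\mathbb{T}$, with $\rho_-\le\rho\le\rho_+$ and with continuous bounded derivatives. Start the totally asymmetric simple exclusion process $\eta_t$ on $\mathbb{T}_N$ from the product measure $\mu^N=\prod_{x\in\mathbb{T}_N}\mathrm{Bern}(\rho_0(x/N))$. Then, for every $t\in[0,T]$ and every continuous $J:\mathbb{T}\to\mathbb{R}$, one has the convergence in probability, as $N\to\infty$, $$\langle\pi^N_{Nt},J\rangle=\frac1N\sum_{x\in\mathbb{T}_N}J(x/N)\,\eta_{Nt}(x)\ \longrightarrow\ \int_{\mathbb{T}}J(u)\rho(t,u)\,du .$$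
   Context: $\mathbb{T}=\mathbb{R}/\mathbb{Z}$, $\mathbb{T}_N=\mathbb{Z}/N\mathbb{Z}$. The totally asymmetric simple exclusion process (TASEP) on $\{0,1\}^{\mathbb{T}_N}$ is the Markov chain with generator $(Lf)(\eta)=\sum_{x\in\mathbb{T}_N}\eta(x)(1-\eta(x+1))[f(\eta^{x,x+1})-f(\eta)]$, where $\eta^{x,x+1}$ is $\eta$ with the values at $x$ and $x+1$ exchanged. The empirical measure is $\pi^N_t=N^{-1}\sum_{x\in\mathbb{T}_N}\eta_t(x)\delta_{x/N}$. *)

theory Defs
  imports "HOL-Probability.Probability"
begin

(* Functions on the circle R/Z are rendered as functions on the reals with period 1. *)

definition periodic1 :: "(real \<Rightarrow> 'b) \<Rightarrow> bool" where
  "periodic1 f \<longleftrightarrow> (\<forall>u. f (u + 1) = f u)"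

definition transition_semigroup :: "(('s \<Rightarrow> real) \<Rightarrow> 's \<Rightarrow> real) \<Rightarrow> real \<Rightarrow> ('s \<Rightarrow> real) \<Rightarrow> 's \<Rightarrow> real" where
  "transition_semigroup L t f x = (\<Sum>n. t ^ n / fact n * (L ^^ n) f x)"

(* The Markov property with transition function p_t(x,y) = (exp(t L) 1_{y})(x), in elementary
   form.  It is multiplied out, so no condition on the conditioning event having positive
   probability is needed.  No path regularity is required, so every version of the chain is
   covered. *)
definition markov_chain_with_generator ::
  "'a measure \<Rightarrow> (real \<Rightarrow> 'a \<Rightarrow> 's) \<Rightarrow> 's set \<Rightarrow> (('s \<Rightarrow> real) \<Rightarrow> 's \<Rightarrow> real) \<Rightarrow> bool" where
  "markov_chain_with_generator M X S L \<longleftrightarrow>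
     prob_space M \<and>
     (\<forall>t\<ge>0. X t \<in> measurable M (count_space S)) \<and>
     (\<forall>n (\<tau> :: nat \<Rightarrow> real) x.
        0 \<le> \<tau> 0 \<and> (\<forall>i\<le>n. \<tau> i < \<tau> (Suc i)) \<and> (\<forall>i\<le>Suc n. x i \<in> S) \<longrightarrow>
        measure M {\<omega> \<in> space M. \<forall>i\<le>Suc n. X (\<tau> i) \<omega> = x i} =
        measure M {\<omega> \<in> space M. \<forall>i\<le>n. X (\<tau> i) \<omega> = x i} *
          transition_semigroup L (\<tau> (Suc n) - \<tau> n) (indicator {x (Suc n)}) (x n))"

(* The sites of Z/NZ are 0, ..., N - 1, and the right neighbour of x is (x + 1) mod N.
   Configurations are extended by False off the sites, in accordance with Pi_pmf. *)

type_synonym config = "nat \<Rightarrow> bool"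

definition configs :: "nat \<Rightarrow> config set" where
  "configs N = {\<xi>. \<forall>x. \<xi> x \<longrightarrow> x < N}"

definition exchange :: "nat \<Rightarrow> nat \<Rightarrow> config \<Rightarrow> config" where
  "exchange x y \<xi> = \<xi>(x := \<xi> y, y := \<xi> x)"

definition tasep_generator :: "nat \<Rightarrow> (config \<Rightarrow> real) \<Rightarrow> config \<Rightarrow> real" where
  "tasep_generator N f \<xi> =
     (\<Sum>x<N. of_bool (\<xi> x) * (1 - of_bool (\<xi> ((x + 1) mod N))) *
        (f (exchange x ((x + 1) mod N) \<xi>) - f \<xi>))"

lemma summable_tasep_semigroup:
  assumes B: "\<And>\<xi>. \<bar>f \<xi>\<bar> \<le> B"
  shows "summable (\<lambda>n. t ^ n / fact n * (tasep_generator N ^^ n) f \<xi>)"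
proof -
  have bound: "\<bar>(tasep_generator N ^^ n) f \<xi>\<bar> \<le> (2 * real N) ^ n * B" for n \<xi>
  proof (induction n arbitrary: \<xi>)
    case 0
    then show ?case using B by simp
  next
    case (Suc n)
    let ?g = "(tasep_generator N ^^ n) f" and ?C = "(2 * real N) ^ n * B"
    have "\<bar>of_bool (\<xi> x) * (1 - of_bool (\<xi> ((x + 1) mod N))) *
        (?g (exchange x ((x + 1) mod N) \<xi>) - ?g \<xi>)\<bar> \<le> 2 * ?C" for x
      using Suc.IH[of "exchange x ((x + 1) mod N) \<xi>"] Suc.IH[of \<xi>]
      by (auto simp: of_bool_def)
    then have "\<bar>tasep_generator N ?g \<xi>\<bar> \<le> (\<Sum>x<N. 2 * ?C)"
      unfolding tasep_generator_def by (intro order_trans[OF sum_abs] sum_mono)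
    then show ?case by (simp add: algebra_simps)
  qed
  have "summable (\<lambda>n. B * (inverse (fact n) * (\<bar>t\<bar> * (2 * real N)) ^ n))"
    by (intro summable_mult summable_exp)
  then show ?thesis
  proof (rule summable_comparison_test'[where N = 0])
    fix n
    have "norm (t ^ n / fact n * (tasep_generator N ^^ n) f \<xi>)
        = \<bar>t\<bar> ^ n / fact n * \<bar>(tasep_generator N ^^ n) f \<xi>\<bar>"
      by (simp add: abs_mult power_abs)
    also have "\<dots> \<le> \<bar>t\<bar> ^ n / fact n * ((2 * real N) ^ n * B)"
      by (intro mult_left_mono bound) simp
    finally show "norm (t ^ n / fact n * (tasep_generator N ^^ n) f \<xi>)
        \<le> B * (inverse (fact n) * (\<bar>t\<bar> * (2 * real N)) ^ n)"
      by (simp add: field_simps power_mult_distrib)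
  qed
qed

definition initial_law :: "nat \<Rightarrow> (real \<Rightarrow> real) \<Rightarrow> config pmf" where
  "initial_law N \<rho>\<^sub>0 = Pi_pmf {..<N} False (\<lambda>x. bernoulli_pmf (\<rho>\<^sub>0 (real x / real N)))"

definition tasep_from :: "nat \<Rightarrow> (real \<Rightarrow> real) \<Rightarrow> 'a measure \<Rightarrow> (real \<Rightarrow> 'a \<Rightarrow> config) \<Rightarrow> bool" where
  "tasep_from N \<rho>\<^sub>0 M \<eta> \<longleftrightarrow>
     markov_chain_with_generator M \<eta> (configs N) (tasep_generator N) \<and>
     distr M (count_space UNIV) (\<eta> 0) = measure_pmf (initial_law N \<rho>\<^sub>0)"

(* The measure (1/N) * (sum over x < N of \<xi>(x) * (point mass at x/N)), carried by the
   fundamental domain [0,1) of the circle. *)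
definition empirical_measure :: "nat \<Rightarrow> config \<Rightarrow> real measure" where
  "empirical_measure N \<xi> =
     distr (point_measure {..<N} (\<lambda>x. ennreal (of_bool (\<xi> x) / real N))) borel
       (\<lambda>x. real x / real N)"

lemma integral_empirical_measure:
  fixes J :: "real \<Rightarrow> real"
  assumes "continuous_on UNIV J"
  shows "(LINT u|empirical_measure N \<xi>. J u) =
    (1 / real N) * (\<Sum>x<N. J (real x / real N) * of_bool (\<xi> x))"
proof -
  have J: "J \<in> borel_measurable borel"
    using assms by (rule borel_measurable_continuous_onI)
  have "(LINT u|empirical_measure N \<xi>. J u) =
      (LINT x|point_measure {..<N} (\<lambda>x. ennreal (of_bool (\<xi> x) / real N)). J (real x / real N))"
    unfolding empirical_measure_def
    by (rule integral_distr[OF _ J]) (simp add: measurable_point_measure_eq1)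
  also have "\<dots> = (\<Sum>x<N. (of_bool (\<xi> x) / real N) * J (real x / real N))"
    by (subst lebesgue_integral_point_measure_finite) auto
  finally show ?thesis
    by (simp add: sum_distrib_left mult_ac del: sum_of_bool_mult_eq sum_mult_of_bool_eq)
qed

(* A C^1 solution on [0,T] x R/Z; the time derivative is one-sided at t = 0 and t = T. *)
definition classical_solution ::
  "real \<Rightarrow> (real \<Rightarrow> real) \<Rightarrow> (real \<Rightarrow> real \<Rightarrow> real) \<Rightarrow> bool" where
  "classical_solution T \<rho>\<^sub>0 \<rho> \<longleftrightarrow>
     (\<forall>t\<in>{0..T}. periodic1 (\<rho> t)) \<and>
     (\<forall>u. \<rho> 0 u = \<rho>\<^sub>0 u) \<and>
     (\<exists>\<rho>t \<rho>u.
        continuous_on ({0..T} \<times> UNIV) (\<lambda>(t, u). \<rho>t t u) \<and>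
        continuous_on ({0..T} \<times> UNIV) (\<lambda>(t, u). \<rho>u t u) \<and>
        bounded ((\<lambda>(t, u). \<rho>t t u) ` ({0..T} \<times> UNIV)) \<and>
        bounded ((\<lambda>(t, u). \<rho>u t u) ` ({0..T} \<times> UNIV)) \<and>
        (\<forall>t\<in>{0..T}. \<forall>u.
           ((\<lambda>s. \<rho> s u) has_real_derivative \<rho>t t u) (at t within {0..T}) \<and>
           (\<rho> t has_real_derivative \<rho>u t u) (at u) \<and>
           \<rho>t t u + deriv (\<lambda>v. \<rho> t v * (1 - \<rho> t v)) u = 0))"

(* Convergence in probability to a constant; each X N may live on its own space. *)
definition converges_in_probability ::
  "(nat \<Rightarrow> 'a measure) \<Rightarrow> (nat \<Rightarrow> 'a \<Rightarrow> real) \<Rightarrow> real \<Rightarrow> bool" where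
  "converges_in_probability M X c \<longleftrightarrow>
     (\<forall>\<epsilon>>0. (\<lambda>N. measure (M N) {\<omega> \<in> space (M N). \<bar>X N \<omega> - c\<bar> > \<epsilon>}) \<longlonglongrightarrow> 0)"

end

theory Submission
  imports Defs "HOL-Real_Asymp.Real_Asymp"
begin

text \<open>The generator is \<open>\<Sum>\<^sub>x (T\<^sub>x - 1)\<close> for the jump maps \<open>T\<^sub>x\<close>. Measure the distance of two
  configurations by their \<^emph>\<open>discrepancy\<close>, the largest difference of particle numbers over all
  arcs of the ring. No jump map increases it, so the semigroup preserves discrepancy-Lipschitz
  functions. Errors made in successive time blocks of macroscopic length \<open>\<delta>\<close> therefore only add
  up, and at the start of each block the configuration may be replaced by a sample of the product
  measure \<open>\<nu>\<close> with the current density profile. It remains to see that the error of one block is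
  \<open>o(\<delta>) N\<close>.

  Within a block, \<open>\<nu> (L f) = \<nu> (V f)\<close> where \<open>V\<close> is a mean-zero sum of local terms of size \<open>O(1/N)\<close>.
  By bounded differences \<open>V\<close> exceeds a multiple of \<open>\<delta>\<close> only with a probability so small that
  Gronwall's lemma gives \<open>\<nu> (P\<^sub>s f) \<le> exp (O(\<delta>\<^sup>2) N) (\<nu> f + negligible)\<close> for \<open>0 \<le> f \<le> 1\<close>. Averages of
  the microscopic current over windows of \<open>\<epsilon> \<delta> N\<close> sites thus stay within \<open>O((\<delta>/\<epsilon>)\<^sup>1\<^sup>/\<^sup>2)\<close> of their
  local equilibrium value throughout the block, and a Chernoff bound for the particle number
  weighted by a smeared arc gives an error \<open>O(\<epsilon> \<delta> + \<delta> (\<delta>/\<epsilon>)\<^sup>1\<^sup>/\<^sup>2) N\<close>. The smooth solution is consistent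
  with the equilibrium current to order \<open>o(\<delta>)\<close>. Summing over \<open>t/\<delta>\<close> blocks and letting first \<open>N\<close> tend
  to infinity, then \<open>\<delta>\<close> and \<open>\<epsilon>\<close> to zero, proves the theorem.\<close>

subsection \<open>The TASEP semigroup\<close>

definition jump :: "nat \<Rightarrow> nat \<Rightarrow> config \<Rightarrow> config" where
  "jump N x \<xi> = (if \<xi> x \<and> \<not> \<xi> ((x + 1) mod N) then exchange x ((x + 1) mod N) \<xi> else \<xi>)"

definition jump_sum :: "nat \<Rightarrow> (config \<Rightarrow> real) \<Rightarrow> config \<Rightarrow> real" where
  "jump_sum N f \<xi> = (\<Sum>x<N. f (jump N x \<xi>))"

abbreviation tasep_semigroup :: "nat \<Rightarrow> real \<Rightarrow> (config \<Rightarrow> real) \<Rightarrow> config \<Rightarrow> real" where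
  "tasep_semigroup N \<equiv> transition_semigroup (tasep_generator N)"

lemma bounded_range_realE:
  fixes f :: "'s \<Rightarrow> real"
  assumes "bounded (range f)"
  obtains B where "B \<ge> 0" "\<And>\<xi>. \<bar>f \<xi>\<bar> \<le> B"
proof -
  obtain B where B: "\<And>\<xi>. \<bar>f \<xi>\<bar> \<le> B"
    using assms by (auto simp: bounded_iff)
  have "B \<ge> 0"
    using B[of undefined] by linarith
  then show ?thesis using B that by blast
qed

lemma bounded_range_realI:
  fixes f :: "'s \<Rightarrow> real"
  assumes "\<And>\<xi>. \<bar>f \<xi>\<bar> \<le> B"
  shows "bounded (range f)"
  using assms by (auto simp: bounded_iff)

lemma tasep_generator_eq: "tasep_generator N f \<xi> = jump_sum N f \<xi> - real N * f \<xi>"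
proof -
  have "tasep_generator N f \<xi> = (\<Sum>x<N. f (jump N x \<xi>) - f \<xi>)"
    unfolding tasep_generator_def jump_def by (intro sum.cong) auto
  then show ?thesis
    by (simp add: sum_subtractf jump_sum_def)
qed

lemma jump_sum_sum:
  "jump_sum N (\<lambda>\<xi>. \<Sum>i\<in>I. c i * f i \<xi>) \<xi> = (\<Sum>i\<in>I. c i * jump_sum N (f i) \<xi>)"
  unfolding jump_sum_def by (subst sum.swap) (simp add: sum_distrib_left)

lemma abs_jump_sum_power_le:
  assumes "\<And>\<xi>. \<bar>f \<xi>\<bar> \<le> B"
  shows "\<bar>(jump_sum N ^^ n) f \<xi>\<bar> \<le> real N ^ n * B"
proof (induction n arbitrary: \<xi>)
  case (Suc n)
  have "\<bar>jump_sum N ((jump_sum N ^^ n) f) \<xi>\<bar> \<le> (\<Sum>x<N. real N ^ n * B)"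
    unfolding jump_sum_def[of N "(jump_sum N ^^ n) f"] using Suc
    by (intro order_trans[OF sum_abs] sum_mono) auto
  then show ?case by simp
qed (use assms in auto)

lemma summable_norm_jump_sum_power:
  assumes "bounded (range f)"
  shows "summable (\<lambda>n. norm (t ^ n / fact n * (jump_sum N ^^ n) f \<xi>))"
proof -
  obtain B where B: "\<And>\<xi>. \<bar>f \<xi>\<bar> \<le> B"
    using bounded_range_realE[OF assms] by blast
  have "summable (\<lambda>n. B * (inverse (fact n) * (\<bar>t\<bar> * real N) ^ n))"
    by (intro summable_mult summable_exp)
  then show ?thesis
  proof (rule summable_comparison_test'[where N = 0])
    fix n
    have "\<bar>t\<bar> ^ n / fact n * \<bar>(jump_sum N ^^ n) f \<xi>\<bar> \<le> \<bar>t\<bar> ^ n / fact n * (real N ^ n * B)"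
      by (intro mult_left_mono abs_jump_sum_power_le B) simp
    then show "norm (norm (t ^ n / fact n * (jump_sum N ^^ n) f \<xi>))
        \<le> B * (inverse (fact n) * (\<bar>t\<bar> * real N) ^ n)"
      by (simp add: field_simps power_mult_distrib abs_mult power_abs)
  qed
qed

lemma tasep_generator_power:
  "t ^ n / fact n * (tasep_generator N ^^ n) f \<xi> =
    (\<Sum>i\<le>n. (t ^ i / fact i * (jump_sum N ^^ i) f \<xi>) *
      ((- (t * real N)) ^ (n - i) / fact (n - i)))"
proof -
  have *: "(tasep_generator N ^^ n) f \<xi> =
    (\<Sum>i\<le>n. (of_nat (n choose i) * (- real N) ^ (n - i)) * (jump_sum N ^^ i) f \<xi>)" for \<xi>
  proof (induction n arbitrary: \<xi>)
    case (Suc n)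
    let ?a = "\<lambda>n i. of_nat (n choose i) * (- real N) ^ (n - i)"
    let ?q = "\<lambda>i. (jump_sum N ^^ i) f \<xi>"
    have "(tasep_generator N ^^ Suc n) f \<xi> =
        (\<Sum>i\<le>n. ?a n i * ?q (Suc i)) + (\<Sum>i\<le>n. - real N * (?a n i * ?q i))"
      by (simp add: Suc[abs_def] tasep_generator_eq jump_sum_sum sum_distrib_left sum_negf)
    also have "(\<Sum>i\<le>n. - real N * (?a n i * ?q i)) =
        (\<Sum>i\<le>Suc n. of_nat (n choose i) * (- real N) ^ (Suc n - i) * ?q i)"
      by (simp add: Suc_diff_le mult.assoc mult.left_commute)
    also have "\<dots> = (- real N) ^ Suc n * ?q 0 +
        (\<Sum>i\<le>n. of_nat (n choose Suc i) * (- real N) ^ (n - i) * ?q (Suc i))"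
      by (subst sum.atMost_Suc_shift) simp
    also have "(\<Sum>i\<le>n. ?a n i * ?q (Suc i)) + \<dots> =
        (- real N) ^ Suc n * ?q 0 + (\<Sum>i\<le>n. ?a (Suc n) (Suc i) * ?q (Suc i))"
      by (simp add: algebra_simps flip: sum.distrib)
    also have "\<dots> = (\<Sum>i\<le>Suc n. ?a (Suc n) i * ?q i)"
      by (subst sum.atMost_Suc_shift) simp
    finally show ?case .
  qed simp
  show ?thesis
    unfolding * sum_distrib_left
  proof (intro sum.cong refl)
    fix i assume i: "i \<in> {..n}"
    then have "real (n choose i) = fact n / (fact i * fact (n - i))"
      by (simp add: binomial_fact)
    moreover have "t ^ n = t ^ i * t ^ (n - i)"
      using i by (simp flip: power_add)
    moreover have "(- (t * real N)) ^ (n - i) = t ^ (n - i) * (- real N) ^ (n - i)"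
      by (simp flip: power_mult_distrib)
    ultimately show "t ^ n / fact n * (of_nat (n choose i) * (- real N) ^ (n - i) * (jump_sum N ^^ i) f \<xi>) =
        t ^ i / fact i * (jump_sum N ^^ i) f \<xi> * ((- (t * real N)) ^ (n - i) / fact (n - i))"
      by simp
  qed
qed

text \<open>Poissonization: positivity and contraction properties of the jump maps pass to the
  semigroup.\<close>

lemma tasep_semigroup_eq:
  assumes "bounded (range f)"
  shows "tasep_semigroup N t f \<xi> =
    exp (- (t * real N)) * (\<Sum>n. t ^ n / fact n * (jump_sum N ^^ n) f \<xi>)"
proof -
  have e: "(\<lambda>n. (- (t * real N)) ^ n / fact n) sums exp (- (t * real N))"
    using exp_converges[of "- (t * real N)"] by (simp add: divide_inverse mult.commute scaleR_conv_of_real)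
  have e': "summable (\<lambda>n. norm ((- (t * real N)) ^ n / fact n))"
    using summable_norm_exp[of "- (t * real N)"] by (simp add: divide_inverse mult.commute)
  show ?thesis
    unfolding transition_semigroup_def tasep_generator_power
    using Cauchy_product[OF summable_norm_jump_sum_power[OF assms] e'] sums_unique[OF e]
    by (simp add: mult.commute)
qed

lemma summable_tasep_semigroup':
  assumes "bounded (range f)"
  shows "summable (\<lambda>n. t ^ n / fact n * (tasep_generator N ^^ n) f \<xi>)"
  by (rule bounded_range_realE[OF assms]) (rule summable_tasep_semigroup)

lemma bounded_tasep_generator:
  assumes "bounded (range f)"
  shows "bounded (range (tasep_generator N f))"
proof -
  obtain B where B: "B \<ge> 0" "\<And>\<xi>. \<bar>f \<xi>\<bar> \<le> B"
    using bounded_range_realE[OF assms] by blast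
  have "\<bar>jump_sum N f \<xi>\<bar> \<le> real N * B" for \<xi>
    using abs_jump_sum_power_le[OF B(2), where n = 1] by simp
  moreover have "\<bar>real N * f \<xi>\<bar> \<le> real N * B" for \<xi>
    using B(2) by (simp add: abs_mult mult_left_mono)
  ultimately show ?thesis
    unfolding tasep_generator_eq
    by (intro bounded_range_realI[of _ "real N * B + real N * B"])
      (meson abs_triangle_ineq4 add_mono order_trans)
qed

lemma tasep_generator_power_lin:
  "(tasep_generator N ^^ n) (\<lambda>\<xi>. a * f \<xi> + b * g \<xi>) \<xi> =
    a * (tasep_generator N ^^ n) f \<xi> + b * (tasep_generator N ^^ n) g \<xi>"
proof (induction n arbitrary: \<xi>)
  case (Suc n)
  then show ?case
    by (simp add: Suc[abs_def] tasep_generator_eq jump_sum_def sum.distrib sum_distrib_left algebra_simps)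
qed simp

lemma tasep_semigroup_lin:
  assumes "bounded (range f)" "bounded (range g)"
  shows "tasep_semigroup N t (\<lambda>\<xi>. a * f \<xi> + b * g \<xi>) \<xi> =
    a * tasep_semigroup N t f \<xi> + b * tasep_semigroup N t g \<xi>"
proof -
  have "(\<lambda>n. t ^ n / fact n * (tasep_generator N ^^ n) (\<lambda>\<xi>. a * f \<xi> + b * g \<xi>) \<xi>) =
     (\<lambda>n. a * (t ^ n / fact n * (tasep_generator N ^^ n) f \<xi>) + b * (t ^ n / fact n * (tasep_generator N ^^ n) g \<xi>))"
    by (simp add: tasep_generator_power_lin algebra_simps)
  moreover have "(\<lambda>n. t ^ n / fact n * (tasep_generator N ^^ n) h \<xi>) sums tasep_semigroup N t h \<xi>"
    if "bounded (range h)" for h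
    unfolding transition_semigroup_def by (intro summable_sums summable_tasep_semigroup' that)
  note sums_add[OF sums_mult[OF this[OF assms(1)], of a] sums_mult[OF this[OF assms(2)], of b]]
  ultimately show ?thesis
    unfolding transition_semigroup_def[of _ _ "\<lambda>\<xi>. a * f \<xi> + b * g \<xi>"]
    by (simp only: sums_unique[symmetric])
qed

lemma tasep_semigroup_const: "tasep_semigroup N t (\<lambda>_. c) \<xi> = c"
proof -
  have "(tasep_generator N ^^ n) (\<lambda>_. c) = (\<lambda>_. if n = 0 then c else 0)" for n
    by (induction n) (auto simp: tasep_generator_def)
  then have "(\<lambda>n. t ^ n / fact n * (tasep_generator N ^^ n) (\<lambda>_. c) \<xi>) = (\<lambda>n. if n = 0 then c else 0)"
    by auto
  then show ?thesis
    unfolding transition_semigroup_def using sums_unique[OF sums_single[of 0 "\<lambda>_. c"]] by (simp only:)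
qed

lemma tasep_semigroup_0: "tasep_semigroup N 0 f \<xi> = f \<xi>"
proof -
  have "(\<lambda>n. 0 ^ n / fact n * (tasep_generator N ^^ n) f \<xi>) = (\<lambda>n. if n = 0 then f \<xi> else 0)"
    by auto
  then show ?thesis
    unfolding transition_semigroup_def using sums_unique[OF sums_single[of 0 "\<lambda>_. f \<xi>"]] by (simp only:)
qed

lemma tasep_semigroup_nonneg:
  assumes "bounded (range f)" "\<And>\<xi>. f \<xi> \<ge> 0" "t \<ge> 0"
  shows "tasep_semigroup N t f \<xi> \<ge> 0"
proof -
  have "(jump_sum N ^^ n) f \<xi> \<ge> 0" for n \<xi>
    by (induction n arbitrary: \<xi>) (auto simp: jump_sum_def assms intro: sum_nonneg)
  then show ?thesis
    unfolding tasep_semigroup_eq[OF assms(1)]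
    by (intro mult_nonneg_nonneg suminf_nonneg summable_norm_cancel[OF summable_norm_jump_sum_power]
        assms) (auto simp: assms)
qed

lemma tasep_semigroup_mono:
  assumes "bounded (range f)" "bounded (range g)" "\<And>\<xi>. f \<xi> \<le> g \<xi>" "t \<ge> 0"
  shows "tasep_semigroup N t f \<xi> \<le> tasep_semigroup N t g \<xi>"
proof -
  have "bounded (range (\<lambda>\<xi>. 1 * g \<xi> + (-1) * f \<xi>))"
    using bounded_minus_comp[OF assms(2,1)] by simp
  from tasep_semigroup_nonneg[OF this _ assms(4)] assms(3)
  have "tasep_semigroup N t (\<lambda>\<xi>. 1 * g \<xi> + (-1) * f \<xi>) \<xi> \<ge> 0"
    by simp
  then show ?thesis
    unfolding tasep_semigroup_lin[OF assms(2,1)] by simp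
qed

lemma abs_tasep_semigroup_le:
  assumes "\<And>\<xi>. \<bar>f \<xi>\<bar> \<le> B" "t \<ge> 0"
  shows "\<bar>tasep_semigroup N t f \<xi>\<bar> \<le> B"
proof -
  have f: "bounded (range f)"
    using assms by (intro bounded_range_realI)
  have "tasep_semigroup N t f \<xi> \<le> tasep_semigroup N t (\<lambda>_. B) \<xi>"
    using assms by (intro tasep_semigroup_mono f) (auto simp: abs_le_iff)
  moreover have "tasep_semigroup N t (\<lambda>_. - B) \<xi> \<le> tasep_semigroup N t f \<xi>"
    using assms by (intro tasep_semigroup_mono f) (auto simp: abs_le_iff minus_le_iff)
  ultimately show ?thesis
    by (simp add: tasep_semigroup_const abs_le_iff)
qed

lemma tasep_semigroup_sum:
  assumes "finite I" "\<And>i. i \<in> I \<Longrightarrow> bounded (range (f i))"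
  shows "tasep_semigroup N t (\<lambda>\<xi>. \<Sum>i\<in>I. c i * f i \<xi>) \<xi> = (\<Sum>i\<in>I. c i * tasep_semigroup N t (f i) \<xi>)
     \<and> bounded (range (\<lambda>\<xi>. \<Sum>i\<in>I. c i * f i \<xi>))"
  using assms
proof (induction I rule: finite_induct)
  case empty
  then show ?case by (simp add: tasep_semigroup_const)
next
  case (insert i I)
  then have *: "bounded (range (f i))" "bounded (range (\<lambda>\<xi>. \<Sum>i\<in>I. c i * f i \<xi>))"
    by auto
  have "bounded (range (\<lambda>\<xi>. c i * f i \<xi>))"
    using bounded_scaling[OF *(1), of "c i"] by (simp add: image_image)
  from bounded_plus_comp[OF this *(2)] insert tasep_semigroup_lin[OF *, of N t "c i" 1 \<xi>]
  show ?case by simp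
qed

lemma tasep_generator_semigroup:
  assumes "bounded (range f)"
  shows "tasep_generator N (tasep_semigroup N t f) \<xi> = tasep_semigroup N t (tasep_generator N f) \<xi>"
proof -
  let ?a = "\<lambda>n \<xi>. t ^ n / fact n * (tasep_generator N ^^ n) f \<xi>"
  have s: "(\<lambda>n. ?a n \<zeta>) sums tasep_semigroup N t f \<zeta>" for \<zeta>
    unfolding transition_semigroup_def by (intro summable_sums summable_tasep_semigroup' assms)
  have "(\<lambda>n. (\<Sum>x<N. ?a n (jump N x \<xi>)) - real N * ?a n \<xi>) sums
     ((\<Sum>x<N. tasep_semigroup N t f (jump N x \<xi>)) - real N * tasep_semigroup N t f \<xi>)"
    by (intro sums_diff sums_sum sums_mult s)
  also have "(\<Sum>x<N. tasep_semigroup N t f (jump N x \<xi>)) - real N * tasep_semigroup N t f \<xi> =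
      tasep_generator N (tasep_semigroup N t f) \<xi>"
    by (simp only: tasep_generator_eq jump_sum_def)
  also have "(\<lambda>n. (\<Sum>x<N. ?a n (jump N x \<xi>)) - real N * ?a n \<xi>) =
      (\<lambda>n. t ^ n / fact n * tasep_generator N ((tasep_generator N ^^ n) f) \<xi>)"
    by (simp only: tasep_generator_eq jump_sum_def sum_distrib_left right_diff_distrib mult.left_commute)
  also have "\<dots> = (\<lambda>n. t ^ n / fact n * (tasep_generator N ^^ n) (tasep_generator N f) \<xi>)"
    by (simp only: funpow_swap1)
  finally show ?thesis
    unfolding transition_semigroup_def[of _ _ "tasep_generator N f"] by (rule sums_unique)
qed

lemma has_real_derivative_tasep_semigroup:
  assumes "bounded (range f)"
  shows "((\<lambda>t. tasep_semigroup N t f \<xi>) has_real_derivative tasep_semigroup N t (tasep_generator N f) \<xi>) (at t)"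
proof -
  let ?c = "\<lambda>n. (tasep_generator N ^^ n) f \<xi> / fact n"
  have "summable (\<lambda>n. ?c n * y ^ n)" for y
    using summable_tasep_semigroup'[OF assms, of y N \<xi>] by (simp add: mult.commute)
  from termdiffs_strong_converges_everywhere[OF this, of t]
  have "((\<lambda>t. \<Sum>n. ?c n * t ^ n) has_real_derivative (\<Sum>n. diffs ?c n * t ^ n)) (at t)" .
  moreover have "(\<lambda>t. \<Sum>n. ?c n * t ^ n) = (\<lambda>t. tasep_semigroup N t f \<xi>)"
    unfolding transition_semigroup_def by (simp add: mult.commute)
  moreover have "diffs ?c n * t ^ n = t ^ n / fact n * (tasep_generator N ^^ n) (tasep_generator N f) \<xi>" for n
  proof -
    have "diffs ?c n = (tasep_generator N ^^ Suc n) f \<xi> / fact n"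
      by (simp add: diffs_def del: funpow.simps of_nat_Suc)
    then show ?thesis
      by (simp only: funpow_Suc_right comp_apply) simp
  qed
  ultimately show ?thesis
    unfolding transition_semigroup_def by simp
qed

lemma tasep_semigroup_contraction:
  assumes f: "bounded (range f)" and t: "t \<ge> 0"
    and d: "\<And>x \<xi> \<zeta>. x < N \<Longrightarrow> d (jump N x \<xi>) (jump N x \<zeta>) \<le> (d \<xi> \<zeta> :: real)"
    and lip: "\<And>\<xi> \<zeta>. \<bar>f \<xi> - f \<zeta>\<bar> \<le> d \<xi> \<zeta>"
  shows "\<bar>tasep_semigroup N t f \<xi> - tasep_semigroup N t f \<zeta>\<bar> \<le> d \<xi> \<zeta>"
proof -
  have *: "\<bar>(jump_sum N ^^ n) f \<xi> - (jump_sum N ^^ n) f \<zeta>\<bar> \<le> real N ^ n * d \<xi> \<zeta>" for n \<xi> \<zeta>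
  proof (induction n arbitrary: \<xi> \<zeta>)
    case (Suc n)
    have "\<bar>(jump_sum N ^^ n) f (jump N x \<xi>) - (jump_sum N ^^ n) f (jump N x \<zeta>)\<bar> \<le> real N ^ n * d \<xi> \<zeta>" if "x < N" for x
      using Suc[of "jump N x \<xi>" "jump N x \<zeta>"] d[of x \<xi> \<zeta>] that
      by (meson mult_left_mono of_nat_0_le_iff order_trans zero_le_power)
    then have "\<bar>(\<Sum>x<N. (jump_sum N ^^ n) f (jump N x \<xi>) - (jump_sum N ^^ n) f (jump N x \<zeta>))\<bar>
        \<le> (\<Sum>x<N. real N ^ n * d \<xi> \<zeta>)"
      by (intro order_trans[OF sum_abs] sum_mono) auto
    then have "\<bar>jump_sum N ((jump_sum N ^^ n) f) \<xi> - jump_sum N ((jump_sum N ^^ n) f) \<zeta>\<bar> \<le> real N * (real N ^ n * d \<xi> \<zeta>)"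
      by (simp add: jump_sum_def[of N "(jump_sum N ^^ n) f"] sum_subtractf)
    then show ?case by simp
  qed (use lip in auto)
  let ?a = "\<lambda>\<xi> n. t ^ n / fact n * (jump_sum N ^^ n) f \<xi>"
  have s: "summable (?a \<xi>)" for \<xi>
    by (rule summable_norm_cancel[OF summable_norm_jump_sum_power[OF f]])
  have e: "(\<lambda>n. d \<xi> \<zeta> * ((t * real N) ^ n / fact n)) sums (d \<xi> \<zeta> * exp (t * real N))"
    using exp_converges[of "t * real N"]
    by (intro sums_mult) (simp add: divide_inverse mult.commute scaleR_conv_of_real)
  have le: "\<bar>?a \<xi> n - ?a \<zeta> n\<bar> \<le> d \<xi> \<zeta> * ((t * real N) ^ n / fact n)" for n
  proof -
    have "\<bar>?a \<xi> n - ?a \<zeta> n\<bar> = t ^ n / fact n * \<bar>(jump_sum N ^^ n) f \<xi> - (jump_sum N ^^ n) f \<zeta>\<bar>"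
      using t by (simp only: right_diff_distrib[symmetric] abs_mult) simp
    also have "\<dots> \<le> t ^ n / fact n * (real N ^ n * d \<xi> \<zeta>)"
      using t by (intro mult_left_mono *) auto
    finally show ?thesis by (simp add: power_mult_distrib mult_ac)
  qed
  have "\<bar>(\<Sum>n. ?a \<xi> n) - (\<Sum>n. ?a \<zeta> n)\<bar> = \<bar>\<Sum>n. ?a \<xi> n - ?a \<zeta> n\<bar>"
    using s by (simp add: suminf_diff)
  also have "\<dots> \<le> (\<Sum>n. d \<xi> \<zeta> * ((t * real N) ^ n / fact n))"
    using norm_suminf_le[of "\<lambda>n. ?a \<xi> n - ?a \<zeta> n" "\<lambda>n. d \<xi> \<zeta> * ((t * real N) ^ n / fact n)"]
      sums_summable[OF e] le by (simp only: real_norm_def)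
  also have "\<dots> = d \<xi> \<zeta> * exp (t * real N)"
    using sums_unique[OF e] by simp
  finally have "exp (- (t * real N)) * \<bar>(\<Sum>n. ?a \<xi> n) - (\<Sum>n. ?a \<zeta> n)\<bar>
      \<le> exp (- (t * real N)) * (d \<xi> \<zeta> * exp (t * real N))"
    by (rule mult_left_mono) simp
  also have "\<dots> = d \<xi> \<zeta>"
    by (simp add: exp_minus)
  finally show ?thesis
    unfolding tasep_semigroup_eq[OF f] by (simp only: right_diff_distrib[symmetric] abs_mult abs_exp_cancel)
qed

subsection \<open>Bernoulli product measures\<close>

definition bernoulli_weight :: "(nat \<Rightarrow> real) \<Rightarrow> nat \<Rightarrow> config \<Rightarrow> real" where
  "bernoulli_weight p N \<xi> = (\<Prod>x<N. if \<xi> x then p x else 1 - p x)"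

definition product_mean :: "(nat \<Rightarrow> real) \<Rightarrow> nat \<Rightarrow> (config \<Rightarrow> real) \<Rightarrow> real" where
  "product_mean p N f = (\<Sum>\<xi>\<in>configs N. bernoulli_weight p N \<xi> * f \<xi>)"

lemma configs_0 [simp]: "configs 0 = {\<lambda>_. False}"
  by (auto simp: configs_def)

lemma configs_Suc: "configs (Suc n) = configs n \<union> (\<lambda>\<xi>. \<xi>(n := True)) ` configs n"
proof (intro equalityI subsetI)
  fix \<xi> assume \<xi>: "\<xi> \<in> configs (Suc n)"
  show "\<xi> \<in> configs n \<union> (\<lambda>\<xi>. \<xi>(n := True)) ` configs n"
  proof (cases "\<xi> n")
    case True
    then have "\<xi> = (\<xi>(n := False))(n := True)" by (simp add: fun_upd_idem)
    moreover have "\<xi>(n := False) \<in> configs n"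
      using \<xi> by (auto simp: configs_def less_Suc_eq)
    ultimately show ?thesis by blast
  next
    case False
    then have "\<xi> \<in> configs n"
      using \<xi> by (auto simp: configs_def less_Suc_eq)
    then show ?thesis by blast
  qed
qed (auto simp: configs_def less_Suc_eq)

lemma finite_configs [simp, intro]: "finite (configs n)"
  by (induction n) (auto simp: configs_Suc)

lemma product_mean_0 [simp]: "product_mean p 0 f = f (\<lambda>_. False)"
  by (simp add: product_mean_def bernoulli_weight_def)

lemma product_mean_Suc:
  "product_mean p (Suc n) f =
    product_mean p n (\<lambda>\<xi>. p n * f (\<xi>(n := True)) + (1 - p n) * f (\<xi>(n := False)))"
proof -
  let ?u = "\<lambda>\<xi>::config. \<xi>(n := True)"
  have F: "\<xi>(n := False) = \<xi>" "\<not> \<xi> n" if "\<xi> \<in> configs n" for \<xi>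
    using that by (auto simp: configs_def fun_upd_idem_iff)
  have inj: "inj_on ?u (configs n)"
  proof (rule inj_onI)
    fix \<xi> \<zeta> assume "\<xi> \<in> configs n" "\<zeta> \<in> configs n" "?u \<xi> = ?u \<zeta>"
    then show "\<xi> = \<zeta>"
      by (metis F(1) fun_upd_upd)
  qed
  have "configs n \<inter> ?u ` configs n = {}"
    by (force simp: configs_def)
  then have "product_mean p (Suc n) f =
      (\<Sum>\<xi>\<in>configs n. bernoulli_weight p (Suc n) \<xi> * f \<xi>) +
      (\<Sum>\<xi>\<in>configs n. bernoulli_weight p (Suc n) (?u \<xi>) * f (?u \<xi>))"
    unfolding product_mean_def configs_Suc
    by (subst sum.union_disjoint) (auto simp: sum.reindex[OF inj])
  also have "\<dots> = (\<Sum>\<xi>\<in>configs n. bernoulli_weight p n \<xi> * (1 - p n) * f \<xi>) +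
      (\<Sum>\<xi>\<in>configs n. bernoulli_weight p n \<xi> * p n * f (?u \<xi>))"
    unfolding bernoulli_weight_def prod.lessThan_Suc
    by (intro arg_cong2[where f = plus] sum.cong refl) (simp_all add: F)
  also have "\<dots> = (\<Sum>\<xi>\<in>configs n. bernoulli_weight p n \<xi> * (p n * f (?u \<xi>) + (1 - p n) * f (\<xi>(n := False))))"
    unfolding sum.distrib[symmetric] by (intro sum.cong refl) (simp add: F algebra_simps)
  finally show ?thesis
    unfolding product_mean_def .
qed

lemma product_mean_lin:
  "product_mean p N (\<lambda>\<xi>. a * f \<xi> + b * g \<xi>) = a * product_mean p N f + b * product_mean p N g"
  unfolding product_mean_def by (simp add: sum.distrib sum_distrib_left algebra_simps)

lemma product_mean_cmult: "product_mean p N (\<lambda>\<xi>. a * f \<xi>) = a * product_mean p N f"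
  using product_mean_lin[of p N a f 0 f] by simp

lemma product_mean_add: "product_mean p N (\<lambda>\<xi>. f \<xi> + g \<xi>) = product_mean p N f + product_mean p N g"
  using product_mean_lin[of p N 1 f 1 g] by simp

lemma product_mean_sum:
  "product_mean p N (\<lambda>\<xi>. \<Sum>i\<in>I. f i \<xi>) = (\<Sum>i\<in>I. product_mean p N (f i))"
  unfolding product_mean_def sum_distrib_left by (rule sum.swap)

lemma product_mean_cong:
  assumes "\<And>\<xi>. \<xi> \<in> configs N \<Longrightarrow> f \<xi> = g \<xi>"
  shows "product_mean p N f = product_mean p N g"
  unfolding product_mean_def using assms by (intro sum.cong) auto

lemma product_mean_const [simp]: "product_mean p N (\<lambda>_. c) = c"
  by (induction N) (simp_all add: product_mean_Suc algebra_simps)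

lemma bernoulli_weight_nonneg:
  assumes "\<And>x. x < N \<Longrightarrow> 0 \<le> p x \<and> p x \<le> 1"
  shows "bernoulli_weight p N \<xi> \<ge> 0"
  unfolding bernoulli_weight_def using assms by (intro prod_nonneg) auto

lemma product_mean_mono:
  assumes "\<And>x. x < N \<Longrightarrow> 0 \<le> p x \<and> p x \<le> 1" "\<And>\<xi>. \<xi> \<in> configs N \<Longrightarrow> f \<xi> \<le> g \<xi>"
  shows "product_mean p N f \<le> product_mean p N g"
  unfolding product_mean_def
  using assms by (intro sum_mono mult_left_mono bernoulli_weight_nonneg) auto

lemma product_mean_nonneg:
  assumes "\<And>x. x < N \<Longrightarrow> 0 \<le> p x \<and> p x \<le> 1" "\<And>\<xi>. \<xi> \<in> configs N \<Longrightarrow> 0 \<le> f \<xi>"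
  shows "0 \<le> product_mean p N f"
  using product_mean_mono[of N p "\<lambda>_. 0" f] assms by simp

lemma product_mean_site:
  assumes "x < N"
  shows "product_mean p N (\<lambda>\<xi>. g (\<xi> x)) = p x * g True + (1 - p x) * g False"
  using assms
proof (induction N)
  case (Suc N)
  then show ?case
    by (cases "x = N") (simp_all add: product_mean_Suc algebra_simps)
qed simp

lemma product_mean_two_sites:
  assumes "x < N" "y < N" "x \<noteq> y"
  shows "product_mean p N (\<lambda>\<xi>. of_bool (\<xi> x) * (1 - of_bool (\<xi> y))) = p x * (1 - p y)"
  using assms
proof (induction N)
  case (Suc N)
  consider "x = N" "y < N" | "x < N" "y = N" | "x < N" "y < N"
    using Suc.prems by linarith
  then show ?case
  proof cases
    case 1
    then show ?thesis
      using product_mean_site[of y N p "\<lambda>b. p N * (1 - of_bool b)"]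
      by (simp add: product_mean_Suc)
  next
    case 2
    then show ?thesis
      using product_mean_site[of x N p "\<lambda>b. (1 - p N) * of_bool b"]
      by (simp add: product_mean_Suc)
  next
    case 3
    have "p N * A + (1 - p N) * A = A" for A
      by (simp add: algebra_simps)
    with 3 Suc show ?thesis
      by (simp add: product_mean_Suc del: of_bool_conj flip: of_bool_conj)
  qed
qed simp

lemma bernoulli_exp_le:
  fixes p a b d :: real
  assumes p: "0 \<le> p" "p \<le> 1" and d: "\<bar>a - b\<bar> \<le> d"
  shows "p * exp a + (1 - p) * exp b \<le> exp (p * a + (1 - p) * b + d\<^sup>2 / 8)"
proof -
  have le: "p * exp a + (1 - p) * exp b \<le> exp (p * a + (1 - p) * b + (a - b)\<^sup>2 / 8)"
    if "0 \<le> p" "p \<le> 1" "a \<ge> b" for p a b :: real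
  proof -
    define h where "h = a - b"
    have pos: "1 + p * (exp h - 1) > 0"
      using that by (intro add_pos_nonneg) (auto simp: h_def)
    have "ln (1 + p * (exp h - 1)) \<le> p * h + h\<^sup>2 / 8"
      using Hoeffdings_lemma_aux[of h p] that by (simp add: h_def algebra_simps)
    then have "1 + p * (exp h - 1) \<le> exp (p * h + h\<^sup>2 / 8)"
      using pos by (metis exp_le_cancel_iff exp_ln)
    then have "exp b * (1 + p * (exp h - 1)) \<le> exp b * exp (p * h + h\<^sup>2 / 8)"
      by (intro mult_left_mono) auto
    moreover have "exp b * (1 + p * (exp h - 1)) = p * exp a + (1 - p) * exp b"
      by (simp add: h_def exp_diff algebra_simps)
    moreover have "exp b * exp (p * h + h\<^sup>2 / 8) = exp (p * a + (1 - p) * b + (a - b)\<^sup>2 / 8)"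
      by (simp add: h_def algebra_simps flip: exp_add)
    ultimately show ?thesis by simp
  qed
  have "p * exp a + (1 - p) * exp b \<le> exp (p * a + (1 - p) * b + (a - b)\<^sup>2 / 8)"
    using le[of p b a] le[of "1 - p" a b] p
    by (cases "a \<ge> b") (simp_all add: add.commute power2_commute)
  also have "(a - b)\<^sup>2 \<le> d\<^sup>2"
    using d by (metis abs_ge_zero power2_abs power_mono)
  finally show ?thesis by simp
qed

text \<open>McDiarmid's method of bounded differences: averaging over the last site keeps the
  increments in the other sites bounded.\<close>

lemma product_mean_exp_le:
  assumes "\<And>x. x < N \<Longrightarrow> 0 \<le> p x \<and> p x \<le> 1"
    and "\<And>x \<xi>. x < N \<Longrightarrow> \<bar>f (\<xi>(x := True)) - f (\<xi>(x := False))\<bar> \<le> d x"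
  shows "product_mean p N (\<lambda>\<xi>. exp (f \<xi>)) \<le> exp (product_mean p N f + (\<Sum>x<N. (d x)\<^sup>2))"
  using assms
proof (induction N arbitrary: f)
  case (Suc n)
  define g where "g = (\<lambda>\<xi>. p n * f (\<xi>(n := True)) + (1 - p n) * f (\<xi>(n := False)))"
  have pn: "0 \<le> p n" "p n \<le> 1"
    using Suc.prems(1) by auto
  have "\<bar>g (\<xi>(x := True)) - g (\<xi>(x := False))\<bar> \<le> d x" if "x < n" for x \<xi>
  proof -
    let ?D = "\<lambda>b. f (\<xi>(n := b, x := True)) - f (\<xi>(n := b, x := False))"
    have "g (\<xi>(x := True)) - g (\<xi>(x := False)) = p n * ?D True + (1 - p n) * ?D False"
      using that by (simp add: g_def fun_upd_twist[of n x] algebra_simps)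
    also have "\<bar>\<dots>\<bar> \<le> p n * d x + (1 - p n) * d x"
      using Suc.prems(2)[of x "\<xi>(n := True)"] Suc.prems(2)[of x "\<xi>(n := False)"] that pn
      by (intro order_trans[OF abs_triangle_ineq] add_mono)
        (simp_all add: abs_mult mult_left_mono del: fun_upd_apply)
    finally show ?thesis by (simp add: algebra_simps)
  qed
  then have IH: "product_mean p n (\<lambda>\<xi>. exp (g \<xi>)) \<le> exp (product_mean p n g + (\<Sum>x<n. (d x)\<^sup>2))"
    using Suc.prems(1) by (intro Suc.IH) (auto simp del: fun_upd_apply)
  have "product_mean p (Suc n) (\<lambda>\<xi>. exp (f \<xi>)) \<le> product_mean p n (\<lambda>\<xi>. exp ((d n)\<^sup>2) * exp (g \<xi>))"
    unfolding product_mean_Suc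
  proof (rule product_mean_mono)
    fix \<xi>
    have "p n * exp (f (\<xi>(n := True))) + (1 - p n) * exp (f (\<xi>(n := False))) \<le> exp (g \<xi> + (d n)\<^sup>2 / 8)"
      unfolding g_def using Suc.prems(2)[of n] pn
        by (intro bernoulli_exp_le) (simp_all del: fun_upd_apply)
    also have "\<dots> \<le> exp (g \<xi> + (d n)\<^sup>2)"
      by simp
    finally show "p n * exp (f (\<xi>(n := True))) + (1 - p n) * exp (f (\<xi>(n := False)))
        \<le> exp ((d n)\<^sup>2) * exp (g \<xi>)"
      by (simp add: exp_add mult.commute)
  qed (use Suc.prems in auto)
  also have "\<dots> = exp ((d n)\<^sup>2) * product_mean p n (\<lambda>\<xi>. exp (g \<xi>))"
    by (rule product_mean_cmult)
  also have "\<dots> \<le> exp ((d n)\<^sup>2) * exp (product_mean p n g + (\<Sum>x<n. (d x)\<^sup>2))"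
    using IH by (intro mult_left_mono) auto
  also have "\<dots> = exp (product_mean p (Suc n) f + (\<Sum>x<Suc n. (d x)\<^sup>2))"
    unfolding product_mean_Suc[of p n f] g_def[symmetric] by (simp add: algebra_simps flip: exp_add)
  finally show ?case .
qed simp

lemma product_mean_deviation:
  assumes p: "\<And>x. x < N \<Longrightarrow> 0 \<le> p x \<and> p x \<le> 1"
    and f: "\<And>x \<xi>. x < N \<Longrightarrow> \<bar>f (\<xi>(x := True)) - f (\<xi>(x := False))\<bar> \<le> d x"
    and S: "(\<Sum>x<N. (d x)\<^sup>2) \<le> S" "S > 0" and a: "a \<ge> 0"
  shows "product_mean p N (\<lambda>\<xi>. of_bool (f \<xi> \<ge> product_mean p N f + a)) \<le> exp (- a\<^sup>2 / (4 * S))"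
proof -
  define l where "l = a / (2 * S)"
  have l: "l \<ge> 0" using S a by (simp add: l_def)
  let ?m = "product_mean p N f"
  have "product_mean p N (\<lambda>\<xi>. of_bool (f \<xi> \<ge> ?m + a)) \<le>
      product_mean p N (\<lambda>\<xi>. exp (- l * (?m + a)) * exp (l * f \<xi>))"
  proof (rule product_mean_mono[OF p])
    fix \<xi>
    show "of_bool (f \<xi> \<ge> ?m + a) \<le> exp (- l * (?m + a)) * exp (l * f \<xi>)"
    proof (cases "f \<xi> \<ge> ?m + a")
      case True
      then have "0 \<le> l * (f \<xi> - (?m + a))"
        using l by simp
      then show ?thesis
        by (simp add: algebra_simps flip: exp_add)
    qed simp
  qed
  also have "\<dots> = exp (- l * (?m + a)) * product_mean p N (\<lambda>\<xi>. exp (l * f \<xi>))"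
    by (rule product_mean_cmult)
  also have "\<dots> \<le> exp (- l * (?m + a)) * exp (product_mean p N (\<lambda>\<xi>. l * f \<xi>) + (\<Sum>x<N. (l * d x)\<^sup>2))"
    using f l by (intro mult_left_mono product_mean_exp_le p)
      (auto simp: abs_mult mult_left_mono simp flip: right_diff_distrib)
  also have "\<dots> = exp (- l * a + l\<^sup>2 * (\<Sum>x<N. (d x)\<^sup>2))"
    by (simp add: product_mean_cmult power_mult_distrib sum_distrib_left algebra_simps flip: exp_add)
  also have "\<dots> \<le> exp (- l * a + l\<^sup>2 * S)"
    using S by (simp add: mult_left_mono)
  also have "- l * a + l\<^sup>2 * S = - a\<^sup>2 / (4 * S)"
    using S by (simp add: l_def power2_eq_square field_simps)
  finally show ?thesis .
qed

subsection \<open>Monotonicity of the discrepancy\<close>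

definition arc_sum :: "nat \<Rightarrow> nat \<Rightarrow> nat \<Rightarrow> (nat \<Rightarrow> real) \<Rightarrow> real" where
  "arc_sum N a l g = (\<Sum>i<l. g ((a + 1 + i) mod N))"

definition discrepancy :: "nat \<Rightarrow> (nat \<Rightarrow> real) \<Rightarrow> real" where
  "discrepancy N g = Max ((\<lambda>(a, l). \<bar>arc_sum N a l g\<bar>) ` ({..<N} \<times> {..N}))"

lemma arc_sum_mod: "arc_sum N (a mod N) l g = arc_sum N a l g"
  unfolding arc_sum_def by (intro sum.cong refl arg_cong[of _ _ g]) (metis add.assoc mod_add_left_eq)

lemma abs_arc_sum_le_discrepancy:
  assumes "0 < N" "l \<le> N"
  shows "\<bar>arc_sum N a l g\<bar> \<le> discrepancy N g"
proof -
  have "\<bar>arc_sum N (a mod N) l g\<bar> \<in> (\<lambda>(a, l). \<bar>arc_sum N a l g\<bar>) ` ({..<N} \<times> {..N})"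
    using assms by (intro image_eqI[of _ _ "(a mod N, l)"]) auto
  then show ?thesis
    unfolding discrepancy_def arc_sum_mod by (intro Max_ge) auto
qed

lemma discrepancy_le:
  assumes "0 < N" "\<And>a l. a < N \<Longrightarrow> l \<le> N \<Longrightarrow> \<bar>arc_sum N a l g\<bar> \<le> B"
  shows "discrepancy N g \<le> B"
  unfolding discrepancy_def using assms by (subst Max_le_iff) auto

lemma discrepancy_nonneg: "0 < N \<Longrightarrow> 0 \<le> discrepancy N g"
  using abs_arc_sum_le_discrepancy[of N 0 0 g] by simp

lemma arc_sum_diff: "arc_sum N a l (\<lambda>x. g x - h x) = arc_sum N a l g - arc_sum N a l h"
  unfolding arc_sum_def by (rule sum_subtractf)

lemma discrepancy_triangle:
  assumes "0 < N"
  shows "discrepancy N (\<lambda>x. g x - k x) \<le> discrepancy N (\<lambda>x. g x - h x) + discrepancy N (\<lambda>x. h x - k x)"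
proof (rule discrepancy_le[OF assms])
  fix a l assume l: "l \<le> N"
  have "arc_sum N a l (\<lambda>x. g x - k x) = arc_sum N a l (\<lambda>x. g x - h x) + arc_sum N a l (\<lambda>x. h x - k x)"
    by (simp add: arc_sum_diff)
  then show "\<bar>arc_sum N a l (\<lambda>x. g x - k x)\<bar>
      \<le> discrepancy N (\<lambda>x. g x - h x) + discrepancy N (\<lambda>x. h x - k x)"
    using abs_arc_sum_le_discrepancy[OF assms l, of a "\<lambda>x. g x - h x"]
      abs_arc_sum_le_discrepancy[OF assms l, of a "\<lambda>x. h x - k x"] by linarith
qed

lemma discrepancy_commute: "discrepancy N (\<lambda>x. g x - h x) = discrepancy N (\<lambda>x. h x - g x)"
proof -
  have "\<bar>arc_sum N a l (\<lambda>x. g x - h x)\<bar> = \<bar>arc_sum N a l (\<lambda>x. h x - g x)\<bar>" for a l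
    by (simp add: arc_sum_diff abs_minus_commute)
  then show ?thesis by (simp add: discrepancy_def)
qed

lemma abs_arc_sum_le:
  assumes "0 < N" "\<And>x. x < N \<Longrightarrow> \<bar>g x\<bar> \<le> c"
  shows "\<bar>arc_sum N a l g\<bar> \<le> real l * c"
proof -
  have "\<bar>arc_sum N a l g\<bar> \<le> (\<Sum>i<l. c)"
    unfolding arc_sum_def using assms by (intro order_trans[OF sum_abs] sum_mono) auto
  then show ?thesis by simp
qed

lemma discrepancy_le_mult:
  assumes "0 < N" "\<And>x. x < N \<Longrightarrow> \<bar>g x\<bar> \<le> c"
  shows "discrepancy N g \<le> real N * c"
proof (rule discrepancy_le[OF assms(1)])
  fix a l assume l: "l \<le> N"
  have "0 \<le> c"
    using assms(2)[OF assms(1)] by linarith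
  then have "real l * c \<le> real N * c"
    using l by (intro mult_right_mono) auto
  then show "\<bar>arc_sum N a l g\<bar> \<le> real N * c"
    using abs_arc_sum_le[OF assms(1), of g c a l] assms(2) by fastforce
qed

lemma Suc_mod_eq_Suc_mod_iff:
  fixes x k N :: nat
  assumes "x < N"
  shows "(k + 1) mod N = (x + 1) mod N \<longleftrightarrow> k mod N = x"
proof -
  have "k mod N < N" "x mod N = x"
    using assms by auto
  then show ?thesis
    by (auto simp: mod_Suc split: if_splits)
qed

definition current :: "nat \<Rightarrow> config \<Rightarrow> nat \<Rightarrow> real" where
  "current N \<xi> x = of_bool (\<xi> x) * (1 - of_bool (\<xi> ((x + 1) mod N)))"

lemma jump_site:
  "(of_bool (jump N x \<xi> z) :: real) =
    of_bool (\<xi> z) + current N \<xi> x * (of_bool (z = (x + 1) mod N) - of_bool (z = x))"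
  by (auto simp: jump_def exchange_def current_def)

lemma arc_sum_jump:
  assumes "x < N"
  shows "arc_sum N a l (\<lambda>z. of_bool (jump N x \<xi> z)) = arc_sum N a l (\<lambda>z. of_bool (\<xi> z)) +
    current N \<xi> x * (of_bool (a mod N = x) - of_bool ((a + l) mod N = x))"
proof -
  have "arc_sum N a l (\<lambda>z. of_bool (jump N x \<xi> z)) - arc_sum N a l (\<lambda>z. of_bool (\<xi> z)) =
      (\<Sum>i<l. current N \<xi> x * (of_bool ((a + i) mod N = x) - of_bool ((a + Suc i) mod N = x)))"
    unfolding arc_sum_def sum_subtractf[symmetric]
  proof (intro sum.cong refl)
    fix i
    have "(a + 1 + i) mod N = (x + 1) mod N \<longleftrightarrow> (a + i) mod N = x"
      using Suc_mod_eq_Suc_mod_iff[OF assms, of "a + i"] by (simp add: add_ac)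
    then show "of_bool (jump N x \<xi> ((a + 1 + i) mod N)) - of_bool (\<xi> ((a + 1 + i) mod N)) =
        current N \<xi> x * (of_bool ((a + i) mod N = x) - of_bool ((a + Suc i) mod N = x))"
      unfolding jump_site by simp
  qed
  also have "\<dots> = current N \<xi> x * (of_bool (a mod N = x) - of_bool ((a + l) mod N = x))"
    unfolding sum_distrib_left[symmetric]
    by (subst sum_lessThan_telescope'[of "\<lambda>i. of_bool ((a + i) mod N = x)"]) simp
  finally show ?thesis by simp
qed

text \<open>The key monotonicity: when only one of the two configurations jumps across an endpoint of
  an arc, the new value is the old value of the arc with one site added or removed.\<close>

lemma discrepancy_jump_le:
  assumes x: "x < N"
  shows "discrepancy N (\<lambda>z. of_bool (jump N x \<xi> z) - of_bool (jump N x \<zeta> z)) \<le>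
    discrepancy N (\<lambda>z. of_bool (\<xi> z) - of_bool (\<zeta> z))"
proof (rule discrepancy_le)
  show N: "0 < N" using x by simp
  fix a l assume a: "a < N" and l: "l \<le> N"
  define g :: "nat \<Rightarrow> real" where "g = (\<lambda>z. of_bool (\<xi> z) - of_bool (\<zeta> z))"
  define D where "D = current N \<xi> x - current N \<zeta> x"
  define y where "y = (x + 1) mod N"
  have D: "D = 0 \<or> D = g x \<or> D = - g y"
    by (auto simp: D_def g_def y_def current_def)
  let ?A' = "arc_sum N a l (\<lambda>z. of_bool (jump N x \<xi> z) - of_bool (jump N x \<zeta> z))"
  have A': "?A' = arc_sum N a l g + D * (of_bool (a mod N = x) - of_bool ((a + l) mod N = x))"
    unfolding arc_sum_diff arc_sum_jump[OF x] by (simp add: g_def D_def arc_sum_diff algebra_simps)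
  have "\<exists>b k. k \<le> N \<and> ?A' = arc_sum N b k g"
  proof (cases "D = 0 \<or> (a mod N = x \<longleftrightarrow> (a + l) mod N = x)")
    case True
    then have "?A' = arc_sum N a l g"
      using A' by auto
    then show ?thesis
      using l by blast
  next
    case nz: False
    then have "l \<noteq> 0" "l \<noteq> N"
      by (metis add_0_right, metis mod_add_self2)
    then have l': "0 < l" "l < N"
      using l by auto
    then obtain k where k: "l = Suc k"
      by (cases l) auto
    show ?thesis
    proof (cases "a mod N = x")
      case True
      then have ax: "a = x" and A1: "?A' = arc_sum N a l g + D"
        using A' nz a by auto
      show ?thesis
      proof (cases "D = g x")
        case True
        have "(a + (N - 1) + 1 + k) mod N = (a + k) mod N" for k
        proof -
          have "a + (N - 1) + 1 + k = a + k + N"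
            using N by simp
          then show ?thesis by (simp only: mod_add_self2)
        qed
        then have "arc_sum N (a + (N - 1)) (Suc l) g = g ((a + 0) mod N) + (\<Sum>i<l. g ((a + Suc i) mod N))"
          unfolding arc_sum_def sum.lessThan_Suc_shift by (simp only:)
        then have "arc_sum N (a + (N - 1)) (Suc l) g = g x + arc_sum N a l g"
          using x by (simp add: ax arc_sum_def)
        then show ?thesis
          using A1 True l' by (intro exI[of _ "a + (N - 1)"] exI[of _ "Suc l"]) simp
      next
        case False
        then have "D = - g y" using D nz by auto
        moreover have "arc_sum N a l g = g y + arc_sum N (a + 1) k g"
          unfolding arc_sum_def k sum.lessThan_Suc_shift by (simp add: ax y_def)
        ultimately show ?thesis
          using A1 k l by (intro exI[of _ "a + 1"] exI[of _ k]) simp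
      qed
    next
      case notx: False
      then have e: "(a + l) mod N = x" and A1: "?A' = arc_sum N a l g - D"
        using A' nz by auto
      show ?thesis
      proof (cases "D = g x")
        case True
        have "arc_sum N a l g = arc_sum N a k g + g x"
          using e unfolding arc_sum_def k by simp
        then show ?thesis
          using A1 True l k by (intro exI[of _ a] exI[of _ k]) simp
      next
        case False
        then have "D = - g y" using D nz by auto
        moreover have "(a + 1 + l) mod N = y"
          unfolding y_def e[symmetric] by (simp add: mod_simps)
        then have "arc_sum N a (Suc l) g = arc_sum N a l g + g y"
          unfolding arc_sum_def by simp
        ultimately show ?thesis
          using A1 l' by (intro exI[of _ a] exI[of _ "Suc l"]) simp
      qed
    qed
  qed
  then show "\<bar>?A'\<bar> \<le> discrepancy N (\<lambda>z. of_bool (\<xi> z) - of_bool (\<zeta> z))"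
    using abs_arc_sum_le_discrepancy[OF N] by (auto simp: g_def)
qed

lemma tasep_semigroup_discrepancy_lipschitz:
  assumes "0 < N" "t \<ge> 0"
  shows "tasep_semigroup N t (\<lambda>\<xi>. discrepancy N (\<lambda>x. of_bool (\<xi> x) - p x)) \<xi> \<le>
    tasep_semigroup N t (\<lambda>\<xi>. discrepancy N (\<lambda>x. of_bool (\<xi> x) - p x)) \<zeta> +
    discrepancy N (\<lambda>x. of_bool (\<xi> x) - of_bool (\<zeta> x))"
proof -
  let ?f = "\<lambda>\<xi>. discrepancy N (\<lambda>x. of_bool (\<xi> x) - p x)"
  let ?d = "\<lambda>\<xi> \<zeta> :: config. discrepancy N (\<lambda>x. of_bool (\<xi> x) - of_bool (\<zeta> x))"
  define B where "B = (\<Sum>x<N. \<bar>p x\<bar>) + 1"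
  have "\<bar>?f \<xi>\<bar> \<le> real N * B" for \<xi>
  proof -
    have "\<bar>of_bool (\<xi> x) - p x\<bar> \<le> B" if "x < N" for x
    proof -
      have "\<bar>p x\<bar> \<le> (\<Sum>x<N. \<bar>p x\<bar>)"
        using that by (intro member_le_sum) auto
      then show ?thesis by (auto simp: B_def of_bool_def)
    qed
    then show ?thesis
      using discrepancy_le_mult[OF assms(1), of "\<lambda>x. of_bool (\<xi> x) - p x" B]
        discrepancy_nonneg[OF assms(1)] by simp
  qed
  then have bd: "bounded (range ?f)"
    by (rule bounded_range_realI)
  have lip: "\<bar>?f \<xi> - ?f \<zeta>\<bar> \<le> ?d \<xi> \<zeta>" for \<xi> \<zeta>
    using discrepancy_triangle[OF assms(1), of "\<lambda>x. of_bool (\<xi> x)" p "\<lambda>x. of_bool (\<zeta> x)"]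
      discrepancy_triangle[OF assms(1), of "\<lambda>x. of_bool (\<zeta> x)" p "\<lambda>x. of_bool (\<xi> x)"]
      discrepancy_commute[of N "\<lambda>x. of_bool (\<zeta> x)" "\<lambda>x. of_bool (\<xi> x)"]
    by linarith
  have "\<bar>tasep_semigroup N t ?f \<xi> - tasep_semigroup N t ?f \<zeta>\<bar> \<le> ?d \<xi> \<zeta>"
    using tasep_semigroup_contraction[where d = ?d, OF bd assms(2) _ lip] discrepancy_jump_le by blast
  then show ?thesis by linarith
qed

lemma sum_rotate:
  fixes f :: "nat \<Rightarrow> real"
  shows "(\<Sum>x<N. f ((x + 1) mod N)) = (\<Sum>x<N. f x)"
proof (cases N)
  case (Suc n)
  have "(\<Sum>x<n. f ((x + 1) mod N)) = (\<Sum>x<n. f (Suc x))"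
    using Suc by (intro sum.cong) auto
  then have "(\<Sum>x<N. f ((x + 1) mod N)) = f 0 + (\<Sum>x<n. f (Suc x))"
    using Suc by simp
  also have "\<dots> = (\<Sum>x<N. f x)"
    unfolding Suc sum.lessThan_Suc_shift by simp
  finally show ?thesis .
qed simp

lemma gronwall_linear:
  fixes u u' :: "real \<Rightarrow> real"
  assumes s: "0 \<le> s" and e: "0 \<le> e"
    and u: "\<And>r. 0 \<le> r \<Longrightarrow> r \<le> s \<Longrightarrow> (u has_real_derivative u' r) (at r)"
    and le: "\<And>r. 0 \<le> r \<Longrightarrow> r \<le> s \<Longrightarrow> u' r \<le> b * u r + e"
  shows "u s \<le> exp (b * s) * (u 0 + s * e * exp (\<bar>b\<bar> * s))"
proof -
  define w where "w = (\<lambda>r. u r * exp (- b * r) - e * exp (\<bar>b\<bar> * s) * r)"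
  have "w s \<le> w 0"
  proof (rule DERIV_nonpos_imp_nonincreasing[OF s])
    fix r assume r: "0 \<le> r" "r \<le> s"
    have "(w has_real_derivative (u' r - b * u r) * exp (- b * r) - e * exp (\<bar>b\<bar> * s)) (at r)"
      unfolding w_def using u[OF r] by (auto intro!: derivative_eq_intros simp: algebra_simps)
    moreover have "(u' r - b * u r) * exp (- b * r) \<le> e * exp (- b * r)"
      using le[OF r] by (intro mult_right_mono) auto
    moreover have "- b * r \<le> \<bar>b\<bar> * s"
      using r by (metis abs_ge_minus_self abs_ge_zero mult_mono)
    then have "e * exp (- b * r) \<le> e * exp (\<bar>b\<bar> * s)"
      using e by (intro mult_left_mono) auto
    ultimately show "\<exists>y. (w has_real_derivative y) (at r) \<and> y \<le> 0"
      by (intro exI conjI) (assumption, linarith)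
  qed
  then have "u s * exp (- b * s) \<le> u 0 + s * e * exp (\<bar>b\<bar> * s)"
    by (simp add: w_def algebra_simps)
  then have "exp (b * s) * (u s * exp (- b * s)) \<le> exp (b * s) * (u 0 + s * e * exp (\<bar>b\<bar> * s))"
    by (intro mult_left_mono) auto
  then show ?thesis
    by (simp add: exp_minus mult.left_commute)
qed

lemma exp_le_quadratic:
  fixes y :: real
  assumes "y \<le> 1"
  shows "exp y \<le> 1 + y + y\<^sup>2"
proof (cases "y \<ge> 0")
  case True
  then show ?thesis using assms exp_bound by auto
next
  case False
  have 1: "1 - y + y\<^sup>2 / 2 \<le> exp (- y)"
    using exp_lower_Taylor_quadratic[of "- y"] False by simp
  have "(1 + y + y\<^sup>2) * (1 - y + y\<^sup>2 / 2) = 1 + y\<^sup>2 / 2 - y * y\<^sup>2 / 2 + (y\<^sup>2)\<^sup>2 / 2"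
    by (simp add: power2_eq_square field_simps)
  moreover have "y * y\<^sup>2 \<le> 0"
    using False by (simp add: mult_nonpos_nonneg)
  ultimately have 2: "1 \<le> (1 + y + y\<^sup>2) * (1 - y + y\<^sup>2 / 2)"
    using zero_le_power2[of y] zero_le_power2[of "y\<^sup>2"] by linarith
  have "1 + y + y\<^sup>2 = ((1 + 2 * y)\<^sup>2 + 3) / 4"
    by (simp add: power2_eq_square field_simps)
  also have "0 \<le> \<dots>"
    by simp
  finally have "0 \<le> 1 + y + y\<^sup>2" .
  with 1 have "(1 + y + y\<^sup>2) * (1 - y + y\<^sup>2 / 2) \<le> (1 + y + y\<^sup>2) * exp (- y)"
    by (intro mult_left_mono) auto
  with 2 have "1 \<le> (1 + y + y\<^sup>2) * exp (- y)"
    by linarith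
  then have "1 * exp y \<le> (1 + y + y\<^sup>2) * exp (- y) * exp y"
    by (intro mult_right_mono) auto
  also have "\<dots> = 1 + y + y\<^sup>2"
    by (simp only: mult.assoc exp_add[symmetric]) simp
  finally show ?thesis by simp
qed

lemma product_mean_local_deviation:
  fixes c :: "nat \<Rightarrow> real"
  assumes p: "\<And>x. x < N \<Longrightarrow> 0 \<le> p x \<and> p x \<le> 1" and N: "0 < N"
    and G: "\<And>a b. 0 \<le> G a b \<and> G a b \<le> (1 :: real)"
    and c: "(\<Sum>x<N. (c x)\<^sup>2) \<le> S" "S > 0" and a: "a \<ge> 0"
  defines "F \<equiv> \<lambda>\<xi>. \<Sum>x<N. c x * G (\<xi> x) (\<xi> ((x + 1) mod N))"
  shows "product_mean p N (\<lambda>\<xi>. of_bool (F \<xi> \<ge> product_mean p N F + a)) \<le> exp (- a\<^sup>2 / (16 * S))"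
proof -
  define d where "d = (\<lambda>z. \<bar>c z\<bar> + \<bar>c ((z + N - 1) mod N)\<bar>)"
  have pred: "((x + 1) mod N + N - 1) mod N = x" if "x < N" for x
    using that by (cases "x + 1 = N") auto
  have diff: "\<bar>F (\<xi>(z := True)) - F (\<xi>(z := False))\<bar> \<le> d z" if z: "z < N" for z \<xi>
  proof -
    define k where "k = (z + N - 1) mod N"
    have k: "k < N" using N by (simp add: k_def)
    let ?h = "\<lambda>x. (if x = z then \<bar>c x\<bar> else 0) + (if x = k then \<bar>c x\<bar> else 0)"
    define D where "D = (\<lambda>x. G ((\<xi>(z := True)) x) ((\<xi>(z := True)) ((x + 1) mod N)) -
      G ((\<xi>(z := False)) x) ((\<xi>(z := False)) ((x + 1) mod N)))"
    have "F (\<xi>(z := True)) - F (\<xi>(z := False)) = (\<Sum>x<N. c x * D x)"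
      unfolding F_def D_def by (simp add: sum_subtractf right_diff_distrib)
    also have "\<bar>\<dots>\<bar> \<le> (\<Sum>x<N. ?h x)"
    proof (intro order_trans[OF sum_abs] sum_mono)
      fix x assume "x \<in> {..<N}"
      then have x: "x < N" by simp
      have "\<bar>c x * D x\<bar> \<le> \<bar>c x\<bar>"
      proof -
        have "\<bar>D x\<bar> \<le> 1"
          using G[of "(\<xi>(z := True)) x" "(\<xi>(z := True)) ((x + 1) mod N)"]
            G[of "(\<xi>(z := False)) x" "(\<xi>(z := False)) ((x + 1) mod N)"]
          unfolding D_def by linarith
        then show ?thesis
          by (simp add: abs_mult mult_left_le)
      qed
      moreover have "D x = 0" if "x \<noteq> z" "(x + 1) mod N \<noteq> z"
        using that by (simp add: D_def)
      moreover have "x = k" if "(x + 1) mod N = z"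
        using pred[OF x] that by (simp add: k_def)
      ultimately show "\<bar>c x * D x\<bar> \<le> ?h x"
        by (cases "x = z"; cases "(x + 1) mod N = z") auto
    qed
    also have "\<dots> = d z"
      using z k unfolding sum.distrib d_def k_def[symmetric] by simp
    finally show ?thesis .
  qed
  have "(\<Sum>z<N. (d z)\<^sup>2) \<le> (\<Sum>z<N. 2 * (c z)\<^sup>2 + 2 * (c ((z + N - 1) mod N))\<^sup>2)"
  proof (rule sum_mono)
    fix z
    show "(d z)\<^sup>2 \<le> 2 * (c z)\<^sup>2 + 2 * (c ((z + N - 1) mod N))\<^sup>2"
      unfolding d_def using sum_squares_bound[of "\<bar>c z\<bar>" "\<bar>c ((z + N - 1) mod N)\<bar>"]
      by (simp add: power2_sum)
  qed
  also have "\<dots> = 2 * (\<Sum>z<N. (c z)\<^sup>2) + 2 * (\<Sum>z<N. (c ((z + N - 1) mod N))\<^sup>2)"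
    by (simp add: sum.distrib sum_distrib_left)
  also have "(\<Sum>z<N. (c ((z + N - 1) mod N))\<^sup>2) = (\<Sum>x<N. (c (((x + 1) mod N + N - 1) mod N))\<^sup>2)"
    by (rule sum_rotate[symmetric])
  also have "\<dots> = (\<Sum>x<N. (c x)\<^sup>2)"
    by (intro sum.cong refl) (simp only: pred lessThan_iff)
  finally have "(\<Sum>z<N. (d z)\<^sup>2) \<le> 4 * S"
    using c by linarith
  from product_mean_deviation[OF p diff this _ a] c show ?thesis
    by simp
qed

subsection \<open>The adjoint of the generator\<close>

definition adjoint_drift :: "(nat \<Rightarrow> real) \<Rightarrow> nat \<Rightarrow> config \<Rightarrow> real" where
  "adjoint_drift p N \<xi> = (\<Sum>x<N. (p x - p ((x + 1) mod N)) / ((1 - p x) * p ((x + 1) mod N)) *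
     ((1 - of_bool (\<xi> x)) * of_bool (\<xi> ((x + 1) mod N))))"

lemma Suc_mod_neq:
  fixes x N :: nat
  assumes "x < N" "2 \<le> N"
  shows "(x + 1) mod N \<noteq> x" "(x + 1) mod N < N"
  using assms by (cases "x + 1 = N"; simp)+

lemma exchange_exchange: "exchange x y (exchange x y \<xi>) = \<xi>"
  by (auto simp: exchange_def fun_eq_iff)

lemma exchange_in_configs:
  assumes "\<xi> \<in> configs N" "x < N" "y < N"
  shows "exchange x y \<xi> \<in> configs N"
  using assms by (auto simp: exchange_def configs_def)

lemma bernoulli_weight_exchange:
  assumes "x < N" "y < N" "x \<noteq> y" "\<not> \<xi> x" "\<xi> y" "p x \<noteq> 1" "p y \<noteq> 0"
  shows "bernoulli_weight p N (exchange x y \<xi>) =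
    bernoulli_weight p N \<xi> * (p x * (1 - p y) / ((1 - p x) * p y))"
proof -
  define R where "R = {..<N} - {x, y}"
  have "{..<N} = insert x (insert y R)"
    using assms by (auto simp: R_def)
  moreover have "(\<Prod>z\<in>R. if exchange x y \<xi> z then p z else 1 - p z) = (\<Prod>z\<in>R. if \<xi> z then p z else 1 - p z)"
    by (intro prod.cong) (auto simp: R_def exchange_def)
  moreover have "finite R" "x \<notin> R" "y \<notin> R"
    by (auto simp: R_def)
  ultimately show ?thesis
    unfolding bernoulli_weight_def using assms by (simp add: exchange_def)
qed

lemma product_mean_generator:
  assumes N: "2 \<le> N" and p: "\<And>x. x < N \<Longrightarrow> 0 < p x \<and> p x < 1"
  shows "product_mean p N (tasep_generator N g) = product_mean p N (\<lambda>\<xi>. adjoint_drift p N \<xi> * g \<xi>)"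
proof -
  let ?y = "\<lambda>x. (x + 1) mod N"
  let ?b = "\<lambda>x \<xi>. (1 - of_bool (\<xi> x)) * of_bool (\<xi> (?y x)) :: real"
  let ?t = "\<lambda>x. p x * (1 - p (?y x)) / ((1 - p x) * p (?y x))"
  have flip: "product_mean p N (\<lambda>\<xi>. current N \<xi> x * g (exchange x (?y x) \<xi>)) =
      product_mean p N (\<lambda>\<xi>. ?t x * ?b x \<xi> * g \<xi>)" if x: "x < N" for x
  proof -
    note y = Suc_mod_neq[OF x N]
    have "product_mean p N (\<lambda>\<xi>. current N \<xi> x * g (exchange x (?y x) \<xi>)) =
        (\<Sum>\<xi>\<in>configs N. bernoulli_weight p N (exchange x (?y x) \<xi>) * (current N (exchange x (?y x) \<xi>) x * g \<xi>))"
      unfolding product_mean_def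
      by (rule sum.reindex_bij_witness[of _ "exchange x (?y x)" "exchange x (?y x)"])
        (simp_all only: exchange_exchange exchange_in_configs[OF _ x y(2)])
    also have "\<dots> = product_mean p N (\<lambda>\<xi>. ?t x * ?b x \<xi> * g \<xi>)"
      unfolding product_mean_def
    proof (intro sum.cong refl)
      fix \<xi>
      show "bernoulli_weight p N (exchange x (?y x) \<xi>) * (current N (exchange x (?y x) \<xi>) x * g \<xi>) =
        bernoulli_weight p N \<xi> * (?t x * ?b x \<xi> * g \<xi>)"
      proof (cases "\<not> \<xi> x \<and> \<xi> (?y x)")
        case True
        then have "bernoulli_weight p N (exchange x (?y x) \<xi>) = bernoulli_weight p N \<xi> * ?t x"
          using x y p[OF x] p[OF y(2)] by (intro bernoulli_weight_exchange) auto
        moreover have "current N (exchange x (?y x) \<xi>) x = 1"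
          using True y by (simp add: current_def exchange_def)
        ultimately show ?thesis
          using True by simp
      next
        case False
        then have "current N (exchange x (?y x) \<xi>) x = 0"
          using y by (auto simp: current_def exchange_def)
        then show ?thesis
          using False by auto
      qed
    qed
    finally show ?thesis .
  qed
  have "product_mean p N (tasep_generator N g) =
      product_mean p N (\<lambda>\<xi>. \<Sum>x<N. current N \<xi> x * g (exchange x (?y x) \<xi>) + (-1) * (current N \<xi> x * g \<xi>))"
    by (intro arg_cong[where f = "product_mean p N"] ext)
      (simp add: tasep_generator_def current_def algebra_simps)
  also have "\<dots> = product_mean p N (\<lambda>\<xi>. \<Sum>x<N. ?t x * ?b x \<xi> * g \<xi> + (-1) * (current N \<xi> x * g \<xi>))"
    unfolding product_mean_sum product_mean_add
    by (intro sum.cong refl arg_cong2[where f = plus] flip) simp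
  also have "\<dots> = product_mean p N (\<lambda>\<xi>. adjoint_drift p N \<xi> * g \<xi>)"
  proof (rule product_mean_cong)
    fix \<xi>
    have "(\<Sum>x<N. ?b x \<xi> - current N \<xi> x) = (\<Sum>x<N. of_bool (\<xi> (?y x)) - of_bool (\<xi> x))"
      by (intro sum.cong refl) (auto simp: current_def)
    also have "\<dots> = 0"
      using sum_rotate[of "\<lambda>x. of_bool (\<xi> x)" N] by (simp add: sum_subtractf)
    finally have 0: "(\<Sum>x<N. ?b x \<xi> - current N \<xi> x) = 0" .
    have t: "?t x - 1 = (p x - p (?y x)) / ((1 - p x) * p (?y x))" if "x < N" for x
      using p[OF that] p[OF Suc_mod_neq(2)[OF that N]] by (simp add: field_simps)
    have "(\<Sum>x<N. ?t x * ?b x \<xi> * g \<xi> + (-1) * (current N \<xi> x * g \<xi>)) =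
        (\<Sum>x<N. ((?t x - 1) * ?b x \<xi> + (?b x \<xi> - current N \<xi> x)) * g \<xi>)"
      by (intro sum.cong refl) (simp add: algebra_simps)
    also have "\<dots> = (\<Sum>x<N. (?t x - 1) * ?b x \<xi>) * g \<xi>"
      unfolding sum_distrib_right[symmetric] sum.distrib 0 by simp
    also have "(\<Sum>x<N. (?t x - 1) * ?b x \<xi>) = adjoint_drift p N \<xi>"
      unfolding adjoint_drift_def by (intro sum.cong refl) (simp only: t lessThan_iff)
    finally show "(\<Sum>x<N. ?t x * ?b x \<xi> * g \<xi> + (-1) * (current N \<xi> x * g \<xi>)) = adjoint_drift p N \<xi> * g \<xi>" .
  qed
  finally show ?thesis .
qed

lemma product_mean_adjoint_drift:
  assumes N: "2 \<le> N" and p: "\<And>x. x < N \<Longrightarrow> 0 < p x \<and> p x < 1"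
  shows "product_mean p N (adjoint_drift p N) = 0"
proof -
  have "tasep_generator N (\<lambda>_. 1) = (\<lambda>_. 0)"
    by (simp add: tasep_generator_def fun_eq_iff)
  then show ?thesis
    using product_mean_generator[where g = "\<lambda>_. 1" and p = p, OF N p] by simp
qed

lemma has_real_derivative_product_mean_semigroup:
  assumes "bounded (range f)"
  shows "((\<lambda>t. product_mean p N (tasep_semigroup N t f)) has_real_derivative
    product_mean p N (tasep_semigroup N t (tasep_generator N f))) (at t)"
  unfolding product_mean_def
  by (intro DERIV_sum DERIV_cmult has_real_derivative_tasep_semigroup assms)

text \<open>The adjoint drift has mean zero, so it exceeds \<open>b\<close> only with exponentially small
  probability; taking \<open>b\<close> and the (macroscopic) time both of order \<open>\<delta>\<close>, the law of the process
  is dominated by the product measure up to a factor \<open>exp (O(\<delta>\<^sup>2) N)\<close> instead of the trivial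
  \<open>exp (O(\<delta>) N)\<close>.\<close>

lemma product_mean_semigroup_le:
  assumes N: "2 \<le> N" and p: "\<And>x. x < N \<Longrightarrow> 0 < p x \<and> p x < 1"
    and C: "\<And>\<xi>. \<bar>adjoint_drift p N \<xi>\<bar> \<le> C" and f: "\<And>\<xi>. 0 \<le> f \<xi> \<and> f \<xi> \<le> 1"
    and b: "0 \<le> b" and r: "0 \<le> r" "r \<le> s"
  shows "product_mean p N (tasep_semigroup N r f) \<le>
    exp (2 * b * s) * (product_mean p N f + s * C * product_mean p N (\<lambda>\<xi>. of_bool (adjoint_drift p N \<xi> \<ge> b)))"
proof -
  have bd: "bounded (range f)"
    using f by (intro bounded_range_realI[of _ 1]) (auto simp: abs_le_iff intro: order_trans)
  have p': "0 \<le> p x \<and> p x \<le> 1" if "x < N" for x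
    using p[OF that] by auto
  have C0: "0 \<le> C"
    using C[of "\<lambda>_. False"] by linarith
  define q where "q = product_mean p N (\<lambda>\<xi>. of_bool (adjoint_drift p N \<xi> \<ge> b))"
  have q: "0 \<le> q"
    unfolding q_def by (intro product_mean_nonneg p') auto
  let ?u = "\<lambda>t. product_mean p N (tasep_semigroup N t f)"
  have "?u r \<le> exp (b * r) * (?u 0 + r * (C * q) * exp (\<bar>b\<bar> * r))"
  proof (rule gronwall_linear)
    fix t :: real assume t: "0 \<le> t"
    have h: "0 \<le> tasep_semigroup N t f \<xi>" "tasep_semigroup N t f \<xi> \<le> 1" for \<xi>
      using tasep_semigroup_nonneg[OF bd _ t] abs_tasep_semigroup_le[of f 1 t N \<xi>] f t
      by (auto simp: abs_le_iff)
    have "product_mean p N (tasep_semigroup N t (tasep_generator N f)) =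
        product_mean p N (tasep_generator N (tasep_semigroup N t f))"
      using tasep_generator_semigroup[OF bd] by (intro product_mean_cong) simp
    also have "\<dots> = product_mean p N (\<lambda>\<xi>. adjoint_drift p N \<xi> * tasep_semigroup N t f \<xi>)"
      by (rule product_mean_generator[OF N p])
    also have "\<dots> \<le> product_mean p N (\<lambda>\<xi>. b * tasep_semigroup N t f \<xi> + C * of_bool (adjoint_drift p N \<xi> \<ge> b))"
    proof (rule product_mean_mono[OF p'])
      fix \<xi>
      show "adjoint_drift p N \<xi> * tasep_semigroup N t f \<xi> \<le>
        b * tasep_semigroup N t f \<xi> + C * of_bool (adjoint_drift p N \<xi> \<ge> b)"
      proof (cases "adjoint_drift p N \<xi> \<ge> b")
        case True
        then have "adjoint_drift p N \<xi> * tasep_semigroup N t f \<xi> \<le> C * 1"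
          using C[of \<xi>] h[of \<xi>] C0 by (intro mult_mono) auto
        moreover have "0 \<le> b * tasep_semigroup N t f \<xi>"
          using b h by simp
        ultimately show ?thesis using True by simp
      next
        case False
        then show ?thesis using h[of \<xi>] by (simp add: mult_right_mono)
      qed
    qed
    also have "\<dots> = b * ?u t + C * q"
      unfolding q_def by (rule product_mean_lin)
    finally show "product_mean p N (tasep_semigroup N t (tasep_generator N f)) \<le> b * ?u t + C * q" .
  qed (use r C0 q in \<open>auto intro!: has_real_derivative_product_mean_semigroup bd\<close>)
  also have "\<dots> = exp (b * r) * (product_mean p N f + r * C * q * exp (b * r))"
    using b product_mean_cong[of N "tasep_semigroup N 0 f" f p] by (simp add: tasep_semigroup_0 mult.assoc)
  also have "\<dots> \<le> exp (b * s) * (product_mean p N f * exp (b * s) + s * C * q * exp (b * s))"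
  proof -
    have brs: "b * r \<le> b * s"
      using b r by (intro mult_left_mono) auto
    have f0: "0 \<le> product_mean p N f"
      using f by (intro product_mean_nonneg p') auto
    have "1 \<le> exp (b * s)"
      using b r by simp
    then have "product_mean p N f \<le> product_mean p N f * exp (b * s)"
      using f0 by (simp add: mult_le_cancel_left1)
    moreover have "r * C * q * exp (b * r) \<le> s * C * q * exp (b * s)"
      using brs r C0 q by (intro mult_mono) auto
    ultimately show ?thesis
      using brs f0 r C0 q by (intro mult_mono add_mono) (auto intro!: add_nonneg_nonneg mult_nonneg_nonneg)
  qed
  also have "\<dots> = exp (2 * b * s) * (product_mean p N f + s * C * q)"
    by (simp add: algebra_simps flip: exp_add)
  finally show ?thesis unfolding q_def .
qed

subsection \<open>Exponential moments of weighted particle numbers\<close>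

definition weighted_count :: "nat \<Rightarrow> (nat \<Rightarrow> real) \<Rightarrow> config \<Rightarrow> real" where
  "weighted_count N \<phi> \<xi> = (\<Sum>x<N. \<phi> x * of_bool (\<xi> x))"

definition ring_diff :: "nat \<Rightarrow> (nat \<Rightarrow> real) \<Rightarrow> nat \<Rightarrow> real" where
  "ring_diff N \<phi> x = \<phi> ((x + 1) mod N) - \<phi> x"

definition weighted_current :: "nat \<Rightarrow> (nat \<Rightarrow> real) \<Rightarrow> config \<Rightarrow> real" where
  "weighted_current N \<phi> \<xi> = (\<Sum>x<N. ring_diff N \<phi> x * current N \<xi> x)"

lemma current_bounds: "0 \<le> current N \<xi> x" "current N \<xi> x \<le> 1"
  by (auto simp: current_def)

lemma weighted_count_exchange:
  assumes "x < N" "2 \<le> N" "\<xi> x" "\<not> \<xi> ((x + 1) mod N)"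
  shows "weighted_count N \<phi> (exchange x ((x + 1) mod N) \<xi>) = weighted_count N \<phi> \<xi> + ring_diff N \<phi> x"
proof -
  define y where "y = (x + 1) mod N"
  have y: "y \<noteq> x" "y < N"
    using Suc_mod_neq[OF assms(1,2)] by (auto simp: y_def)
  define R where "R = {..<N} - {x, y}"
  have "{..<N} = insert x (insert y R)" "finite R" "x \<notin> R" "y \<notin> R"
    using assms y by (auto simp: R_def)
  moreover have "(\<Sum>z\<in>R. \<phi> z * of_bool (exchange x y \<xi> z)) = (\<Sum>z\<in>R. \<phi> z * of_bool (\<xi> z))"
    by (intro sum.cong) (auto simp: R_def exchange_def)
  moreover have "\<not> \<xi> y"
    using assms(4) by (simp add: y_def)
  ultimately show ?thesis
    unfolding weighted_count_def ring_diff_def y_def[symmetric]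
    using assms(3) y by (simp add: exchange_def del: sum_mult_of_bool_eq)
qed

lemma tasep_generator_exp_le:
  assumes N: "2 \<le> N" and d: "\<And>x. x < N \<Longrightarrow> \<bar>ring_diff N \<phi> x\<bar> \<le> 1"
    and S: "(\<Sum>x<N. (ring_diff N \<phi> x)\<^sup>2) \<le> S" and t: "0 \<le> t" "t \<le> 1"
  shows "tasep_generator N (\<lambda>\<xi>. exp (t * weighted_count N \<phi> \<xi>)) \<xi> \<le>
    exp (t * weighted_count N \<phi> \<xi>) * (t * weighted_current N \<phi> \<xi> + t\<^sup>2 * S)"
proof -
  let ?X = "weighted_count N \<phi>"
  have "tasep_generator N (\<lambda>\<xi>. exp (t * ?X \<xi>)) \<xi> =
      (\<Sum>x<N. exp (t * ?X \<xi>) * (current N \<xi> x * (exp (t * ring_diff N \<phi> x) - 1)))"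
    unfolding tasep_generator_def
  proof (intro sum.cong refl)
    fix x assume "x \<in> {..<N}"
    then have x: "x < N" by simp
    show "of_bool (\<xi> x) * (1 - of_bool (\<xi> ((x + 1) mod N))) *
         (exp (t * ?X (exchange x ((x + 1) mod N) \<xi>)) - exp (t * ?X \<xi>)) =
         exp (t * ?X \<xi>) * (current N \<xi> x * (exp (t * ring_diff N \<phi> x) - 1))"
      using weighted_count_exchange[OF x N, of \<xi> \<phi>]
      by (cases "\<xi> x \<and> \<not> \<xi> ((x + 1) mod N)") (auto simp: current_def algebra_simps exp_add)
  qed
  also have "\<dots> \<le> (\<Sum>x<N. exp (t * ?X \<xi>) * (t * (ring_diff N \<phi> x * current N \<xi> x) + t\<^sup>2 * (ring_diff N \<phi> x)\<^sup>2))"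
  proof (intro sum_mono mult_left_mono)
    fix x assume "x \<in> {..<N}"
    then have "\<bar>t * ring_diff N \<phi> x\<bar> \<le> 1 * 1"
      unfolding abs_mult using t d by (intro mult_mono) auto
    then have "exp (t * ring_diff N \<phi> x) - 1 \<le> t * ring_diff N \<phi> x + (t * ring_diff N \<phi> x)\<^sup>2"
      using exp_le_quadratic[of "t * ring_diff N \<phi> x"] by (simp add: abs_le_iff)
    then have "current N \<xi> x * (exp (t * ring_diff N \<phi> x) - 1) \<le>
        current N \<xi> x * (t * ring_diff N \<phi> x + (t * ring_diff N \<phi> x)\<^sup>2)"
      using current_bounds by (intro mult_left_mono) auto
    also have "\<dots> \<le> current N \<xi> x * (t * ring_diff N \<phi> x) + 1 * (t * ring_diff N \<phi> x)\<^sup>2"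
      unfolding distrib_left using current_bounds by (intro add_left_mono mult_right_mono) auto
    finally show "current N \<xi> x * (exp (t * ring_diff N \<phi> x) - 1) \<le>
        t * (ring_diff N \<phi> x * current N \<xi> x) + t\<^sup>2 * (ring_diff N \<phi> x)\<^sup>2"
      by (simp add: power_mult_distrib mult_ac)
  qed auto
  also have "\<dots> = exp (t * ?X \<xi>) * (t * weighted_current N \<phi> \<xi> + t\<^sup>2 * (\<Sum>x<N. (ring_diff N \<phi> x)\<^sup>2))"
    unfolding weighted_current_def by (simp only: sum_distrib_left[symmetric] sum.distrib)
  also have "\<dots> \<le> exp (t * ?X \<xi>) * (t * weighted_current N \<phi> \<xi> + t\<^sup>2 * S)"
    using S by (intro mult_left_mono add_left_mono) auto
  finally show ?thesis .
qed

lemma abs_weighted_count_le: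
  assumes "\<And>x. x < N \<Longrightarrow> \<bar>\<phi> x\<bar> \<le> 1"
  shows "\<bar>weighted_count N \<phi> \<xi>\<bar> \<le> real N"
proof -
  have "\<bar>weighted_count N \<phi> \<xi>\<bar> \<le> (\<Sum>x<N. 1)"
    unfolding weighted_count_def using assms
    by (intro order_trans[OF sum_abs] sum_mono) (auto simp: of_bool_def)
  then show ?thesis by simp
qed

lemma product_mean_weighted_count:
  "product_mean p N (weighted_count N \<phi>) = (\<Sum>x<N. \<phi> x * p x)"
proof -
  have "product_mean p N (weighted_count N \<phi>) = (\<Sum>x<N. product_mean p N (\<lambda>\<xi>. \<phi> x * of_bool (\<xi> x)))"
    unfolding weighted_count_def by (rule product_mean_sum)
  also have "\<dots> = (\<Sum>x<N. \<phi> x * p x)"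
    by (intro sum.cong refl) (simp add: product_mean_cmult product_mean_site[of _ N p of_bool])
  finally show ?thesis .
qed

lemma weighted_count_upd_diff:
  assumes "x < N"
  shows "weighted_count N \<phi> (\<xi>(x := True)) - weighted_count N \<phi> (\<xi>(x := False)) = \<phi> x"
proof -
  have "weighted_count N \<phi> (\<xi>(x := True)) - weighted_count N \<phi> (\<xi>(x := False)) =
      (\<Sum>z<N. if z = x then \<phi> z else 0)"
    unfolding weighted_count_def sum_subtractf[symmetric] by (intro sum.cong) auto
  then show ?thesis using assms by simp
qed

lemma abs_weighted_current_le:
  assumes "(\<Sum>x<N. \<bar>ring_diff N \<phi> x\<bar>) \<le> S"
  shows "\<bar>weighted_current N \<phi> \<xi>\<bar> \<le> S"
proof -
  have "\<bar>ring_diff N \<phi> x * current N \<xi> x\<bar> \<le> \<bar>ring_diff N \<phi> x\<bar>" for x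
    using current_bounds[of N \<xi> x] by (simp add: abs_mult mult_left_le)
  then have "\<bar>weighted_current N \<phi> \<xi>\<bar> \<le> (\<Sum>x<N. \<bar>ring_diff N \<phi> x\<bar>)"
    unfolding weighted_current_def by (intro order_trans[OF sum_abs] sum_mono)
  then show ?thesis using assms by linarith
qed

lemma product_mean_weighted_current:
  assumes "2 \<le> N"
  shows "product_mean p N (weighted_current N \<phi>) = (\<Sum>x<N. ring_diff N \<phi> x * (p x * (1 - p ((x + 1) mod N))))"
proof -
  have "product_mean p N (weighted_current N \<phi>) =
      (\<Sum>x<N. product_mean p N (\<lambda>\<xi>. ring_diff N \<phi> x * current N \<xi> x))"
    unfolding weighted_current_def by (rule product_mean_sum)
  also have "\<dots> = (\<Sum>x<N. ring_diff N \<phi> x * (p x * (1 - p ((x + 1) mod N))))"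
  proof (intro sum.cong refl)
    fix x assume "x \<in> {..<N}"
    then have x: "x < N" by simp
    show "product_mean p N (\<lambda>\<xi>. ring_diff N \<phi> x * current N \<xi> x) =
        ring_diff N \<phi> x * (p x * (1 - p ((x + 1) mod N)))"
      using product_mean_two_sites[OF x Suc_mod_neq(2)[OF x assms] Suc_mod_neq(1)[OF x assms, symmetric]]
      unfolding current_def product_mean_cmult by simp
  qed
  finally show ?thesis .
qed

lemma exponential_moment_le:
  assumes N: "2 \<le> N" and p: "\<And>x. x < N \<Longrightarrow> 0 < p x \<and> p x < 1"
    and \<phi>: "\<And>x. x < N \<Longrightarrow> \<bar>\<phi> x\<bar> \<le> 1"
    and d: "\<And>x. x < N \<Longrightarrow> \<bar>ring_diff N \<phi> x\<bar> \<le> 1"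
    and d1: "(\<Sum>x<N. \<bar>ring_diff N \<phi> x\<bar>) \<le> 2"
    and S: "(\<Sum>x<N. (ring_diff N \<phi> x)\<^sup>2) \<le> S"
    and t: "0 \<le> t" "t \<le> 1" and k: "\<bar>k\<bar> \<le> 3" and s: "0 \<le> s"
    and q: "\<And>r. 0 \<le> r \<Longrightarrow> r \<le> s \<Longrightarrow>
      product_mean p N (tasep_semigroup N r (\<lambda>\<xi>. of_bool (weighted_current N \<phi> \<xi> \<ge> k))) \<le> q"
  shows "product_mean p N (tasep_semigroup N s (\<lambda>\<xi>. exp (t * weighted_count N \<phi> \<xi>))) \<le>
    exp ((t * k + t\<^sup>2 * S) * s) * (exp (t * product_mean p N (weighted_count N \<phi>) + t\<^sup>2 * real N) +
      s * (5 * t * exp (t * real N) * q) * exp (\<bar>t * k + t\<^sup>2 * S\<bar> * s))"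
proof -
  define X where "X = weighted_count N \<phi>"
  define b where "b = t * k + t\<^sup>2 * S"
  define h where "h = (\<lambda>\<xi>. exp (t * X \<xi>))"
  define bad where "bad = (\<lambda>\<xi>. of_bool (weighted_current N \<phi> \<xi> \<ge> k) :: real)"
  define e where "e = 5 * t * exp (t * real N)"
  have p': "0 \<le> p x \<and> p x \<le> 1" if "x < N" for x
    using p[OF that] by auto
  have hN: "h \<xi> \<le> exp (t * real N)" for \<xi>
    using abs_weighted_count_le[where \<phi> = \<phi> and N = N and \<xi> = \<xi>, OF \<phi>] t unfolding h_def X_def
    by (auto intro: mult_left_mono)
  have bdh: "bounded (range h)"
    using hN by (intro bounded_range_realI[of _ "exp (t * real N)"]) (simp add: h_def)
  have bdb: "bounded (range bad)"
    by (intro bounded_range_realI[of _ 1]) (simp add: bad_def)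
  have q0: "0 \<le> q"
  proof -
    have "0 \<le> product_mean p N (tasep_semigroup N 0 bad)"
      by (intro product_mean_nonneg p' tasep_semigroup_nonneg bdb) (auto simp: bad_def)
    then show ?thesis using q[of 0] s unfolding bad_def by linarith
  qed
  have e0: "0 \<le> e"
    using t by (simp add: e_def)
  have Lh: "tasep_generator N h \<xi> \<le> b * h \<xi> + e * bad \<xi>" for \<xi>
  proof -
    have "tasep_generator N h \<xi> \<le> h \<xi> * (t * weighted_current N \<phi> \<xi> + t\<^sup>2 * S)"
      unfolding h_def X_def by (rule tasep_generator_exp_le[OF N d S t])
    also have "\<dots> = b * h \<xi> + t * h \<xi> * (weighted_current N \<phi> \<xi> - k)"
      by (simp add: b_def algebra_simps)
    also have "t * h \<xi> * (weighted_current N \<phi> \<xi> - k) \<le> e * bad \<xi>"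
    proof (cases "weighted_current N \<phi> \<xi> \<ge> k")
      case True
      have "weighted_current N \<phi> \<xi> - k \<le> 5"
        using abs_weighted_current_le[OF d1, of \<xi>] k by linarith
      then have "t * h \<xi> * (weighted_current N \<phi> \<xi> - k) \<le> t * exp (t * real N) * 5"
        using t hN True by (intro mult_mono) (auto simp: h_def)
      then show ?thesis using True by (simp add: e_def bad_def)
    next
      case False
      then have "t * h \<xi> * (weighted_current N \<phi> \<xi> - k) \<le> 0"
        using t by (intro mult_nonneg_nonpos) (auto simp: h_def)
      then show ?thesis using False by (simp add: bad_def)
    qed
    finally show ?thesis by simp
  qed
  have bdL: "bounded (range (\<lambda>\<xi>. b * h \<xi> + e * bad \<xi>))"
    using bounded_plus_comp[of "\<lambda>\<xi>. b * h \<xi>" UNIV "\<lambda>\<xi>. e * bad \<xi>"]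
      bounded_scaling[OF bdh, of b] bounded_scaling[OF bdb, of e] by (simp add: image_image)
  let ?u = "\<lambda>r. product_mean p N (tasep_semigroup N r h)"
  have "?u s \<le> exp (b * s) * (?u 0 + s * (e * q) * exp (\<bar>b\<bar> * s))"
  proof (rule gronwall_linear[OF s])
    fix r assume r: "0 \<le> r" "r \<le> s"
    have "product_mean p N (tasep_semigroup N r (tasep_generator N h)) \<le>
        product_mean p N (tasep_semigroup N r (\<lambda>\<xi>. b * h \<xi> + e * bad \<xi>))"
      by (intro product_mean_mono p' tasep_semigroup_mono bounded_tasep_generator bdh bdL Lh r)
    also have "\<dots> = product_mean p N (\<lambda>\<xi>. b * tasep_semigroup N r h \<xi> + e * tasep_semigroup N r bad \<xi>)"
      by (intro product_mean_cong tasep_semigroup_lin bdh bdb)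
    also have "\<dots> = b * ?u r + e * product_mean p N (tasep_semigroup N r bad)"
      by (rule product_mean_lin)
    also have "\<dots> \<le> b * ?u r + e * q"
      using q[OF r] e0 unfolding bad_def by (intro add_left_mono mult_left_mono) auto
    finally show "product_mean p N (tasep_semigroup N r (tasep_generator N h)) \<le> b * ?u r + e * q" .
  qed (use e0 q0 in \<open>auto intro!: has_real_derivative_product_mean_semigroup bdh\<close>)
  also have "\<dots> \<le> exp (b * s) * (exp (t * product_mean p N X + t\<^sup>2 * real N) + s * (e * q) * exp (\<bar>b\<bar> * s))"
  proof (intro mult_left_mono add_right_mono)
    have "?u 0 = product_mean p N (\<lambda>\<xi>. exp (t * X \<xi>))"
      by (intro product_mean_cong) (simp add: tasep_semigroup_0 h_def)
    also have "\<dots> \<le> exp (product_mean p N (\<lambda>\<xi>. t * X \<xi>) + (\<Sum>x<N. t\<^sup>2))"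
    proof (rule product_mean_exp_le[OF p'])
      fix x \<xi> assume x: "x < N"
      have "t * X (\<xi>(x := True)) - t * X (\<xi>(x := False)) = t * \<phi> x"
        using weighted_count_upd_diff[OF x, of \<phi> \<xi>] unfolding X_def by (metis right_diff_distrib)
      then show "\<bar>t * X (\<xi>(x := True)) - t * X (\<xi>(x := False))\<bar> \<le> t"
        using t \<phi>[OF x] by (simp add: abs_mult mult_left_le)
    qed auto
    finally show "?u 0 \<le> exp (t * product_mean p N X + t\<^sup>2 * real N)"
      by (simp add: product_mean_cmult mult.commute)
  qed auto
  finally show ?thesis
    unfolding h_def X_def b_def e_def by (simp add: mult.assoc)
qed

lemma adjoint_drift_bounds:
  assumes N: "2 \<le> N" and p: "\<And>x. x < N \<Longrightarrow> 0 < p x \<and> p x < 1" and C: "0 < C"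
    and slow: "\<And>x. x < N \<Longrightarrow>
      \<bar>(p x - p ((x + 1) mod N)) / ((1 - p x) * p ((x + 1) mod N))\<bar> \<le> C / real N"
    and b: "0 \<le> b"
  shows "\<bar>adjoint_drift p N \<xi>\<bar> \<le> C"
    and "product_mean p N (\<lambda>\<xi>. of_bool (adjoint_drift p N \<xi> \<ge> b)) \<le> exp (- b\<^sup>2 * real N / (16 * C\<^sup>2))"
proof -
  let ?c = "\<lambda>x. (p x - p ((x + 1) mod N)) / ((1 - p x) * p ((x + 1) mod N))"
  have "\<bar>adjoint_drift p N \<xi>\<bar> \<le> (\<Sum>x<N. C / real N)"
    unfolding adjoint_drift_def
  proof (intro order_trans[OF sum_abs] sum_mono)
    fix x assume "x \<in> {..<N}"
    then have "\<bar>?c x\<bar> \<le> C / real N" by (intro slow) simp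
    moreover have "\<bar>?c x * ((1 - of_bool (\<xi> x)) * of_bool (\<xi> ((x + 1) mod N)))\<bar> \<le> \<bar>?c x\<bar>"
      by (simp add: of_bool_def)
    ultimately show "\<bar>?c x * ((1 - of_bool (\<xi> x)) * of_bool (\<xi> ((x + 1) mod N)))\<bar> \<le> C / real N"
      by linarith
  qed
  then show "\<bar>adjoint_drift p N \<xi>\<bar> \<le> C"
    using N by simp
  have p': "0 \<le> p x \<and> p x \<le> 1" if "x < N" for x
    using p[OF that] by auto
  have "(\<Sum>x<N. (?c x)\<^sup>2) \<le> (\<Sum>x<N. (C / real N)\<^sup>2)"
  proof (intro sum_mono)
    fix x assume "x \<in> {..<N}"
    then have "\<bar>?c x\<bar> \<le> C / real N" by (intro slow) simp
    then show "(?c x)\<^sup>2 \<le> (C / real N)\<^sup>2"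
      by (metis abs_ge_zero power2_abs power_mono)
  qed
  also have "\<dots> = C\<^sup>2 / real N"
    using N by (simp add: power2_eq_square)
  finally have S: "(\<Sum>x<N. (?c x)\<^sup>2) \<le> C\<^sup>2 / real N" .
  have "product_mean p N (\<lambda>\<xi>. of_bool ((\<Sum>x<N. ?c x * ((1 - of_bool (\<xi> x)) * of_bool (\<xi> ((x + 1) mod N)))) \<ge>
      product_mean p N (\<lambda>\<xi>. \<Sum>x<N. ?c x * ((1 - of_bool (\<xi> x)) * of_bool (\<xi> ((x + 1) mod N)))) + b))
      \<le> exp (- b\<^sup>2 / (16 * (C\<^sup>2 / real N)))"
    by (rule product_mean_local_deviation[OF p' _ _ S _ b,
          where G = "\<lambda>a b. (1 - of_bool a) * of_bool b"]) (use N C in auto)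
  then show "product_mean p N (\<lambda>\<xi>. of_bool (adjoint_drift p N \<xi> \<ge> b)) \<le> exp (- b\<^sup>2 * real N / (16 * C\<^sup>2))"
    using product_mean_adjoint_drift[where p = p, OF N p] unfolding adjoint_drift_def[symmetric]
    by (simp add: adjoint_drift_def[abs_def])
qed

lemma block_tail:
  assumes N: "2 \<le> N" and p: "\<And>x. x < N \<Longrightarrow> 0 < p x \<and> p x < 1" and C: "1 \<le> C"
    and slow: "\<And>x. x < N \<Longrightarrow>
      \<bar>(p x - p ((x + 1) mod N)) / ((1 - p x) * p ((x + 1) mod N))\<bar> \<le> C / real N"
    and \<phi>: "\<And>x. x < N \<Longrightarrow> \<bar>\<phi> x\<bar> \<le> 1"
    and d: "\<And>x. x < N \<Longrightarrow> \<bar>ring_diff N \<phi> x\<bar> \<le> 1 / m"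
    and d1: "(\<Sum>x<N. \<bar>ring_diff N \<phi> x\<bar>) \<le> 2"
    and m: "2 \<le> m" "\<epsilon> * \<delta> * real N \<le> m" and \<delta>: "0 < \<delta>" "\<delta> \<le> 1"
    and \<alpha>: "0 < \<alpha>" "\<alpha> \<le> 1" "8192 * C\<^sup>2 * \<delta> \<le> \<alpha>\<^sup>2 * \<epsilon>"
    and t: "0 < t" "t \<le> 1" "7 * t \<le> 64 * C\<^sup>2 * \<delta>\<^sup>2" "4 * t \<le> \<alpha> * \<delta>"
  defines "threshold \<equiv> product_mean p N (weighted_count N \<phi>) +
      \<delta> * real N * (product_mean p N (weighted_current N \<phi>) + 2 * \<alpha>)"
  shows "product_mean p N (tasep_semigroup N (\<delta> * real N) (\<lambda>\<xi>. of_bool (weighted_count N \<phi> \<xi> \<ge> threshold)))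
    \<le> exp (- (t * \<alpha> * \<delta> / 2) * real N) + 5 * real N * (1 + real N * C) * exp (- (64 * C\<^sup>2 * \<delta>\<^sup>2) * real N)"
proof -
  let ?X = "weighted_count N \<phi>" and ?J = "weighted_current N \<phi>"
  define s where "s = \<delta> * real N"
  define D where "D = product_mean p N ?J"
  define S where "S = 2 / m"
  define b where "b = 64 * C\<^sup>2 * \<delta>"
  define \<gamma> where "\<gamma> = C\<^sup>2 * \<delta>\<^sup>2 * real N"
  have N0: "0 < real N" using N by simp
  have C0: "0 < C" using C by simp
  have s: "0 \<le> s" "s \<le> real N"
    using \<delta> N0 by (auto simp: s_def mult_le_cancel_right1)
  have p': "0 \<le> p x \<and> p x \<le> 1" if "x < N" for x
    using p[OF that] by auto
  have D: "\<bar>D\<bar> \<le> 2"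
    using product_mean_mono[where p = p and N = N and f = "?J" and g = "\<lambda>_. 2", OF p'] product_mean_mono[where p = p and N = N and f = "\<lambda>_. -2" and g = "?J", OF p']
      abs_weighted_current_le[OF d1]
    by (simp add: D_def abs_le_iff minus_le_iff)
  have S0: "0 < S" "S \<le> 1" using m by (auto simp: S_def)
  have dS: "(\<Sum>x<N. (ring_diff N \<phi> x)\<^sup>2) \<le> S"
  proof -
    have "(\<Sum>x<N. (ring_diff N \<phi> x)\<^sup>2) \<le> (\<Sum>x<N. 1 / m * \<bar>ring_diff N \<phi> x\<bar>)"
    proof (rule sum_mono)
      fix x assume "x \<in> {..<N}"
      then have "\<bar>ring_diff N \<phi> x\<bar> * \<bar>ring_diff N \<phi> x\<bar> \<le> 1 / m * \<bar>ring_diff N \<phi> x\<bar>"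
        by (intro mult_right_mono d) auto
      then show "(ring_diff N \<phi> x)\<^sup>2 \<le> 1 / m * \<bar>ring_diff N \<phi> x\<bar>"
        by (simp add: power2_eq_square)
    qed
    also have "\<dots> \<le> 1 / m * 2"
      unfolding sum_distrib_left[symmetric] using m by (intro mult_left_mono d1) auto
    finally show ?thesis by (simp add: S_def)
  qed
  have d': "\<bar>ring_diff N \<phi> x\<bar> \<le> 1" if "x < N" for x
  proof -
    have "1 / m \<le> 1" using m by simp
    then show ?thesis using d[OF that] by linarith
  qed
  define bad where "bad = (\<lambda>\<xi>. of_bool (?J \<xi> \<ge> D + \<alpha>) :: real)"
  define q where "q = exp (128 * \<gamma>) * ((1 + real N * C) * exp (- (256 * \<gamma>)))"
  have bad_le: "product_mean p N bad \<le> exp (- (256 * \<gamma>))"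
  proof -
    have "product_mean p N bad \<le> exp (- \<alpha>\<^sup>2 / (16 * S))"
      unfolding bad_def D_def weighted_current_def[abs_def] current_def
      by (rule product_mean_local_deviation[OF p' _ _ dS S0(1),
            where G = "\<lambda>a b. of_bool a * (1 - of_bool b)"]) (use N \<alpha> in auto)
    also have "- \<alpha>\<^sup>2 / (16 * S) \<le> - (256 * \<gamma>)"
    proof -
      have "8192 * \<gamma> = 8192 * C\<^sup>2 * \<delta> * (\<delta> * real N)"
        by (simp add: \<gamma>_def power2_eq_square)
      also have "\<dots> \<le> \<alpha>\<^sup>2 * \<epsilon> * (\<delta> * real N)"
        using \<alpha> \<delta> by (intro mult_right_mono) auto
      also have "\<dots> = \<alpha>\<^sup>2 * (\<epsilon> * \<delta> * real N)"
        by simp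
      also have "\<dots> \<le> \<alpha>\<^sup>2 * m"
        using m by (intro mult_left_mono) auto
      finally show ?thesis
        using m by (simp add: S_def)
    qed
    finally show ?thesis by simp
  qed
  have b0: "0 \<le> b" using \<delta> by (simp add: b_def)
  have adj: "\<bar>adjoint_drift p N \<xi>\<bar> \<le> C"
    "product_mean p N (\<lambda>\<xi>. of_bool (adjoint_drift p N \<xi> \<ge> b)) \<le> exp (- b\<^sup>2 * real N / (16 * C\<^sup>2))" for \<xi>
    using adjoint_drift_bounds[where N = N and p = p and C = C and b = b] N p C0 slow b0 by blast+
  have q: "product_mean p N (tasep_semigroup N r bad) \<le> q" if r: "0 \<le> r" "r \<le> s" for r
  proof -
    have "product_mean p N (tasep_semigroup N r bad) \<le>
      exp (2 * b * s) * (product_mean p N bad + s * C * product_mean p N (\<lambda>\<xi>. of_bool (adjoint_drift p N \<xi> \<ge> b)))"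
      by (rule product_mean_semigroup_le[OF N p adj(1) _ b0 r]) (auto simp: bad_def)
    also have "\<dots> \<le> exp (2 * b * s) * (exp (- (256 * \<gamma>)) + real N * C * exp (- b\<^sup>2 * real N / (16 * C\<^sup>2)))"
      using s C0 bad_le adj(2)
      by (intro mult_left_mono add_mono mult_mono mult_nonneg_nonneg product_mean_nonneg p') auto
    also have "2 * b * s = 128 * \<gamma>"
      by (simp add: b_def s_def \<gamma>_def power2_eq_square)
    also have "- b\<^sup>2 * real N / (16 * C\<^sup>2) = - (256 * \<gamma>)"
      using C0 by (simp add: b_def \<gamma>_def power2_eq_square field_simps)
    also have "exp (- (256 * \<gamma>)) + real N * C * exp (- (256 * \<gamma>)) = (1 + real N * C) * exp (- (256 * \<gamma>))"
      by (simp add: algebra_simps)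
    finally show ?thesis by (simp add: q_def)
  qed
  define \<beta> where "\<beta> = t * (D + \<alpha>) + t\<^sup>2 * S"
  have tS: "0 \<le> t\<^sup>2 * S" "t\<^sup>2 * S \<le> t"
  proof -
    have "t\<^sup>2 * S \<le> t * 1" unfolding power2_eq_square mult.assoc
      using t S0 by (intro mult_left_mono) (auto intro: mult_le_one)
    then show "t\<^sup>2 * S \<le> t" by simp
  qed (use S0 in auto)
  have \<beta>: "\<bar>\<beta>\<bar> \<le> 4 * t"
  proof -
    have "\<bar>t * (D + \<alpha>)\<bar> \<le> t * 3"
      unfolding abs_mult using t D \<alpha> by (intro mult_mono) auto
    then show ?thesis using tS unfolding \<beta>_def by linarith
  qed
  let ?mX = "product_mean p N ?X"
  have mX: "\<bar>?mX\<bar> \<le> real N"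
    using product_mean_mono[where p = p and N = N and f = "?X" and g = "\<lambda>_. real N", OF p'] product_mean_mono[where p = p and N = N and f = "\<lambda>_. - real N" and g = "?X", OF p']
      abs_weighted_count_le[where \<phi> = \<phi> and N = N, OF \<phi>] by (simp add: abs_le_iff minus_le_iff)
  have moment: "product_mean p N (tasep_semigroup N s (\<lambda>\<xi>. exp (t * ?X \<xi>))) \<le>
    exp (\<beta> * s) * (exp (t * ?mX + t\<^sup>2 * real N) + s * (5 * t * exp (t * real N) * q) * exp (\<bar>\<beta>\<bar> * s))"
    unfolding \<beta>_def
    by (rule exponential_moment_le[OF N p \<phi> d' d1 dS]) (use t D \<alpha> s q in \<open>auto simp: bad_def\<close>)
  have bdX: "bounded (range (\<lambda>\<xi>. exp (t * ?X \<xi>)))"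
    using abs_weighted_count_le[where \<phi> = \<phi> and N = N, OF \<phi>] t
    by (intro bounded_range_realI[of _ "exp (t * real N)"]) (auto simp: abs_le_iff intro!: mult_left_mono)
  have thr: "threshold = ?mX + s * (D + 2 * \<alpha>)"
    by (simp add: threshold_def s_def D_def)
  have "product_mean p N (tasep_semigroup N s (\<lambda>\<xi>. of_bool (?X \<xi> \<ge> threshold))) \<le>
      product_mean p N (tasep_semigroup N s (\<lambda>\<xi>. exp (- t * threshold) * exp (t * ?X \<xi>) + 0 * exp (t * ?X \<xi>)))"
  proof (intro product_mean_mono p' tasep_semigroup_mono s)
    fix \<xi>
    show "of_bool (?X \<xi> \<ge> threshold) \<le> exp (- t * threshold) * exp (t * ?X \<xi>) + 0 * exp (t * ?X \<xi>)"
    proof (cases "?X \<xi> \<ge> threshold")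
      case True
      then have "0 \<le> t * (?X \<xi> - threshold)" using t by simp
      then show ?thesis by (simp add: algebra_simps flip: exp_add)
    qed simp
  qed (use bounded_scaling[OF bdX, of "exp (- t * threshold)"] in
      \<open>auto simp: image_image intro!: bounded_range_realI[of _ 1]\<close>)
  also have "\<dots> = exp (- t * threshold) * product_mean p N (tasep_semigroup N s (\<lambda>\<xi>. exp (t * ?X \<xi>)))"
    unfolding product_mean_cmult[symmetric]
    using tasep_semigroup_lin[OF bdX bdX, of N s "exp (- t * threshold)" 0]
    by (intro product_mean_cong) simp
  also have "\<dots> \<le> exp (- t * threshold) *
      (exp (\<beta> * s) * (exp (t * ?mX + t\<^sup>2 * real N) + s * (5 * t * exp (t * real N) * q) * exp (\<bar>\<beta>\<bar> * s)))"
    by (intro mult_left_mono moment) auto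
  also have "\<dots> = exp (- t * threshold + \<beta> * s + t * ?mX + t\<^sup>2 * real N) +
      5 * (s * t) * (exp (- t * threshold + \<beta> * s + t * real N + \<bar>\<beta>\<bar> * s) * q)"
    by (simp only: exp_add) (simp add: algebra_simps)
  also have "\<dots> \<le> exp (- (t * \<alpha> * \<delta> / 2) * real N) + 5 * real N * (exp (7 * t * real N) * q)"
  proof -
    have e1: "- t * threshold + \<beta> * s = - (t * ?mX) - t * \<alpha> * s + t\<^sup>2 * S * s"
      by (simp add: thr \<beta>_def algebra_simps)
    have ts: "t\<^sup>2 * S * s \<le> t\<^sup>2 * real N"
      using S0 s t mult_mono[of S 1 s "real N"] by (simp add: mult.assoc)
    have tq: "t\<^sup>2 * real N * 2 \<le> t * \<alpha> * \<delta> / 2 * real N"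
    proof -
      have "t * (4 * t) \<le> t * (\<alpha> * \<delta>)"
        using t by (intro mult_left_mono) auto
      then have "t\<^sup>2 * 2 \<le> t * \<alpha> * \<delta> / 2"
        by (simp add: power2_eq_square mult_ac)
      then have "(t\<^sup>2 * 2) * real N \<le> (t * \<alpha> * \<delta> / 2) * real N"
        by (intro mult_right_mono) auto
      then show ?thesis by (simp add: mult_ac)
    qed
    have sN: "t * \<alpha> * s = t * \<alpha> * \<delta> * real N"
      by (simp add: s_def)
    have x1: "- t * threshold + \<beta> * s + t * ?mX + t\<^sup>2 * real N \<le> - (t * \<alpha> * \<delta> / 2) * real N"
      using e1 ts tq sN by simp
    have "t\<^sup>2 * S * s \<le> t * real N"
      using tS s t by (intro mult_mono) auto
    moreover have "\<bar>\<beta>\<bar> * s \<le> 4 * t * real N"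
      using \<beta> s t by (intro mult_mono) auto
    moreover have "- (t * ?mX) \<le> t * real N"
      using mX t mult_left_mono[of "- ?mX" "real N" t] by (simp add: abs_le_iff)
    moreover have "0 \<le> t * \<alpha> * s"
      using t \<alpha> s by simp
    ultimately have x2: "- t * threshold + \<beta> * s + t * real N + \<bar>\<beta>\<bar> * s \<le> 7 * t * real N"
      using e1 by simp
    have "s * t \<le> real N * 1"
      using s t by (intro mult_mono) auto
    moreover have "0 \<le> q"
      using C0 by (simp add: q_def)
    ultimately show ?thesis
      using x1 x2 s t by (intro add_mono mult_mono) auto
  qed
  also have "exp (7 * t * real N) * q \<le> (1 + real N * C) * exp (- (64 * C\<^sup>2 * \<delta>\<^sup>2) * real N)"
  proof -
    have "7 * t * real N \<le> 64 * C\<^sup>2 * \<delta>\<^sup>2 * real N"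
      using t by (intro mult_right_mono) auto
    then have "7 * t * real N + 128 * \<gamma> - 256 * \<gamma> \<le> - (64 * C\<^sup>2 * \<delta>\<^sup>2) * real N"
      by (simp add: \<gamma>_def algebra_simps)
    then have "exp (7 * t * real N) * exp (128 * \<gamma>) * exp (- (256 * \<gamma>)) \<le> exp (- (64 * C\<^sup>2 * \<delta>\<^sup>2) * real N)"
      by (simp flip: exp_add)
    then have "(1 + real N * C) * (exp (7 * t * real N) * exp (128 * \<gamma>) * exp (- (256 * \<gamma>)))
      \<le> (1 + real N * C) * exp (- (64 * C\<^sup>2 * \<delta>\<^sup>2) * real N)"
      using C0 by (intro mult_left_mono) auto
    then show ?thesis by (simp add: q_def mult_ac)
  qed
  finally show ?thesis
    using N0 by (simp add: s_def mult.assoc mult_left_mono)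
qed

definition arc_count :: "nat \<Rightarrow> nat \<Rightarrow> nat \<Rightarrow> nat \<Rightarrow> real" where
  "arc_count N a l x = (\<Sum>i<l. of_bool ((a + 1 + i) mod N = x))"

definition smeared_arc :: "nat \<Rightarrow> nat \<Rightarrow> nat \<Rightarrow> nat \<Rightarrow> nat \<Rightarrow> real" where
  "smeared_arc N m a l x = (\<Sum>j<m. arc_count N (a + j) l x) / real m"

lemma sum_of_bool_mod_le_1:
  fixes b l N :: nat
  assumes "l \<le> N"
  shows "(\<Sum>i<l. of_bool ((b + i) mod N = x)) \<le> (1 :: real)"
proof -
  have "card {i. i < l \<and> (b + i) mod N = x} \<le> 1"
  proof (subst One_nat_def, subst card_le_Suc0_iff_eq, simp, intro ballI)
    have *: "i = i'" if "i < l" "i' < l" "(b + i) mod N = (b + i') mod N" "i \<le> i'" for i i'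
    proof -
      have "N dvd (b + i') - (b + i)"
        using that by (intro mod_eq_dvd_iff_nat[THEN iffD1]) auto
      then have "N dvd i' - i" by simp
      moreover have "i' - i < N"
        using that assms by linarith
      ultimately have "i' - i = 0"
        using nat_dvd_not_less[of "i' - i" N] by blast
      then show "i = i'"
        using that by simp
    qed
    fix i i' assume "i \<in> {i. i < l \<and> (b + i) mod N = x}" "i' \<in> {i. i < l \<and> (b + i) mod N = x}"
    then show "i = i'"
      using *[of i i'] *[of i' i] by (cases "i \<le> i'") auto
  qed
  moreover have "(\<Sum>i<l. of_bool ((b + i) mod N = x)) = real (card {i. i < l \<and> (b + i) mod N = x})"
    by (simp add: sum.If_cases of_bool_def Int_def lessThan_def)
  ultimately show ?thesis by simp
qed

lemma sum_lessThan_of_bool_eq: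
  fixes g :: "nat \<Rightarrow> real"
  assumes "k < N"
  shows "(\<Sum>x<N. of_bool (k = x) * g x) = g k"
proof -
  have "(\<Sum>x<N. of_bool (k = x) * g x) = (\<Sum>x<N. if x = k then g x else 0)"
    by (intro sum.cong) auto
  then show ?thesis using assms by simp
qed

lemma arc_count_bounds:
  assumes "l \<le> N"
  shows "0 \<le> arc_count N a l x" "arc_count N a l x \<le> 1"
  using sum_of_bool_mod_le_1[OF assms, of "a + 1" x] by (auto simp: arc_count_def intro: sum_nonneg)

lemma sum_arc_count:
  assumes "0 < N"
  shows "(\<Sum>x<N. arc_count N a l x * g x) = arc_sum N a l g"
proof -
  have "(\<Sum>x<N. arc_count N a l x * g x) = (\<Sum>i<l. \<Sum>x<N. of_bool ((a + 1 + i) mod N = x) * g x)"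
    unfolding arc_count_def sum_distrib_right by (rule sum.swap)
  also have "\<dots> = arc_sum N a l g"
    unfolding arc_sum_def using assms by (intro sum.cong refl sum_lessThan_of_bool_eq) simp
  finally show ?thesis .
qed

lemma ring_diff_arc_count:
  assumes "x < N"
  shows "ring_diff N (arc_count N a l) x = of_bool (a mod N = x) - of_bool ((a + l) mod N = x)"
proof -
  have "ring_diff N (arc_count N a l) x =
      (\<Sum>i<l. of_bool ((a + i) mod N = x) - of_bool ((a + Suc i) mod N = x))"
    unfolding ring_diff_def arc_count_def sum_subtractf[symmetric]
  proof (intro sum.cong refl)
    fix i
    have "(a + 1 + i) mod N = (x + 1) mod N \<longleftrightarrow> (a + i) mod N = x"
      using Suc_mod_eq_Suc_mod_iff[OF assms, of "a + i"] by (simp add: add_ac)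
    then show "of_bool ((a + 1 + i) mod N = (x + 1) mod N) - of_bool ((a + 1 + i) mod N = x) =
        (of_bool ((a + i) mod N = x) - of_bool ((a + Suc i) mod N = x) :: real)"
      by simp
  qed
  also have "\<dots> = of_bool (a mod N = x) - of_bool ((a + l) mod N = x)"
    by (subst sum_lessThan_telescope'[of "\<lambda>i. of_bool ((a + i) mod N = x)"]) simp
  finally show ?thesis .
qed

lemma ring_diff_smeared_arc:
  assumes "x < N"
  shows "ring_diff N (smeared_arc N m a l) x =
    ((\<Sum>j<m. of_bool ((a + j) mod N = x)) - (\<Sum>j<m. of_bool ((a + l + j) mod N = x))) / real m"
proof -
  have "ring_diff N (smeared_arc N m a l) x = (\<Sum>j<m. ring_diff N (arc_count N (a + j) l) x) / real m"
    by (simp add: ring_diff_def smeared_arc_def sum_subtractf diff_divide_distrib)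
  also have "\<dots> = (\<Sum>j<m. of_bool ((a + j) mod N = x) - of_bool ((a + l + j) mod N = x)) / real m"
    unfolding ring_diff_arc_count[OF assms] by (simp add: add_ac)
  finally show ?thesis by (simp add: sum_subtractf)
qed

lemma smeared_arc_bounds:
  assumes "l \<le> N" "0 < m"
  shows "0 \<le> smeared_arc N m a l x" "smeared_arc N m a l x \<le> 1"
proof -
  show "0 \<le> smeared_arc N m a l x"
    unfolding smeared_arc_def using arc_count_bounds[OF assms(1)] by (intro divide_nonneg_nonneg sum_nonneg) auto
  have "(\<Sum>j<m. arc_count N (a + j) l x) \<le> (\<Sum>j<m. 1)"
    by (intro sum_mono arc_count_bounds assms)
  then show "smeared_arc N m a l x \<le> 1"
    unfolding smeared_arc_def using assms by (simp add: divide_le_eq_1)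
qed

lemma ring_diff_smeared_arc_le:
  assumes "x < N" "m \<le> N" "0 < m"
  shows "\<bar>ring_diff N (smeared_arc N m a l) x\<bar> \<le> 1 / real m"
proof -
  have "\<bar>(\<Sum>j<m. of_bool ((a + j) mod N = x)) - (\<Sum>j<m. of_bool ((a + l + j) mod N = x))\<bar> \<le> (1 :: real)"
  proof -
    have *: "\<bar>u - v\<bar> \<le> 1" if "0 \<le> u" "u \<le> 1" "0 \<le> v" "v \<le> 1" for u v :: real
      using that by linarith
    show ?thesis
      by (intro * sum_nonneg sum_of_bool_mod_le_1 assms) auto
  qed
  then show ?thesis
    unfolding ring_diff_smeared_arc[OF assms(1)] abs_divide by (simp add: divide_right_mono)
qed

lemma sum_ring_diff_smeared_arc_le:
  assumes "0 < m" "0 < N"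
  shows "(\<Sum>x<N. \<bar>ring_diff N (smeared_arc N m a l) x\<bar>) \<le> 2"
proof -
  have 1: "(\<Sum>x<N. \<Sum>j<m. of_bool ((b + j) mod N = x)) = real m" for b
  proof -
    have "(\<Sum>x<N. \<Sum>j<m. of_bool ((b + j) mod N = x)) = (\<Sum>j<m. \<Sum>x<N. of_bool ((b + j) mod N = x) * 1 :: real)"
      by (subst sum.swap) simp
    also have "\<dots> = (\<Sum>j<m. 1)"
      using assms by (intro sum.cong refl sum_lessThan_of_bool_eq) simp
    finally show ?thesis by simp
  qed
  have "(\<Sum>x<N. \<bar>ring_diff N (smeared_arc N m a l) x\<bar>) \<le>
      (\<Sum>x<N. ((\<Sum>j<m. of_bool ((a + j) mod N = x)) + (\<Sum>j<m. of_bool ((a + l + j) mod N = x))) / real m)"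
  proof (rule sum_mono)
    fix x assume "x \<in> {..<N}"
    then have x: "x < N" by simp
    have *: "\<bar>u - v\<bar> \<le> u + v" if "0 \<le> u" "0 \<le> v" for u v :: real
      using that by linarith
    show "\<bar>ring_diff N (smeared_arc N m a l) x\<bar> \<le>
      ((\<Sum>j<m. of_bool ((a + j) mod N = x)) + (\<Sum>j<m. of_bool ((a + l + j) mod N = x))) / real m"
      unfolding ring_diff_smeared_arc[OF x] abs_divide abs_of_nat
      by (intro divide_right_mono * sum_nonneg) auto
  qed
  also have "\<dots> = 2"
    unfolding sum_divide_distrib[symmetric] sum.distrib 1 using assms by simp
  finally show ?thesis .
qed

lemma sum_smeared_arc:
  assumes "0 < m" "0 < N" and g: "\<And>x. x < N \<Longrightarrow> \<bar>g x\<bar> \<le> 1"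
  shows "\<bar>arc_sum N a l g - (\<Sum>x<N. smeared_arc N m a l x * g x)\<bar> \<le> 2 * real m"
proof -
  have step: "\<bar>arc_sum N (b + 1) l g - arc_sum N b l g\<bar> \<le> 2" for b
  proof -
    have "arc_sum N (b + 1) l g - arc_sum N b l g = (\<Sum>i<l. g ((b + 1 + Suc i) mod N) - g ((b + 1 + i) mod N))"
      unfolding arc_sum_def sum_subtractf by (simp add: add_ac)
    also have "\<dots> = g ((b + 1 + l) mod N) - g ((b + 1) mod N)"
      by (subst sum_lessThan_telescope[of "\<lambda>i. g ((b + 1 + i) mod N)"]) simp
    finally have "arc_sum N (b + 1) l g - arc_sum N b l g = g ((b + 1 + l) mod N) - g ((b + 1) mod N)" .
    moreover have "\<bar>g ((b + 1 + l) mod N)\<bar> \<le> 1" "\<bar>g ((b + 1) mod N)\<bar> \<le> 1"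
      using assms(2) by (auto intro!: g)
    ultimately show ?thesis by linarith
  qed
  have shift: "\<bar>arc_sum N a l g - arc_sum N (a + j) l g\<bar> \<le> 2 * real j" for j
  proof (induction j)
    case (Suc j)
    then show ?case
      using step[of "a + j"] by (simp add: add_ac)
  qed simp
  have "(\<Sum>x<N. smeared_arc N m a l x * g x) = (\<Sum>x<N. \<Sum>j<m. arc_count N (a + j) l x * g x) / real m"
    unfolding smeared_arc_def by (simp add: sum_distrib_right sum_divide_distrib)
  also have "\<dots> = (\<Sum>j<m. arc_sum N (a + j) l g) / real m"
    by (subst sum.swap) (simp add: sum_arc_count assms)
  finally have "arc_sum N a l g - (\<Sum>x<N. smeared_arc N m a l x * g x) =
      (\<Sum>j<m. arc_sum N a l g - arc_sum N (a + j) l g) / real m"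
    using assms by (simp add: sum_subtractf field_simps)
  moreover have "\<bar>\<Sum>j<m. arc_sum N a l g - arc_sum N (a + j) l g\<bar> \<le> (\<Sum>j<m. 2 * real m)"
  proof (intro order_trans[OF sum_abs] sum_mono)
    fix j assume "j \<in> {..<m}"
    then show "\<bar>arc_sum N a l g - arc_sum N (a + j) l g\<bar> \<le> 2 * real m"
      using shift[of j] by simp
  qed
  ultimately show ?thesis
    using assms by (simp add: abs_divide divide_le_eq mult_ac)
qed

subsection \<open>The discrepancy from a product measure\<close>

lemma abs_le_indicators:
  fixes u :: real
  assumes "\<bar>u\<bar> \<le> k" "0 \<le> B"
  shows "\<bar>u\<bar> \<le> B + k * (of_bool (u \<ge> B) + of_bool (- u \<ge> B))"
  using assms by (auto simp: of_bool_def)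

lemma discrepancy_le_union:
  fixes I :: "nat \<times> nat \<Rightarrow> real"
  assumes "0 < N" "0 \<le> k" "\<And>i. 0 \<le> I i"
    and "\<And>a l. a < N \<Longrightarrow> l \<le> N \<Longrightarrow> \<bar>arc_sum N a l g\<bar> \<le> B + k * I (a, l)"
  shows "discrepancy N g \<le> B + k * (\<Sum>i\<in>{..<N} \<times> {..N}. I i)"
proof (rule discrepancy_le[OF assms(1)])
  fix a l assume al: "a < N" "l \<le> N"
  then have "I (a, l) \<le> (\<Sum>i\<in>{..<N} \<times> {..N}. I i)"
    using assms(3) by (intro member_le_sum) auto
  then have "k * I (a, l) \<le> k * (\<Sum>i\<in>{..<N} \<times> {..N}. I i)"
    using assms(2) by (rule mult_left_mono)
  then show "\<bar>arc_sum N a l g\<bar> \<le> B + k * (\<Sum>i\<in>{..<N} \<times> {..N}. I i)"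
    using assms(4)[OF al] by linarith
qed

lemma weighted_count_diff:
  "weighted_count N \<phi> \<xi> - (\<Sum>x<N. \<phi> x * p x) = (\<Sum>x<N. \<phi> x * (of_bool (\<xi> x) - p x))"
  by (simp add: weighted_count_def right_diff_distrib sum_subtractf del: sum_mult_of_bool_eq)

lemma abs_sum_weighted_le:
  fixes \<phi> :: "nat \<Rightarrow> real"
  assumes "\<And>x. x < N \<Longrightarrow> \<bar>\<phi> x\<bar> \<le> 1" "\<And>x. x < N \<Longrightarrow> \<bar>g x\<bar> \<le> c"
  shows "\<bar>\<Sum>x<N. \<phi> x * g x\<bar> \<le> real N * c"
proof -
  have "\<bar>\<phi> x * g x\<bar> \<le> 1 * c" if "x < N" for x
    unfolding abs_mult using assms[OF that] by (intro mult_mono) auto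
  then have "\<bar>\<Sum>x<N. \<phi> x * g x\<bar> \<le> (\<Sum>x<N. c)"
    by (intro order_trans[OF sum_abs] sum_mono) simp
  then show ?thesis by simp
qed

lemma weighted_count_uminus: "weighted_count N (\<lambda>x. - \<phi> x) \<xi> = - weighted_count N \<phi> \<xi>"
  by (simp add: weighted_count_def sum_negf del: sum_mult_of_bool_eq)

lemma product_mean_discrepancy_le:
  assumes N: "0 < N" and p: "\<And>x. x < N \<Longrightarrow> 0 \<le> p x \<and> p x \<le> 1" and B: "0 \<le> B"
  shows "product_mean p N (\<lambda>\<xi>. discrepancy N (\<lambda>x. of_bool (\<xi> x) - p x)) \<le>
    B * real N + real N * (real N * (real N + 1) * (2 * exp (- B\<^sup>2 * real N / 4)))"
proof -
  define \<phi> where "\<phi> = (\<lambda>i. arc_count N (fst i) (snd i))"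
  let ?I = "{..<N} \<times> {..N}"
  let ?dev = "\<lambda>\<phi> \<xi>. of_bool (weighted_count N \<phi> \<xi> - (\<Sum>x<N. \<phi> x * p x) \<ge> B * real N) :: real"
  have dev: "product_mean p N (?dev \<psi>) \<le> exp (- B\<^sup>2 * real N / 4)"
    if \<psi>: "\<And>x. x < N \<Longrightarrow> \<bar>\<psi> x\<bar> \<le> 1" for \<psi>
  proof -
    have "product_mean p N (\<lambda>\<xi>. of_bool (weighted_count N \<psi> \<xi> \<ge> product_mean p N (weighted_count N \<psi>) + B * real N))
        \<le> exp (- (B * real N)\<^sup>2 / (4 * real N))"
      by (rule product_mean_deviation[OF p, where d = "\<lambda>_. 1"])
        (use \<psi> N B in \<open>auto simp: weighted_count_upd_diff simp del: fun_upd_apply\<close>)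
    moreover have "- (B * real N)\<^sup>2 / (4 * real N) = - B\<^sup>2 * real N / 4"
      using N by (simp add: power2_eq_square)
    moreover have "product_mean p N (?dev \<psi>) =
        product_mean p N (\<lambda>\<xi>. of_bool (weighted_count N \<psi> \<xi> \<ge> product_mean p N (weighted_count N \<psi>) + B * real N))"
      by (intro product_mean_cong arg_cong[of _ _ of_bool]) (auto simp: product_mean_weighted_count)
    ultimately show ?thesis by (simp only:)
  qed
  have "product_mean p N (\<lambda>\<xi>. discrepancy N (\<lambda>x. of_bool (\<xi> x) - p x)) \<le>
      product_mean p N (\<lambda>\<xi>. B * real N + real N * (\<Sum>i\<in>?I. ?dev (\<phi> i) \<xi> + ?dev (\<lambda>x. - \<phi> i x) \<xi>))"
  proof (rule product_mean_mono[OF p], assumption, rule discrepancy_le_union[OF N])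
    fix \<xi> a l assume al: "a < N" "l \<le> N"
    have eq: "weighted_count N (\<phi> (a, l)) \<xi> - (\<Sum>x<N. \<phi> (a, l) x * p x) = arc_sum N a l (\<lambda>x. of_bool (\<xi> x) - p x)"
      unfolding weighted_count_diff by (simp add: \<phi>_def sum_arc_count[OF N])
    have eq': "weighted_count N (\<lambda>x. - \<phi> (a, l) x) \<xi> - (\<Sum>x<N. - \<phi> (a, l) x * p x) = - arc_sum N a l (\<lambda>x. of_bool (\<xi> x) - p x)"
      unfolding eq[symmetric] weighted_count_uminus by (simp add: sum_negf)
    have "\<bar>of_bool (\<xi> x) - p x\<bar> \<le> 1" if "x < N" for x
      using p[OF that] by (auto simp: of_bool_def)
    then have "\<bar>arc_sum N a l (\<lambda>x. of_bool (\<xi> x) - p x)\<bar> \<le> real N"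
      using abs_arc_sum_le[OF N, of "\<lambda>x. of_bool (\<xi> x) - p x" 1 a l] al by simp
    from abs_le_indicators[OF this, of "B * real N"] B
    show "\<bar>arc_sum N a l (\<lambda>x. of_bool (\<xi> x) - p x)\<bar> \<le>
        B * real N + real N * (?dev (\<phi> (a, l)) \<xi> + ?dev (\<lambda>x. - \<phi> (a, l) x) \<xi>)"
      unfolding eq eq' by simp
  qed auto
  also have "\<dots> = B * real N + real N * (\<Sum>i\<in>?I. product_mean p N (?dev (\<phi> i)) + product_mean p N (?dev (\<lambda>x. - \<phi> i x)))"
    unfolding product_mean_add product_mean_cmult product_mean_sum by simp
  also have "\<dots> \<le> B * real N + real N * (\<Sum>i\<in>?I. 2 * exp (- B\<^sup>2 * real N / 4))"
  proof (intro add_left_mono mult_left_mono sum_mono)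
    fix i assume "i \<in> ?I"
    then have "\<bar>\<phi> i x\<bar> \<le> 1" "\<bar>- \<phi> i x\<bar> \<le> 1" for x
      using arc_count_bounds[of "snd i" N "fst i" x] by (auto simp: \<phi>_def)
    then show "product_mean p N (?dev (\<phi> i)) + product_mean p N (?dev (\<lambda>x. - \<phi> i x)) \<le> 2 * exp (- B\<^sup>2 * real N / 4)"
      using dev[of "\<phi> i"] dev[of "\<lambda>x. - \<phi> i x"] by simp
  qed auto
  also have "(\<Sum>i\<in>?I. 2 * exp (- B\<^sup>2 * real N / 4)) = real N * (real N + 1) * (2 * exp (- B\<^sup>2 * real N / 4))"
    by (simp add: card_cartesian_product algebra_simps)
  finally show ?thesis .
qed

lemma product_mean_semigroup_union:
  assumes I: "finite I" and p: "\<And>x. x < N \<Longrightarrow> 0 \<le> p x \<and> p x \<le> 1" and t: "0 \<le> t"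
    and f: "bounded (range f)" and g: "\<And>i. i \<in> I \<Longrightarrow> bounded (range (g i))"
    and le: "\<And>\<xi>. f \<xi> \<le> c + k * (\<Sum>i\<in>I. g i \<xi>)"
  shows "product_mean p N (tasep_semigroup N t f) \<le>
    c + k * (\<Sum>i\<in>I. product_mean p N (tasep_semigroup N t (g i)))"
proof -
  have sum: "tasep_semigroup N t (\<lambda>\<xi>. \<Sum>i\<in>I. 1 * g i \<xi>) \<xi> = (\<Sum>i\<in>I. 1 * tasep_semigroup N t (g i) \<xi>)"
    "bounded (range (\<lambda>\<xi>. \<Sum>i\<in>I. 1 * g i \<xi>))" for \<xi>
    using tasep_semigroup_sum[where f = g and N = N and t = t and c = "\<lambda>_. 1" and \<xi> = \<xi>, OF I g] by auto
  have c: "bounded (range (\<lambda>_ :: config. c))"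
    by (rule bounded_range_realI[of _ "\<bar>c\<bar>"]) simp
  have "bounded (range (\<lambda>\<xi>. 1 * c + k * (\<Sum>i\<in>I. 1 * g i \<xi>)))"
    using bounded_plus_comp[OF c, of "\<lambda>\<xi>. k * (\<Sum>i\<in>I. 1 * g i \<xi>)"] bounded_scaling[OF sum(2), of k]
    by (simp add: image_image)
  then have "product_mean p N (tasep_semigroup N t f) \<le>
      product_mean p N (tasep_semigroup N t (\<lambda>\<xi>. 1 * c + k * (\<Sum>i\<in>I. 1 * g i \<xi>)))"
    using le by (intro product_mean_mono p tasep_semigroup_mono f t) auto
  also have "\<dots> = product_mean p N (\<lambda>\<xi>. c + k * (\<Sum>i\<in>I. tasep_semigroup N t (g i) \<xi>))"
    using tasep_semigroup_lin[OF c sum(2), of N t 1 k] sum(1)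
    by (intro product_mean_cong) (simp add: tasep_semigroup_const)
  also have "\<dots> = c + k * (\<Sum>i\<in>I. product_mean p N (tasep_semigroup N t (g i)))"
    by (simp add: product_mean_add product_mean_cmult product_mean_sum)
  finally show ?thesis .
qed

lemma weighted_flux_consistency:
  assumes \<phi>: "\<And>x. x < N \<Longrightarrow> \<bar>\<phi> x\<bar> \<le> 1" and N: "2 \<le> N"
    and cons: "\<And>x. x < N \<Longrightarrow> \<bar>p' ((x + 1) mod N) - p ((x + 1) mod N) - h * (F x - F ((x + 1) mod N))\<bar> \<le> e"
  shows "\<bar>(\<Sum>x<N. \<phi> x * p' x) - (\<Sum>x<N. \<phi> x * p x) - h * (\<Sum>x<N. ring_diff N \<phi> x * F x)\<bar> \<le> real N * e"
proof -
  let ?y = "\<lambda>x. (x + 1) mod N"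
  have "(\<Sum>x<N. ring_diff N \<phi> x * F x) = (\<Sum>x<N. \<phi> (?y x) * F x) - (\<Sum>x<N. \<phi> x * F x)"
    by (simp add: ring_diff_def left_diff_distrib sum_subtractf)
  also have "(\<Sum>x<N. \<phi> x * F x) = (\<Sum>x<N. \<phi> (?y x) * F (?y x))"
    using sum_rotate[of "\<lambda>x. \<phi> x * F x" N] by simp
  finally have "(\<Sum>x<N. \<phi> x * p' x) - (\<Sum>x<N. \<phi> x * p x) - h * (\<Sum>x<N. ring_diff N \<phi> x * F x) =
      (\<Sum>x<N. \<phi> (?y x) * p' (?y x)) - (\<Sum>x<N. \<phi> (?y x) * p (?y x)) -
      h * ((\<Sum>x<N. \<phi> (?y x) * F x) - (\<Sum>x<N. \<phi> (?y x) * F (?y x)))"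
    using sum_rotate[of "\<lambda>x. \<phi> x * p' x" N] sum_rotate[of "\<lambda>x. \<phi> x * p x" N] by simp
  also have "\<dots> = (\<Sum>x<N. \<phi> (?y x) * (p' (?y x) - p (?y x) - h * (F x - F (?y x))))"
    by (simp add: right_diff_distrib sum_subtractf sum_distrib_left mult_ac)
  finally show ?thesis
    using abs_sum_weighted_le[of N "\<lambda>x. \<phi> (?y x)" "\<lambda>x. p' (?y x) - p (?y x) - h * (F x - F (?y x))" e]
      \<phi> cons N by simp
qed

lemma block_discrepancy:
  assumes N: "2 \<le> N" and p: "\<And>x. x < N \<Longrightarrow> 0 < p x \<and> p x < 1" and C: "1 \<le> C"
    and slow: "\<And>x. x < N \<Longrightarrow>
      \<bar>(p x - p ((x + 1) mod N)) / ((1 - p x) * p ((x + 1) mod N))\<bar> \<le> C / real N"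
    and m: "2 \<le> m" "m \<le> N" "\<epsilon> * \<delta> * real N \<le> real m" and \<delta>: "0 < \<delta>" "\<delta> \<le> 1"
    and \<alpha>: "0 < \<alpha>" "\<alpha> \<le> 1" "8192 * C\<^sup>2 * \<delta> \<le> \<alpha>\<^sup>2 * \<epsilon>"
    and t: "0 < t" "t \<le> 1" "7 * t \<le> 64 * C\<^sup>2 * \<delta>\<^sup>2" "4 * t \<le> \<alpha> * \<delta>"
    and p': "\<And>x. x < N \<Longrightarrow> 0 \<le> p' x \<and> p' x \<le> 1" and e: "0 \<le> e"
    and cons: "\<And>x. x < N \<Longrightarrow>
      \<bar>p' ((x + 1) mod N) - p ((x + 1) mod N) -
        \<delta> * real N * (p x * (1 - p ((x + 1) mod N)) -
          p ((x + 1) mod N) * (1 - p (((x + 1) mod N + 1) mod N)))\<bar> \<le> \<delta> * e"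
  shows "product_mean p N (tasep_semigroup N (\<delta> * real N) (\<lambda>\<xi>. discrepancy N (\<lambda>x. of_bool (\<xi> x) - p' x)))
    \<le> 2 * real m + \<delta> * real N * (2 * \<alpha> + e) + real N * (real N * (real N + 1) *
      (2 * (exp (- (t * \<alpha> * \<delta> / 2) * real N) +
        5 * real N * (1 + real N * C) * exp (- (64 * C\<^sup>2 * \<delta>\<^sup>2) * real N))))"
proof -
  define tail where "tail = exp (- (t * \<alpha> * \<delta> / 2) * real N) +
        5 * real N * (1 + real N * C) * exp (- (64 * C\<^sup>2 * \<delta>\<^sup>2) * real N)"
  define \<tau> where "\<tau> = \<delta> * real N * (2 * \<alpha> + e)"
  define \<phi> where "\<phi> = (\<lambda>i. smeared_arc N m (fst i) (snd i))"
  let ?I = "{..<N} \<times> {..N}"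
  let ?dev = "\<lambda>\<phi> \<xi>. of_bool (weighted_count N \<phi> \<xi> - (\<Sum>x<N. \<phi> x * p' x) \<ge> \<tau>) :: real"
  have N0: "0 < N" and m0: "0 < m" and s: "0 \<le> \<delta> * real N" using N m \<delta> by auto
  have pp: "0 \<le> p x \<and> p x \<le> 1" if "x < N" for x
    using p[OF that] by auto
  have bd: "bounded (range (?dev \<psi>))" for \<psi>
    by (rule bounded_range_realI[of _ 1]) simp
  have dev: "product_mean p N (tasep_semigroup N (\<delta> * real N) (?dev \<psi>)) \<le> tail"
    if \<psi>: "\<And>x. x < N \<Longrightarrow> \<bar>\<psi> x\<bar> \<le> 1" "\<And>x. x < N \<Longrightarrow> \<bar>ring_diff N \<psi> x\<bar> \<le> 1 / real m"
      "(\<Sum>x<N. \<bar>ring_diff N \<psi> x\<bar>) \<le> 2" for \<psi>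
  proof -
    let ?thr = "product_mean p N (weighted_count N \<psi>) +
      \<delta> * real N * (product_mean p N (weighted_current N \<psi>) + 2 * \<alpha>)"
    have "\<bar>(\<Sum>x<N. \<psi> x * p' x) - (\<Sum>x<N. \<psi> x * p x) -
        \<delta> * real N * (\<Sum>x<N. ring_diff N \<psi> x * (p x * (1 - p ((x + 1) mod N))))\<bar> \<le> real N * (\<delta> * e)"
      by (rule weighted_flux_consistency[where F = "\<lambda>x. p x * (1 - p ((x + 1) mod N))" and N = N and \<phi> = \<psi>,
            OF \<psi>(1) N cons])
    then have "?thr \<le> (\<Sum>x<N. \<psi> x * p' x) + \<tau>"
      unfolding product_mean_weighted_count product_mean_weighted_current[OF N] \<tau>_def
      by (simp add: abs_le_iff algebra_simps)
    then have "product_mean p N (tasep_semigroup N (\<delta> * real N) (?dev \<psi>)) \<le>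
        product_mean p N (tasep_semigroup N (\<delta> * real N) (\<lambda>\<xi>. of_bool (weighted_count N \<psi> \<xi> \<ge> ?thr)))"
      by (intro product_mean_mono pp tasep_semigroup_mono bd s) (auto intro!: bounded_range_realI[of _ 1])
    also have "\<dots> \<le> tail"
      unfolding tail_def by (rule block_tail[where m = "real m" and \<epsilon> = \<epsilon>])
        (fact N p C slow \<psi> m(3) \<delta> \<alpha> t | use m in simp)+
    finally show ?thesis .
  qed
  have le1: "\<bar>of_bool (\<xi> x) - p' x\<bar> \<le> 1" if "x < N" for x \<xi>
    using p'[OF that] by (auto simp: of_bool_def)
  have "product_mean p N (tasep_semigroup N (\<delta> * real N) (\<lambda>\<xi>. discrepancy N (\<lambda>x. of_bool (\<xi> x) - p' x))) \<le>
      (2 * real m + \<tau>) + real N * (\<Sum>i\<in>?I. product_mean p N (tasep_semigroup N (\<delta> * real N)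
        (\<lambda>\<xi>. 1 * ?dev (\<phi> i) \<xi> + 1 * ?dev (\<lambda>x. - \<phi> i x) \<xi>)))"
  proof (rule product_mean_semigroup_union[OF _ pp s])
    have "\<bar>discrepancy N (\<lambda>x. of_bool (\<xi> x) - p' x)\<bar> \<le> real N" for \<xi>
      using discrepancy_le_mult[OF N0, of "\<lambda>x. of_bool (\<xi> x) - p' x" 1] le1
        discrepancy_nonneg[OF N0] by simp
    then show "bounded (range (\<lambda>\<xi>. discrepancy N (\<lambda>x. of_bool (\<xi> x) - p' x)))"
      by (rule bounded_range_realI)
    show "bounded (range (\<lambda>\<xi>. 1 * ?dev (\<phi> i) \<xi> + 1 * ?dev (\<lambda>x. - \<phi> i x) \<xi>))" for i
      by (rule bounded_range_realI[of _ 2]) (auto simp: of_bool_def)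
    fix \<xi>
    show "discrepancy N (\<lambda>x. of_bool (\<xi> x) - p' x) \<le>
      (2 * real m + \<tau>) + real N * (\<Sum>i\<in>?I. 1 * ?dev (\<phi> i) \<xi> + 1 * ?dev (\<lambda>x. - \<phi> i x) \<xi>)"
    proof (rule discrepancy_le_union[OF N0])
      fix a l assume al: "a < N" "l \<le> N"
      let ?u = "\<Sum>x<N. \<phi> (a, l) x * (of_bool (\<xi> x) - p' x)"
      have "\<bar>\<phi> (a, l) x\<bar> \<le> 1" for x
        using smeared_arc_bounds[OF al(2) m0] by (simp add: \<phi>_def)
      then have "\<bar>?u\<bar> \<le> real N"
        using abs_sum_weighted_le[of N "\<phi> (a, l)" "\<lambda>x. of_bool (\<xi> x) - p' x" 1] le1 by simp
      moreover have "0 \<le> \<tau>" using \<delta> \<alpha> e by (simp add: \<tau>_def)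
      ultimately have "\<bar>?u\<bar> \<le> \<tau> + real N * (of_bool (?u \<ge> \<tau>) + of_bool (- ?u \<ge> \<tau>))"
        by (rule abs_le_indicators)
      moreover have "\<bar>arc_sum N a l (\<lambda>x. of_bool (\<xi> x) - p' x) - ?u\<bar> \<le> 2 * real m"
        unfolding \<phi>_def fst_conv snd_conv using le1 by (intro sum_smeared_arc m0 N0)
      moreover have "weighted_count N (\<phi> (a, l)) \<xi> - (\<Sum>x<N. \<phi> (a, l) x * p' x) = ?u"
        by (rule weighted_count_diff)
      moreover from this have "weighted_count N (\<lambda>x. - \<phi> (a, l) x) \<xi> - (\<Sum>x<N. - \<phi> (a, l) x * p' x) = - ?u"
        unfolding weighted_count_uminus by (simp add: sum_negf)
      ultimately show "\<bar>arc_sum N a l (\<lambda>x. of_bool (\<xi> x) - p' x)\<bar> \<le>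
          (2 * real m + \<tau>) + real N * (1 * ?dev (\<phi> (a, l)) \<xi> + 1 * ?dev (\<lambda>x. - \<phi> (a, l) x) \<xi>)"
        by simp
    qed auto
  qed auto
  also have "\<dots> \<le> (2 * real m + \<tau>) + real N * (\<Sum>i\<in>?I. 2 * tail)"
  proof (intro add_left_mono mult_left_mono sum_mono)
    fix i assume "i \<in> ?I"
    then have l: "snd i \<le> N" by auto
    have \<phi>1: "\<bar>\<phi> i x\<bar> \<le> 1" for x
      using smeared_arc_bounds[OF l m0] by (simp add: \<phi>_def)
    have \<phi>2: "\<bar>ring_diff N (\<phi> i) x\<bar> \<le> 1 / real m" if "x < N" for x
      unfolding \<phi>_def by (rule ring_diff_smeared_arc_le[OF that m(2) m0])
    have \<phi>3: "(\<Sum>x<N. \<bar>ring_diff N (\<phi> i) x\<bar>) \<le> 2"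
      unfolding \<phi>_def by (rule sum_ring_diff_smeared_arc_le[OF m0 N0])
    have neg: "ring_diff N (\<lambda>x. - \<phi> i x) x = - ring_diff N (\<phi> i) x" for x
      by (simp add: ring_diff_def)
    have "product_mean p N (tasep_semigroup N (\<delta> * real N) (?dev (\<phi> i))) \<le> tail"
      by (rule dev) (use \<phi>1 \<phi>2 \<phi>3 in auto)
    moreover have "product_mean p N (tasep_semigroup N (\<delta> * real N) (?dev (\<lambda>x. - \<phi> i x))) \<le> tail"
      by (rule dev) (use \<phi>1 \<phi>2 \<phi>3 neg in auto)
    moreover have "product_mean p N (tasep_semigroup N (\<delta> * real N)
        (\<lambda>\<xi>. 1 * ?dev (\<phi> i) \<xi> + 1 * ?dev (\<lambda>x. - \<phi> i x) \<xi>)) =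
      1 * product_mean p N (tasep_semigroup N (\<delta> * real N) (?dev (\<phi> i))) +
      1 * product_mean p N (tasep_semigroup N (\<delta> * real N) (?dev (\<lambda>x. - \<phi> i x)))"
      unfolding product_mean_lin[symmetric] by (intro product_mean_cong tasep_semigroup_lin bd)
    ultimately show "product_mean p N (tasep_semigroup N (\<delta> * real N)
        (\<lambda>\<xi>. 1 * ?dev (\<phi> i) \<xi> + 1 * ?dev (\<lambda>x. - \<phi> i x) \<xi>)) \<le> 2 * tail"
      by linarith
  qed auto
  also have "(\<Sum>i\<in>?I. 2 * tail) = real N * (real N + 1) * (2 * tail)"
    by (simp add: card_cartesian_product algebra_simps)
  finally show ?thesis
    unfolding tail_def \<tau>_def .
qed

lemma periodic1_add_nat: "periodic1 f \<Longrightarrow> f (u + real n) = f u"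
  by (induction n) (auto simp: periodic1_def add.assoc[symmetric] add.commute[of 1])

lemma periodic1_mod:
  assumes "periodic1 f" "0 < N"
  shows "f (real (k mod N) / real N) = f (real k / real N)"
proof -
  have "real k = real N * real (k div N) + real (k mod N)"
    by (metis mult_div_mod_eq of_nat_add of_nat_mult)
  then have "real k / real N = real (k mod N) / real N + real (k div N)"
    using assms(2) by (simp add: field_simps)
  then show ?thesis
    using periodic1_add_nat[OF assms(1), of "real (k mod N) / real N" "k div N"] by simp
qed

lemma mvt_within:
  fixes f :: "real \<Rightarrow> real"
  assumes "a < b" "{a..b} \<subseteq> S" "\<And>x. x \<in> {a..b} \<Longrightarrow> (f has_real_derivative f' x) (at x within S)"
  shows "\<exists>x\<in>{a<..<b}. f b - f a = f' x * (b - a)"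
proof (rule mvt_simple[OF assms(1), where f' = "\<lambda>x. (*) (f' x)"])
  fix x assume "a \<le> x" "x \<le> b"
  then have "x \<in> {a..b}" by simp
  then have "(f has_real_derivative f' x) (at x within {a..b})"
    by (rule DERIV_subset[OF assms(3) assms(2)])
  then show "(f has_derivative (*) (f' x)) (at x within {a..b})"
    by (simp add: has_field_derivative_def)
qed

lemma riemann_sums_converge:
  fixes g :: "real \<Rightarrow> real"
  assumes g: "continuous_on {0..1} g" and e: "0 < e"
  shows "eventually (\<lambda>N. \<bar>(1 / real N) * (\<Sum>x<N. g (real x / real N)) - (LBINT u=0..1. g u)\<bar> \<le> e) sequentially"
proof -
  define G where "G = (\<lambda>x. integral {0..x} g)"
  have G: "(G has_real_derivative g x) (at x within {0..1})" if "x \<in> {0..1}" for x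
    unfolding G_def using integral_has_real_derivative[OF g that] .
  have int: "(LBINT u=0..1. g u) = G 1 - G 0"
    using interval_integral_FTC_finite[of 0 1 g G] g G
    by (simp add: has_real_derivative_iff_has_vector_derivative zero_ereal_def one_ereal_def)
  obtain d where d: "0 < d" "\<And>x y. x \<in> {0..1} \<Longrightarrow> y \<in> {0..1} \<Longrightarrow> dist y x < d \<Longrightarrow> dist (g y) (g x) < e"
    using compact_uniformly_continuous[OF g] e unfolding uniformly_continuous_on_def by (metis compact_Icc)
  obtain N0 where N0: "real N0 > 1 / d"
    using reals_Archimedean2 by blast
  show ?thesis
  proof (rule eventually_sequentiallyI[of "max 1 N0"])
    fix N assume "max 1 N0 \<le> N"
    then have N: "0 < N" "1 / d < real N"
      using N0 by auto
    then have Nd: "1 / real N < d"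
      using d by (simp add: field_simps)
    let ?u = "\<lambda>x. real x / real N"
    have step: "\<bar>(1 / real N) * g (?u x) - (G (?u (Suc x)) - G (?u x))\<bar> \<le> e / real N" if x: "x < N" for x
    proof -
      have lt: "?u x < ?u (Suc x)" and sub: "{?u x..?u (Suc x)} \<subseteq> {0..1}"
        using x N by (auto simp: field_simps)
      obtain z where z: "z \<in> {?u x<..<?u (Suc x)}" "G (?u (Suc x)) - G (?u x) = g z * (?u (Suc x) - ?u x)"
        using mvt_within[OF lt sub G[OF subsetD[OF sub]]] by blast
      have len: "?u (Suc x) - ?u x = 1 / real N"
        using N by (simp add: field_simps)
      have "\<bar>g (?u x) - g z\<bar> < e"
      proof -
        have z': "z \<in> {?u x..?u (Suc x)}" "?u x \<in> {?u x..?u (Suc x)}"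
          using z(1) by auto
        moreover have "\<bar>z - ?u x\<bar> < d"
          using z(1) len Nd unfolding greaterThanLessThan_iff by linarith
        ultimately have "?u x \<in> {0..1}" "z \<in> {0..1}" "dist z (?u x) < d"
          using sub by (blast, blast, simp add: dist_real_def)
        then show ?thesis
          using d(2)[of "?u x" z] by (simp add: dist_real_def abs_minus_commute)
      qed
      then have "\<bar>g (?u x) - g z\<bar> / real N \<le> e / real N"
        by (intro divide_right_mono) auto
      then show ?thesis
        unfolding z(2) len by (simp add: diff_divide_distrib[symmetric] abs_divide)
    qed
    have "(\<Sum>x<N. G (?u (Suc x)) - G (?u x)) = G 1 - G 0"
      using sum_lessThan_telescope[of "\<lambda>x. G (?u x)" N] N by simp
    then have "(1 / real N) * (\<Sum>x<N. g (?u x)) - (LBINT u=0..1. g u) =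
        (\<Sum>x<N. (1 / real N) * g (?u x) - (G (?u (Suc x)) - G (?u x)))"
      unfolding int sum_subtractf sum_distrib_left by simp
    also have "\<bar>\<dots>\<bar> \<le> (\<Sum>x<N. e / real N)"
      using step by (intro order_trans[OF sum_abs] sum_mono) auto
    finally show "\<bar>(1 / real N) * (\<Sum>x<N. g (?u x)) - (LBINT u=0..1. g u)\<bar> \<le> e"
      using N by simp
  qed
qed

lemma sum_by_parts:
  fixes c g :: "nat \<Rightarrow> real"
  shows "(\<Sum>x<n. c x * g x) = c n * (\<Sum>x<n. g x) - (\<Sum>x<n. (c (Suc x) - c x) * (\<Sum>y<Suc x. g y))"
  by (induction n) (simp_all add: algebra_simps)

lemma test_function_discrepancy:
  fixes J :: "real \<Rightarrow> real"
  assumes J: "continuous_on {0..1} J" and e: "0 < e"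
  obtains K where "0 \<le> K" "\<And>N g. 0 < N \<Longrightarrow> (\<And>x. x < N \<Longrightarrow> \<bar>g x\<bar> \<le> 1) \<Longrightarrow>
    \<bar>(1 / real N) * (\<Sum>x<N. J (real x / real N) * g x)\<bar> \<le> e + K * (discrepancy N g / real N)"
proof -
  obtain P where P: "real_polynomial_function P" "\<And>x. x \<in> {0..1} \<Longrightarrow> \<bar>J x - P x\<bar> < e"
    using Stone_Weierstrass_real_polynomial_function[OF compact_Icc J e] by blast
  obtain P' where P': "real_polynomial_function P'" "\<And>x. (P has_real_derivative P' x) (at x)"
    using has_real_derivative_polynomial_function[OF P(1)] by blast
  have "continuous_on {0..1} P'"
    using continuous_real_polymonial_function[OF P'(1)] by (simp add: continuous_at_imp_continuous_on)
  then obtain L where L: "\<And>x. x \<in> {0..1} \<Longrightarrow> \<bar>P' x\<bar> \<le> L"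
    using compact_imp_bounded[OF compact_continuous_image] by (fastforce simp: bounded_iff)
  have L0: "0 \<le> L" using L[of 0] by simp
  show thesis
  proof (rule that[of "\<bar>P 1\<bar> + L"])
    fix N :: nat and g :: "nat \<Rightarrow> real"
    assume N: "0 < N" and g: "\<And>x. x < N \<Longrightarrow> \<bar>g x\<bar> \<le> 1"
    let ?u = "\<lambda>x. real x / real N"
    define D where "D = discrepancy N g"
    have D0: "0 \<le> D" unfolding D_def by (rule discrepancy_nonneg[OF N])
    have G: "\<bar>\<Sum>y<n. g y\<bar> \<le> D" if "n \<le> N" for n
    proof -
      have "arc_sum N (N - 1) n g = (\<Sum>y<n. g y)"
        unfolding arc_sum_def using that N by (intro sum.cong refl) simp
      then show ?thesis
        using abs_arc_sum_le_discrepancy[OF N that, of "N - 1" g] by (simp add: D_def)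
    qed
    have incr: "\<bar>P (?u (Suc x)) - P (?u x)\<bar> \<le> L / real N" if x: "x < N" for x
    proof -
      have lt: "?u x < ?u (Suc x)" and sub: "{?u x..?u (Suc x)} \<subseteq> {0..1}"
        using x N by (auto simp: field_simps)
      obtain z where z: "z \<in> {?u x<..<?u (Suc x)}" "P (?u (Suc x)) - P (?u x) = P' z * (?u (Suc x) - ?u x)"
        using mvt_within[OF lt subset_UNIV P'(2)] by blast
      have "?u (Suc x) - ?u x = 1 / real N"
        using N by (simp add: field_simps)
      moreover have "z \<in> {?u x..?u (Suc x)}"
        using z(1) by auto
      then have "\<bar>P' z\<bar> \<le> L"
        using sub by (intro L) blast
      ultimately show ?thesis
        unfolding z(2) by (simp add: abs_divide divide_right_mono)
    qed
    have "\<bar>\<Sum>x<N. P (?u x) * g x\<bar> \<le> \<bar>P (?u N)\<bar> * D + (\<Sum>x<N. L / real N * D)"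
    proof -
      have "\<bar>P (?u N) * (\<Sum>x<N. g x)\<bar> \<le> \<bar>P (?u N)\<bar> * D"
        unfolding abs_mult by (intro mult_left_mono G) auto
      moreover have "\<bar>\<Sum>x<N. (P (?u (Suc x)) - P (?u x)) * (\<Sum>y<Suc x. g y)\<bar> \<le> (\<Sum>x<N. L / real N * D)"
      proof (intro order_trans[OF sum_abs] sum_mono)
        fix x assume "x \<in> {..<N}"
        then show "\<bar>(P (?u (Suc x)) - P (?u x)) * (\<Sum>y<Suc x. g y)\<bar> \<le> L / real N * D"
          unfolding abs_mult using L0 by (intro mult_mono incr G) auto
      qed
      ultimately show ?thesis
        unfolding sum_by_parts[of "\<lambda>x. P (?u x)"] by linarith
    qed
    also have "\<dots> = (\<bar>P 1\<bar> + L) * D"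
      using N by (simp add: algebra_simps)
    finally have 1: "\<bar>\<Sum>x<N. P (?u x) * g x\<bar> \<le> (\<bar>P 1\<bar> + L) * D" .
    have 2: "\<bar>\<Sum>x<N. (J (?u x) - P (?u x)) * g x\<bar> \<le> (\<Sum>x<N. e * 1)"
    proof (intro order_trans[OF sum_abs] sum_mono)
      fix x assume "x \<in> {..<N}"
      then have x: "x < N" "?u x \<in> {0..1}" by auto
      show "\<bar>(J (?u x) - P (?u x)) * g x\<bar> \<le> e * 1"
        unfolding abs_mult using P(2)[OF x(2)] g[OF x(1)] by (intro mult_mono) auto
    qed
    have "(\<Sum>x<N. J (?u x) * g x) = (\<Sum>x<N. (J (?u x) - P (?u x)) * g x) + (\<Sum>x<N. P (?u x) * g x)"
      by (simp add: algebra_simps flip: sum.distrib)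
    then have "\<bar>\<Sum>x<N. J (?u x) * g x\<bar> \<le> real N * e + (\<bar>P 1\<bar> + L) * D"
      using 1 2 by simp
    then have "\<bar>\<Sum>x<N. J (?u x) * g x\<bar> / real N \<le> (real N * e + (\<bar>P 1\<bar> + L) * D) / real N"
      by (rule divide_right_mono) simp
    then show "\<bar>(1 / real N) * (\<Sum>x<N. J (?u x) * g x)\<bar> \<le> e + (\<bar>P 1\<bar> + L) * (discrepancy N g / real N)"
      using N by (simp add: abs_divide add_divide_distrib D_def)
  qed (use L0 in simp)
qed

subsection \<open>Consistency with the conservation law\<close>

definition profile :: "(real \<Rightarrow> real \<Rightarrow> real) \<Rightarrow> nat \<Rightarrow> real \<Rightarrow> nat \<Rightarrow> real" where
  "profile \<rho> N s x = \<rho> s (real x / real N)"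

lemma profile_mod:
  assumes "classical_solution T \<rho>\<^sub>0 \<rho>" "s \<in> {0..T}" "0 < N"
  shows "profile \<rho> N s (k mod N) = \<rho> s (real k / real N)"
  using assms periodic1_mod[of "\<rho> s" N k] unfolding profile_def classical_solution_def by auto

lemma profile_slowly_varying:
  assumes sol: "classical_solution T \<rho>\<^sub>0 \<rho>"
    and bounds: "0 < \<rho>m" "\<rho>p < 1" "\<And>s u. s \<in> {0..T} \<Longrightarrow> \<rho>m \<le> \<rho> s u \<and> \<rho> s u \<le> \<rho>p"
  obtains C where "1 \<le> C" "\<And>N s x. 0 < N \<Longrightarrow> s \<in> {0..T} \<Longrightarrow> x < N \<Longrightarrow>
    \<bar>(profile \<rho> N s x - profile \<rho> N s ((x + 1) mod N)) /
      ((1 - profile \<rho> N s x) * profile \<rho> N s ((x + 1) mod N))\<bar> \<le> C / real N"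
proof -
  obtain \<rho>u where \<rho>u: "bounded ((\<lambda>(t, u). \<rho>u t u) ` ({0..T} \<times> UNIV))"
    "\<And>t u. t \<in> {0..T} \<Longrightarrow> (\<rho> t has_real_derivative \<rho>u t u) (at u)"
    using sol unfolding classical_solution_def by blast
  obtain K where K: "\<And>t u. t \<in> {0..T} \<Longrightarrow> \<bar>\<rho>u t u\<bar> \<le> K"
    using \<rho>u(1) by (force simp: bounded_iff)
  define C where "C = max 1 (K / ((1 - \<rho>p) * \<rho>m))"
  show thesis
  proof (rule that[of C])
    show "1 \<le> C" by (simp add: C_def)
    fix N s x assume N: "0 < (N :: nat)" and s: "s \<in> {0..T}" and x: "x < N"
    have lt: "real x / real N < real (x + 1) / real N"
      using N by (simp add: divide_strict_right_mono)
    obtain z where z: "\<rho> s (real (x + 1) / real N) - \<rho> s (real x / real N) =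
        \<rho>u s z * (real (x + 1) / real N - real x / real N)"
      using mvt_within[OF lt subset_UNIV \<rho>u(2)[OF s]] by blast
    have "real (x + 1) / real N - real x / real N = 1 / real N"
      using N by (simp add: field_simps)
    then have num: "\<bar>profile \<rho> N s x - profile \<rho> N s ((x + 1) mod N)\<bar> \<le> K / real N"
      using z K[OF s, of z] profile_mod[OF sol s N, of "x + 1"]
      by (subst abs_minus_commute) (simp add: abs_divide divide_right_mono profile_def[of \<rho> N s x])
    have den: "(1 - \<rho>p) * \<rho>m \<le> (1 - profile \<rho> N s x) * profile \<rho> N s ((x + 1) mod N)"
    proof -
      have b: "\<rho>m \<le> profile \<rho> N s y" "profile \<rho> N s y \<le> \<rho>p" for y
        unfolding profile_def using bounds(3)[OF s] by auto
      show ?thesis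
        using b[of x] b[of "(x + 1) mod N"] bounds(1,2) by (intro mult_mono) linarith+
    qed
    have pos: "0 < (1 - \<rho>p) * \<rho>m"
      using bounds by simp
    have "0 \<le> K" using K[OF s, of 0] by linarith
    then have "\<bar>profile \<rho> N s x - profile \<rho> N s ((x + 1) mod N)\<bar> /
        ((1 - profile \<rho> N s x) * profile \<rho> N s ((x + 1) mod N)) \<le> (K / real N) / ((1 - \<rho>p) * \<rho>m)"
      using num den pos by (intro frac_le) auto
    also have "\<dots> = (K / ((1 - \<rho>p) * \<rho>m)) / real N"
      by simp
    also have "\<dots> \<le> C / real N"
      by (intro divide_right_mono) (auto simp: C_def)
    finally show "\<bar>(profile \<rho> N s x - profile \<rho> N s ((x + 1) mod N)) /
      ((1 - profile \<rho> N s x) * profile \<rho> N s ((x + 1) mod N))\<bar> \<le> C / real N"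
      using den pos by (simp add: abs_divide)
  qed
qed

lemma profile_consistency:
  assumes sol: "classical_solution T \<rho>\<^sub>0 \<rho>"
    and bounds: "\<And>s u. s \<in> {0..T} \<Longrightarrow> 0 \<le> \<rho> s u \<and> \<rho> s u \<le> 1"
    and e: "0 < e"
  obtains d0 :: real and N0 :: nat where "0 < d0"
    "\<And>N s d x. N0 \<le> N \<Longrightarrow> 0 < N \<Longrightarrow> s \<in> {0..T} \<Longrightarrow> s + d \<in> {0..T} \<Longrightarrow> 0 < d \<Longrightarrow> d \<le> d0 \<Longrightarrow> x < N \<Longrightarrow>
      \<bar>profile \<rho> N (s + d) ((x + 1) mod N) - profile \<rho> N s ((x + 1) mod N) -
        d * real N * (profile \<rho> N s x * (1 - profile \<rho> N s ((x + 1) mod N)) -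
          profile \<rho> N s ((x + 1) mod N) * (1 - profile \<rho> N s (((x + 1) mod N + 1) mod N)))\<bar> \<le> d * e"
proof -
  obtain \<rho>t \<rho>u where c: "continuous_on ({0..T} \<times> UNIV) (\<lambda>(t, u). \<rho>t t u)"
      "continuous_on ({0..T} \<times> UNIV) (\<lambda>(t, u). \<rho>u t u)"
    and d: "\<And>t u. t \<in> {0..T} \<Longrightarrow>
           ((\<lambda>s. \<rho> s u) has_real_derivative \<rho>t t u) (at t within {0..T}) \<and>
           (\<rho> t has_real_derivative \<rho>u t u) (at u) \<and>
           \<rho>t t u + deriv (\<lambda>v. \<rho> t v * (1 - \<rho> t v)) u = 0"
    using sol unfolding classical_solution_def by blast
  let ?S = "{0..T} \<times> {0..2 :: real}"
  have S: "compact ?S" "?S \<subseteq> {0..T} \<times> UNIV"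
    by (auto intro: compact_Times)
  have e4: "0 < e / 4" using e by simp
  obtain dt where dt: "0 < dt" "\<And>x y. x \<in> ?S \<Longrightarrow> y \<in> ?S \<Longrightarrow> dist y x < dt \<Longrightarrow>
      dist (case y of (t, u) \<Rightarrow> \<rho>t t u) (case x of (t, u) \<Rightarrow> \<rho>t t u) < e / 4"
    using compact_uniformly_continuous[OF continuous_on_subset[OF c(1) S(2)] S(1)] e4
    unfolding uniformly_continuous_on_def by blast
  obtain du where du: "0 < du" "\<And>x y. x \<in> ?S \<Longrightarrow> y \<in> ?S \<Longrightarrow> dist y x < du \<Longrightarrow>
      dist (case y of (t, u) \<Rightarrow> \<rho>u t u) (case x of (t, u) \<Rightarrow> \<rho>u t u) < e / 4"
    using compact_uniformly_continuous[OF continuous_on_subset[OF c(2) S(2)] S(1)] e4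
    unfolding uniformly_continuous_on_def by blast
  obtain N0 where N0: "real N0 > 1 / du"
    using reals_Archimedean2 by blast
  have pde: "\<rho>t t u = - \<rho>u t u + 2 * \<rho> t u * \<rho>u t u" if "t \<in> {0..T}" for t u
  proof -
    have "((\<lambda>v. \<rho> t v * (1 - \<rho> t v)) has_real_derivative \<rho>u t u - 2 * \<rho> t u * \<rho>u t u) (at u)"
      using d[OF that, of u] by (auto intro!: derivative_eq_intros simp: algebra_simps)
    then show ?thesis
      using d[OF that, of u] DERIV_imp_deriv by fastforce
  qed
  show thesis
  proof (rule that[of "dt / 2" N0])
    show "0 < dt / 2" using dt by simp
    fix N s h x
    assume "N0 \<le> N" and N: "0 < N" and s: "s \<in> {0..T}" "s + h \<in> {0..T}" and h: "0 < h" "h \<le> dt / 2" and x: "x < N"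
    then have "1 / du < real N" using N0 by simp
    then have Nd: "1 / real N < du"
      using du N by (simp add: field_simps)
    define u0 where "u0 = real x / real N"
    define u where "u = real (x + 1) / real N"
    define u2 where "u2 = real (x + 2) / real N"
    have len: "u - u0 = 1 / real N" "u2 - u = 1 / real N"
      using N by (auto simp: u0_def u_def u2_def field_simps)
    have "0 < 1 / real N" using N by simp
    then have "u0 < u" "u < u2" using len by linarith+
    have box: "0 \<le> u0" "u2 \<le> 2"
    proof -
      show "0 \<le> u0" by (simp add: u0_def)
      have "x + 2 \<le> 2 * N" using x by simp
      then have "real (x + 2) \<le> 2 * real N" by linarith
      then show "u2 \<le> 2" using N by (simp add: u2_def divide_le_eq)
    qed
    have p: "profile \<rho> N s x = \<rho> s u0" "profile \<rho> N r ((x + 1) mod N) = \<rho> r u"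
      "profile \<rho> N s (((x + 1) mod N + 1) mod N) = \<rho> s u2" if "r \<in> {0..T}" for r
      using profile_mod[OF sol that N] profile_mod[OF sol s(1) N, of "x + 2"]
      by (simp_all add: profile_def u0_def u_def u2_def mod_Suc_eq)
    obtain u1 where u1: "u1 \<in> {u0<..<u}" "\<rho> s u - \<rho> s u0 = \<rho>u s u1 * (u - u0)"
      using mvt_within[OF \<open>u0 < u\<close> subset_UNIV, of "\<rho> s" "\<rho>u s"] d[OF s(1)] by blast
    obtain u3 where u3: "u3 \<in> {u<..<u2}" "\<rho> s u2 - \<rho> s u = \<rho>u s u3 * (u2 - u)"
      using mvt_within[OF \<open>u < u2\<close> subset_UNIV, of "\<rho> s" "\<rho>u s"] d[OF s(1)] by blast
    obtain r where r: "r \<in> {s<..<s + h}" "\<rho> (s + h) u - \<rho> s u = \<rho>t r u * (s + h - s)"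
      using mvt_within[of s "s + h" "{0..T}" "\<lambda>s. \<rho> s u" "\<lambda>t. \<rho>t t u"] d s h by auto
    have A: "\<bar>\<rho>t r u - \<rho>t s u\<bar> < e / 4"
      using dt(2)[of "(s, u)" "(r, u)"] r s h box \<open>u0 < u\<close> \<open>u < u2\<close> by (auto simp: dist_real_def dist_Pair_Pair)
    have B: "\<bar>\<rho>u s u1 - \<rho>u s u\<bar> < e / 4" "\<bar>\<rho>u s u3 - \<rho>u s u\<bar> < e / 4"
      using du(2)[of "(s, u)" "(s, u1)"] du(2)[of "(s, u)" "(s, u3)"] u1(1) u3(1) s box len Nd
      by (auto simp: dist_real_def dist_Pair_Pair)
    have NN: "real N * (\<rho> s u0 * (1 - \<rho> s u) - \<rho> s u * (1 - \<rho> s u2)) =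
        - \<rho>u s u1 + \<rho> s u * (\<rho>u s u1 + \<rho>u s u3)"
    proof -
      have "\<rho> s u0 * (1 - \<rho> s u) - \<rho> s u * (1 - \<rho> s u2) =
          - (\<rho> s u - \<rho> s u0) + \<rho> s u * ((\<rho> s u - \<rho> s u0) + (\<rho> s u2 - \<rho> s u))"
        by (simp add: algebra_simps)
      also have "\<dots> = (- \<rho>u s u1 + \<rho> s u * (\<rho>u s u1 + \<rho>u s u3)) * (1 / real N)"
        unfolding u1(2) u3(2) len by (simp add: algebra_simps)
      finally show ?thesis using N by simp
    qed
    have "\<bar>(\<rho>u s u1 - \<rho>u s u) + (\<rho>u s u3 - \<rho>u s u)\<bar> \<le> e / 4 + e / 4"
      using B by linarith
    then have "\<bar>\<rho> s u * ((\<rho>u s u1 - \<rho>u s u) + (\<rho>u s u3 - \<rho>u s u))\<bar> \<le> 1 * (e / 4 + e / 4)"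
      unfolding abs_mult using bounds[OF s(1), of u] by (intro mult_mono) auto
    note C = this
    have main: "\<bar>\<rho>t r u - (- \<rho>u s u1 + \<rho> s u * (\<rho>u s u1 + \<rho>u s u3))\<bar> \<le> e"
    proof -
      have "\<rho>t r u - (- \<rho>u s u1 + \<rho> s u * (\<rho>u s u1 + \<rho>u s u3)) = (\<rho>t r u - \<rho>t s u) + (\<rho>u s u1 - \<rho>u s u) -
          \<rho> s u * ((\<rho>u s u1 - \<rho>u s u) + (\<rho>u s u3 - \<rho>u s u))"
        unfolding pde[OF s(1)] by (simp add: algebra_simps)
      moreover have "\<bar>a + b - c\<bar> \<le> e" if "\<bar>a\<bar> < e / 4" "\<bar>b\<bar> < e / 4" "\<bar>c\<bar> \<le> 1 * (e / 4 + e / 4)" for a b c :: real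
        using that unfolding abs_le_iff abs_less_iff by auto
      ultimately show ?thesis
        using A B(1) C by (simp only:)
    qed
    have "\<rho> (s + h) u - \<rho> s u - h * real N * (\<rho> s u0 * (1 - \<rho> s u) - \<rho> s u * (1 - \<rho> s u2)) =
        h * (\<rho>t r u - (- \<rho>u s u1 + \<rho> s u * (\<rho>u s u1 + \<rho>u s u3)))"
      unfolding r(2) NN mult.assoc[of h] by (simp add: algebra_simps)
    then show "\<bar>profile \<rho> N (s + h) ((x + 1) mod N) - profile \<rho> N s ((x + 1) mod N) -
        h * real N * (profile \<rho> N s x * (1 - profile \<rho> N s ((x + 1) mod N)) -
          profile \<rho> N s ((x + 1) mod N) * (1 - profile \<rho> N s (((x + 1) mod N + 1) mod N)))\<bar> \<le> h * e"
      using main h unfolding p(1)[OF s(1)] p(2)[OF s(1)] p(2)[OF s(2)] p(3)[OF s(1)]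
      by (simp add: abs_mult mult_left_mono)
  qed
qed

subsection \<open>Marginals of the chain\<close>

lemma jump_in_configs:
  assumes "\<xi> \<in> configs N" "x < N"
  shows "jump N x \<xi> \<in> configs N"
  using assms exchange_in_configs[of \<xi> N x "(x + 1) mod N"] by (simp add: jump_def)

lemma tasep_semigroup_cong_configs:
  assumes "\<And>\<xi>. \<xi> \<in> configs N \<Longrightarrow> f \<xi> = g \<xi>" "\<xi> \<in> configs N"
  shows "tasep_semigroup N t f \<xi> = tasep_semigroup N t g \<xi>"
proof -
  have "(tasep_generator N ^^ n) f \<xi> = (tasep_generator N ^^ n) g \<xi>" if "\<xi> \<in> configs N" for n \<xi>
    using that
  proof (induction n arbitrary: \<xi>)
    case (Suc n)
    have "jump_sum N ((tasep_generator N ^^ n) f) \<xi> = jump_sum N ((tasep_generator N ^^ n) g) \<xi>"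
      unfolding jump_sum_def using Suc.prems by (intro sum.cong refl Suc.IH jump_in_configs) auto
    then show ?case
      using Suc.IH[OF Suc.prems]
      by (simp add: tasep_generator_eq[of N "(tasep_generator N ^^ n) f"] tasep_generator_eq[of N "(tasep_generator N ^^ n) g"])
  qed (use assms in auto)
  then show ?thesis
    unfolding transition_semigroup_def using assms(2) by simp
qed

lemma tasep_semigroup_expand:
  assumes "\<xi> \<in> configs N"
  shows "tasep_semigroup N t g \<xi> = (\<Sum>y\<in>configs N. g y * tasep_semigroup N t (indicator {y}) \<xi>)"
proof -
  have "tasep_semigroup N t g \<xi> = tasep_semigroup N t (\<lambda>\<xi>. \<Sum>y\<in>configs N. g y * indicator {y} \<xi>) \<xi>"
  proof (rule tasep_semigroup_cong_configs[OF _ assms])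
    fix \<zeta> assume "\<zeta> \<in> configs N"
    then show "g \<zeta> = (\<Sum>y\<in>configs N. g y * indicator {y} \<zeta>)"
      by (simp add: indicator_def if_distrib[of "\<lambda>u. _ * u"] cong: if_cong)
  qed
  also have "\<dots> = (\<Sum>y\<in>configs N. g y * tasep_semigroup N t (indicator {y}) \<xi>)"
  proof -
    have "bounded (range (indicator {y} :: config \<Rightarrow> real))" for y
      by (rule bounded_range_realI[of _ 1]) (simp add: indicator_def)
    then show ?thesis
      using tasep_semigroup_sum[of "configs N" "\<lambda>y. indicator {y}" N t g \<xi>] by simp
  qed
  finally show ?thesis .
qed

definition chain_mean :: "'a measure \<Rightarrow> (real \<Rightarrow> 'a \<Rightarrow> config) \<Rightarrow> nat \<Rightarrow> real \<Rightarrow> (config \<Rightarrow> real) \<Rightarrow> real" where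
  "chain_mean M X N \<tau> g = (\<Sum>y\<in>configs N. measure M {\<omega> \<in> space M. X \<tau> \<omega> = y} * g y)"

lemma chain_mean_mono:
  assumes "\<And>\<xi>. \<xi> \<in> configs N \<Longrightarrow> f \<xi> \<le> g \<xi>"
  shows "chain_mean M X N \<tau> f \<le> chain_mean M X N \<tau> g"
  unfolding chain_mean_def using assms by (intro sum_mono mult_left_mono) auto

lemma chain_mean_add: "chain_mean M X N \<tau> (\<lambda>\<xi>. f \<xi> + g \<xi>) = chain_mean M X N \<tau> f + chain_mean M X N \<tau> g"
  unfolding chain_mean_def by (simp add: sum.distrib distrib_left)

lemma chain_mean_cmult: "chain_mean M X N \<tau> (\<lambda>\<xi>. c * f \<xi>) = c * chain_mean M X N \<tau> f"
  unfolding chain_mean_def by (simp add: sum_distrib_left mult_ac)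

context
  fixes M :: "'a measure" and X :: "real \<Rightarrow> 'a \<Rightarrow> config" and N :: nat
  assumes chain: "markov_chain_with_generator M X (configs N) (tasep_generator N)"
begin

lemma prob_space_chain: "prob_space M"
  using chain unfolding markov_chain_with_generator_def by blast

lemma measurable_chain: "0 \<le> \<tau> \<Longrightarrow> X \<tau> \<in> measurable M (count_space (configs N))"
  using chain unfolding markov_chain_with_generator_def by blast

lemma chain_in_configs: "0 \<le> \<tau> \<Longrightarrow> \<omega> \<in> space M \<Longrightarrow> X \<tau> \<omega> \<in> configs N"
  using measurable_space[OF measurable_chain] by fastforce

lemma sets_chain:
  assumes "0 \<le> \<tau>"
  shows "{\<omega> \<in> space M. X \<tau> \<omega> \<in> A} \<in> sets M"
proof -
  have "X \<tau> -` (A \<inter> configs N) \<inter> space M \<in> sets M"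
    using measurable_chain[OF assms] by (rule measurable_sets) simp
  moreover have "X \<tau> -` (A \<inter> configs N) \<inter> space M = {\<omega> \<in> space M. X \<tau> \<omega> \<in> A}"
    using chain_in_configs[OF assms] by auto
  ultimately show ?thesis by simp
qed

lemma prob_chain_eq_chain_mean:
  assumes "0 \<le> \<tau>"
  shows "measure M {\<omega> \<in> space M. P (X \<tau> \<omega>)} = chain_mean M X N \<tau> (\<lambda>\<xi>. of_bool (P \<xi>))"
proof -
  interpret prob_space M by (rule prob_space_chain)
  let ?S = "{y \<in> configs N. P y}"
  have "{\<omega> \<in> space M. P (X \<tau> \<omega>)} = (\<Union>y\<in>?S. {\<omega> \<in> space M. X \<tau> \<omega> = y})"
    using chain_in_configs[OF assms] by auto
  also have "measure M \<dots> = (\<Sum>y\<in>?S. measure M {\<omega> \<in> space M. X \<tau> \<omega> = y})"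
  proof (rule finite_measure_finite_Union)
    show "(\<lambda>y. {\<omega> \<in> space M. X \<tau> \<omega> = y}) ` ?S \<subseteq> sets M"
      using sets_chain[OF assms, of "{y}" for y] by auto
  qed (auto simp: disjoint_family_on_def)
  also have "\<dots> = chain_mean M X N \<tau> (\<lambda>\<xi>. of_bool (P \<xi>))"
    unfolding chain_mean_def by (intro sum.mono_neutral_cong_left) auto
  finally show ?thesis .
qed

lemma chain_mean_const: "0 \<le> \<tau> \<Longrightarrow> chain_mean M X N \<tau> (\<lambda>_. c) = c"
  using prob_chain_eq_chain_mean[of \<tau> "\<lambda>_. True"] prob_space.prob_space[OF prob_space_chain]
    chain_mean_cmult[of M X N \<tau> c "\<lambda>_. 1"] by simp

lemma chain_mean_step:
  assumes s: "0 \<le> s" and h: "0 < h"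
  shows "chain_mean M X N (s + h) g = chain_mean M X N s (tasep_semigroup N h g)"
proof -
  interpret prob_space M by (rule prob_space_chain)
  let ?A = "\<lambda>x y. {\<omega> \<in> space M. X s \<omega> = x \<and> X (s + h) \<omega> = y}"
  have joint: "measure M (?A x y) = measure M {\<omega> \<in> space M. X s \<omega> = x} * tasep_semigroup N h (indicator {y}) x"
    if "x \<in> configs N" "y \<in> configs N" for x y
  proof -
    define \<tau> where "\<tau> = (\<lambda>i. s + real i * h)"
    define z where "z = (\<lambda>i::nat. if i = 0 then x else y)"
    have "measure M {\<omega> \<in> space M. \<forall>i\<le>Suc 0. X (\<tau> i) \<omega> = z i} =
        measure M {\<omega> \<in> space M. \<forall>i\<le>0. X (\<tau> i) \<omega> = z i} *
          tasep_semigroup N (\<tau> (Suc 0) - \<tau> 0) (indicator {z (Suc 0)}) (z 0)"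
      using chain s h that unfolding markov_chain_with_generator_def
      by (elim conjE) (elim allE[of _ 0] allE[of _ \<tau>] allE[of _ z], simp add: \<tau>_def z_def)
    moreover have "(\<forall>i\<le>Suc 0. X (\<tau> i) \<omega> = z i) \<longleftrightarrow> X s \<omega> = x \<and> X (s + h) \<omega> = y" for \<omega>
      by (auto simp: le_Suc_eq \<tau>_def z_def)
    ultimately show ?thesis
      by (simp add: \<tau>_def z_def)
  qed
  have marginal: "measure M {\<omega> \<in> space M. X (s + h) \<omega> = y} = (\<Sum>x\<in>configs N. measure M (?A x y))" for y
  proof -
    have "{\<omega> \<in> space M. X (s + h) \<omega> = y} = (\<Union>x\<in>configs N. ?A x y)"
      using chain_in_configs[OF s] by auto
    also have "measure M \<dots> = (\<Sum>x\<in>configs N. measure M (?A x y))"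
    proof (rule finite_measure_finite_Union)
      have "?A x y \<in> sets M" for x
      proof -
        have "?A x y = {\<omega> \<in> space M. X s \<omega> \<in> {x}} \<inter> {\<omega> \<in> space M. X (s + h) \<omega> \<in> {y}}"
          by auto
        also have "\<dots> \<in> sets M"
          by (intro sets.Int sets_chain) (use s h in auto)
        finally show ?thesis .
      qed
      then show "(\<lambda>x. ?A x y) ` configs N \<subseteq> sets M"
        by blast
    qed (auto simp: disjoint_family_on_def)
    finally show ?thesis .
  qed
  have "chain_mean M X N (s + h) g =
      (\<Sum>y\<in>configs N. \<Sum>x\<in>configs N. measure M {\<omega> \<in> space M. X s \<omega> = x} * (g y * tasep_semigroup N h (indicator {y}) x))"
    unfolding chain_mean_def marginal sum_distrib_right
    by (intro sum.cong refl) (simp add: joint)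
  also have "\<dots> = (\<Sum>x\<in>configs N. measure M {\<omega> \<in> space M. X s \<omega> = x} * tasep_semigroup N h g x)"
    by (subst sum.swap) (simp add: tasep_semigroup_expand[of _ N h g] sum_distrib_left)
  finally show ?thesis
    by (simp add: chain_mean_def)
qed

end

lemma tasep_from_initial_mean:
  assumes init: "tasep_from N \<rho>\<^sub>0 M X" and \<rho>: "\<And>u. 0 \<le> \<rho>\<^sub>0 u \<and> \<rho>\<^sub>0 u \<le> 1"
  shows "chain_mean M X N 0 g = product_mean (\<lambda>x. \<rho>\<^sub>0 (real x / real N)) N g"
  unfolding chain_mean_def product_mean_def
proof (intro sum.cong refl)
  fix y assume y: "y \<in> configs N"
  have chain: "markov_chain_with_generator M X (configs N) (tasep_generator N)"
    and law: "distr M (count_space UNIV) (X 0) = measure_pmf (initial_law N \<rho>\<^sub>0)"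
    using init unfolding tasep_from_def by auto
  have "X 0 \<in> measurable M (count_space UNIV)"
    using measurable_compose[OF measurable_chain[OF chain order_refl], of id "count_space UNIV"] by (simp add: id_def)
  then have "measure M {\<omega> \<in> space M. X 0 \<omega> = y} = measure (distr M (count_space UNIV) (X 0)) {y}"
    by (subst measure_distr) (auto intro!: arg_cong[of _ _ "measure M"])
  also have "\<dots> = pmf (initial_law N \<rho>\<^sub>0) y"
    unfolding law by (simp add: pmf.rep_eq)
  also have "\<dots> = (\<Prod>x<N. pmf (bernoulli_pmf (\<rho>\<^sub>0 (real x / real N))) (y x))"
    unfolding initial_law_def using y by (intro pmf_Pi') (auto simp: configs_def)
  also have "\<dots> = bernoulli_weight (\<lambda>x. \<rho>\<^sub>0 (real x / real N)) N y"
    unfolding bernoulli_weight_def using \<rho> by (intro prod.cong refl) auto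
  finally show "measure M {\<omega> \<in> space M. X 0 \<omega> = y} * g y =
      bernoulli_weight (\<lambda>x. \<rho>\<^sub>0 (real x / real N)) N y * g y"
    by simp
qed

lemma chain_mean_discrepancy_step:
  assumes chain: "markov_chain_with_generator M X (configs N) (tasep_generator N)"
    and N: "0 < N" and s: "0 \<le> s" and h: "0 < h"
    and p: "\<And>x. x < N \<Longrightarrow> 0 \<le> p x \<and> p x \<le> 1"
  defines "D \<equiv> \<lambda>p \<xi>. discrepancy N (\<lambda>x. of_bool (\<xi> x) - p x)"
  shows "chain_mean M X N (s + h) (D p') \<le> chain_mean M X N s (D p) +
    (product_mean p N (tasep_semigroup N h (D p')) + product_mean p N (D p))"
proof -
  let ?c = "product_mean p N (tasep_semigroup N h (D p')) + product_mean p N (D p)"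
  have "tasep_semigroup N h (D p') \<xi> \<le> D p \<xi> + ?c" for \<xi>
  proof -
    have "product_mean p N (\<lambda>_. tasep_semigroup N h (D p') \<xi>) \<le>
        product_mean p N (\<lambda>\<zeta>. (tasep_semigroup N h (D p') \<zeta> + D p \<zeta>) + D p \<xi>)"
    proof (rule product_mean_mono[OF p])
      fix \<zeta> :: config
      have "tasep_semigroup N h (D p') \<xi> \<le> tasep_semigroup N h (D p') \<zeta> +
          discrepancy N (\<lambda>x. of_bool (\<xi> x) - of_bool (\<zeta> x))"
        unfolding D_def using N h by (intro tasep_semigroup_discrepancy_lipschitz) auto
      also have "discrepancy N (\<lambda>x. of_bool (\<xi> x) - of_bool (\<zeta> x)) \<le> D p \<xi> + D p \<zeta>"
        using discrepancy_triangle[OF N, of "\<lambda>x. of_bool (\<xi> x)" "\<lambda>x. of_bool (\<zeta> x)" p]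
          discrepancy_commute[of N p "\<lambda>x. of_bool (\<zeta> x)"] by (simp add: D_def)
      finally show "tasep_semigroup N h (D p') \<xi> \<le> (tasep_semigroup N h (D p') \<zeta> + D p \<zeta>) + D p \<xi>"
        by simp
    qed
    then show ?thesis
      unfolding product_mean_add by simp
  qed
  then have "chain_mean M X N (s + h) (D p') \<le> chain_mean M X N s (\<lambda>\<xi>. D p \<xi> + ?c)"
    unfolding chain_mean_step[OF chain s h] by (intro chain_mean_mono)
  also have "\<dots> = chain_mean M X N s (D p) + ?c"
    unfolding chain_mean_add chain_mean_const[OF chain s] by simp
  finally show ?thesis .
qed

lemma expected_discrepancy_small:
  assumes sol: "classical_solution T \<rho>\<^sub>0 \<rho>" and \<rho>: "0 < \<rho>m" "\<rho>p < 1"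
    and bounds: "\<And>s u. s \<in> {0..T} \<Longrightarrow> \<rho>m \<le> \<rho> s u \<and> \<rho> s u \<le> \<rho>p"
    and start: "\<And>N. 1 \<le> N \<Longrightarrow> tasep_from N \<rho>\<^sub>0 (M N) (\<eta> N)"
    and t: "t \<in> {0..T}" and \<gamma>: "0 < \<gamma>"
  shows "eventually (\<lambda>N. chain_mean (M N) (\<eta> N) N (real N * t)
    (\<lambda>\<xi>. discrepancy N (\<lambda>x. of_bool (\<xi> x) - profile \<rho> N t x)) \<le> \<gamma> * real N) sequentially"
proof -
  define e where "e = (\<lambda>N s. chain_mean (M N) (\<eta> N) N (real N * s)
    (\<lambda>\<xi>. discrepancy N (\<lambda>x. of_bool (\<xi> x) - profile \<rho> N s x)))"
  define q where "q = (\<lambda>B N. real N * (real N + 1) * (2 * exp (- B\<^sup>2 * real N / 4)))"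
  have q_lim: "q B \<longlonglongrightarrow> 0" if "0 < B" for B
    unfolding q_def using that by real_asymp
  have prob: "0 < profile \<rho> N s x \<and> profile \<rho> N s x < 1" "0 \<le> profile \<rho> N s x \<and> profile \<rho> N s x \<le> 1"
    if "s \<in> {0..T}" for N s x
    using bounds[OF that, of "real x / real N"] \<rho> unfolding profile_def by linarith+
  have lln: "product_mean (profile \<rho> N s) N (\<lambda>\<xi>. discrepancy N (\<lambda>x. of_bool (\<xi> x) - profile \<rho> N s x)) \<le>
      B * real N + real N * q B N" if "s \<in> {0..T}" "1 \<le> N" "0 \<le> B" for N s B
    unfolding q_def using that by (intro product_mean_discrepancy_le prob) auto
  have T0: "0 \<in> {0..T}" using t by auto
  have chain: "markov_chain_with_generator (M N) (\<eta> N) (configs N) (tasep_generator N)" if "1 \<le> N" for N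
    using start[OF that] unfolding tasep_from_def by blast
  have e0: "e N 0 \<le> B * real N + real N * q B N" if "1 \<le> N" "0 \<le> B" for N B
  proof -
    have \<rho>\<^sub>0: "\<rho> 0 u = \<rho>\<^sub>0 u" for u
      using sol unfolding classical_solution_def by blast
    have "0 \<le> \<rho>\<^sub>0 u \<and> \<rho>\<^sub>0 u \<le> 1" for u
      using bounds[OF T0, of u] \<rho> unfolding \<rho>\<^sub>0 by linarith
    then have "e N 0 = product_mean (profile \<rho> N 0) N (\<lambda>\<xi>. discrepancy N (\<lambda>x. of_bool (\<xi> x) - profile \<rho> N 0 x))"
      unfolding e_def mult_zero_right
      by (subst tasep_from_initial_mean[OF start[OF that(1)]]) (simp_all add: profile_def[abs_def] \<rho>\<^sub>0)
    then show ?thesis using lln[OF T0 that] by simp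
  qed
  have "eventually (\<lambda>N. e N t \<le> \<gamma> * real N) sequentially"
  proof (cases "t = 0")
    case True
    have "eventually (\<lambda>N. q (\<gamma> / 2) N < \<gamma> / 2) sequentially"
      using \<gamma> by (intro order_tendstoD(2)[OF q_lim]) auto
    then show ?thesis
      using eventually_ge_at_top[of 1]
    proof eventually_elim
      case (elim N)
      then have "real N * q (\<gamma> / 2) N \<le> real N * (\<gamma> / 2)"
        by (intro mult_left_mono) auto
      moreover have "\<gamma> / 2 * real N + real N * (\<gamma> / 2) = \<gamma> * real N"
        by simp
      moreover have "e N 0 \<le> \<gamma> / 2 * real N + real N * q (\<gamma> / 2) N"
        using elim \<gamma> by (intro e0) auto
      ultimately show ?case unfolding True by linarith
    qed
  next
    case False
    then have t0: "0 < t" using t by auto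
    obtain C where C: "1 \<le> C" "\<And>N s x. 0 < N \<Longrightarrow> s \<in> {0..T} \<Longrightarrow> x < N \<Longrightarrow>
      \<bar>(profile \<rho> N s x - profile \<rho> N s ((x + 1) mod N)) /
        ((1 - profile \<rho> N s x) * profile \<rho> N s ((x + 1) mod N))\<bar> \<le> C / real N"
      using profile_slowly_varying[OF sol \<rho> bounds] by blast
    define \<epsilon> where "\<epsilon> = min (1 / 2) (\<gamma> / (16 * t))"
    define \<alpha> where "\<alpha> = min 1 (\<gamma> / (16 * t))"
    define e' where "e' = \<gamma> / (8 * t)"
    have \<epsilon>: "0 < \<epsilon>" "\<epsilon> \<le> 1 / 2" "t * (2 * \<epsilon>) \<le> \<gamma> / 8"
      and \<alpha>: "0 < \<alpha>" "\<alpha> \<le> 1" "t * (2 * \<alpha>) \<le> \<gamma> / 8" and e': "0 < e'" "t * e' = \<gamma> / 8"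
    proof -
      have "t * (2 * (\<gamma> / (16 * t))) = \<gamma> / 8" using t0 by simp
      moreover have "\<epsilon> \<le> \<gamma> / (16 * t)" "\<alpha> \<le> \<gamma> / (16 * t)"
        by (simp_all add: \<epsilon>_def \<alpha>_def)
      then have "t * (2 * \<epsilon>) \<le> t * (2 * (\<gamma> / (16 * t)))" "t * (2 * \<alpha>) \<le> t * (2 * (\<gamma> / (16 * t)))"
        using t0 by (simp_all add: field_simps)
      ultimately show "t * (2 * \<epsilon>) \<le> \<gamma> / 8" "t * (2 * \<alpha>) \<le> \<gamma> / 8" by simp_all
    qed (use t0 \<gamma> in \<open>auto simp: \<epsilon>_def \<alpha>_def e'_def\<close>)
    have bounds01: "0 \<le> \<rho> s u \<and> \<rho> s u \<le> 1" if "s \<in> {0..T}" for s u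
      using bounds[OF that, of u] \<rho> by linarith
    obtain d0 :: real and N0 :: nat where d0: "0 < d0" and cons:
      "\<And>N s d x. N0 \<le> N \<Longrightarrow> 0 < N \<Longrightarrow> s \<in> {0..T} \<Longrightarrow> s + d \<in> {0..T} \<Longrightarrow> 0 < d \<Longrightarrow> d \<le> d0 \<Longrightarrow> x < N \<Longrightarrow>
      \<bar>profile \<rho> N (s + d) ((x + 1) mod N) - profile \<rho> N s ((x + 1) mod N) -
        d * real N * (profile \<rho> N s x * (1 - profile \<rho> N s ((x + 1) mod N)) -
          profile \<rho> N s ((x + 1) mod N) * (1 - profile \<rho> N s (((x + 1) mod N + 1) mod N)))\<bar> \<le> d * e'"
      using profile_consistency[OF sol bounds01 e'(1)] by blast
    define r where "r = Min {1, d0, \<alpha>\<^sup>2 * \<epsilon> / (8192 * C\<^sup>2)}"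
    have r: "0 < r" "r \<le> 1" "r \<le> d0" "r \<le> \<alpha>\<^sup>2 * \<epsilon> / (8192 * C\<^sup>2)"
      using d0 \<alpha> \<epsilon> C(1) by (auto simp: r_def)
    obtain K :: nat where Kr: "t / r < real K"
      using reals_Archimedean2 by blast
    have "0 < t / r" using t0 r by simp
    then have K: "0 < real K" "t \<le> r * real K"
      using Kr r by (linarith, simp add: field_simps)
    define \<delta> where "\<delta> = t / real K"
    have K\<delta>: "real K * \<delta> = t" using K by (simp add: \<delta>_def)
    have \<delta>: "0 < \<delta>" "\<delta> \<le> r" using t0 K by (auto simp: \<delta>_def divide_le_eq)
    have \<alpha>\<epsilon>: "8192 * C\<^sup>2 * \<delta> \<le> \<alpha>\<^sup>2 * \<epsilon>"
    proof -
      have "8192 * C\<^sup>2 * \<delta> \<le> 8192 * C\<^sup>2 * (\<alpha>\<^sup>2 * \<epsilon> / (8192 * C\<^sup>2))"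
        using \<delta> r by (intro mult_left_mono) auto
      then show ?thesis using C(1) by simp
    qed
    define \<theta> where "\<theta> = Min {1, 64 * C\<^sup>2 * \<delta>\<^sup>2 / 7, \<alpha> * \<delta> / 4}"
    have \<theta>: "0 < \<theta>" "\<theta> \<le> 1" "7 * \<theta> \<le> 64 * C\<^sup>2 * \<delta>\<^sup>2" "4 * \<theta> \<le> \<alpha> * \<delta>"
    proof -
      have "\<theta> \<le> 64 * C\<^sup>2 * \<delta>\<^sup>2 / 7" "\<theta> \<le> \<alpha> * \<delta> / 4" by (auto simp: \<theta>_def)
      then show "7 * \<theta> \<le> 64 * C\<^sup>2 * \<delta>\<^sup>2" "4 * \<theta> \<le> \<alpha> * \<delta>" by simp_all
    qed (use C(1) \<delta> \<alpha> in \<open>auto simp: \<theta>_def\<close>)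
    define B where "B = \<gamma> / (8 * (real K + 1))"
    have B: "0 < B" "(real K + 1) * B = \<gamma> / 8"
    proof -
      have "0 < \<gamma> / (8 * k) \<and> k * (\<gamma> / (8 * k)) = \<gamma> / 8" if "0 < k" for k
        using that \<gamma> by simp
      from this[of "real K + 1"] show "0 < B" "(real K + 1) * B = \<gamma> / 8"
        unfolding B_def by auto
    qed
    define w where "w = (\<lambda>N. real N * (real N + 1) *
      (2 * (exp (- (\<theta> * \<alpha> * \<delta> / 2) * real N) +
        5 * real N * (1 + real N * C) * exp (- (64 * C\<^sup>2 * \<delta>\<^sup>2) * real N))))"
    have w_lim: "w \<longlonglongrightarrow> 0"
    proof -
      have "0 < \<theta> * \<alpha> * \<delta> / 2" "0 < 64 * C\<^sup>2 * \<delta>\<^sup>2" "0 < C"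
        using \<theta> \<alpha> \<delta> C(1) by auto
      moreover have "(\<lambda>N. real N * (real N + 1) *
        (2 * (exp (- a * real N) + 5 * real N * (1 + real N * C) * exp (- b * real N)))) \<longlonglongrightarrow> 0"
        if "0 < a" "0 < b" "0 < C" for a b C :: real
      proof -
        have "(\<lambda>N. real N * (real N + 1) * (2 * exp (- a * real N))) \<longlonglongrightarrow> 0"
          using that by real_asymp
        moreover have "(\<lambda>N. real N * (real N + 1) * (2 * (5 * real N * (1 + real N * C) * exp (- b * real N)))) \<longlonglongrightarrow> 0"
          using that by real_asymp
        ultimately have "(\<lambda>N. real N * (real N + 1) * (2 * exp (- a * real N)) +
            real N * (real N + 1) * (2 * (5 * real N * (1 + real N * C) * exp (- b * real N)))) \<longlonglongrightarrow> 0"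
          by (rule tendsto_add_zero)
        then show ?thesis
          by (simp only: distrib_left[symmetric])
      qed
      ultimately show ?thesis unfolding w_def by blast
    qed
    define R where "R = (\<lambda>N. 2 * (\<epsilon> * \<delta> * real N + 1) + \<delta> * real N * (2 * \<alpha> + e') + real N * w N +
      (B * real N + real N * q B N))"
    have block: "e N (real (Suc k) * \<delta>) \<le> e N (real k * \<delta>) + R N"
      if N: "N0 \<le> N" "2 \<le> N" "2 \<le> \<epsilon> * \<delta> * real N" and k: "k < K" for N k
    proof -
      have k\<delta>: "0 \<le> real k * \<delta>" "real (Suc k) * \<delta> \<le> t"
        using \<delta> k mult_right_mono[of "real (Suc k)" "real K" \<delta>] by (auto simp: K\<delta>)
      have sT: "real k * \<delta> \<in> {0..T}" "real k * \<delta> + \<delta> \<in> {0..T}"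
        using k\<delta> t \<delta> by (auto simp: algebra_simps)
      define m where "m = nat \<lceil>\<epsilon> * \<delta> * real N\<rceil>"
      have m: "\<epsilon> * \<delta> * real N \<le> real m" "real m \<le> \<epsilon> * \<delta> * real N + 1"
        using N by (auto simp: m_def)
      have "\<epsilon> * \<delta> \<le> 1 / 2 * 1"
        using \<epsilon> \<delta> r by (intro mult_mono) auto
      then have "\<epsilon> * \<delta> * real N \<le> 1 / 2 * real N"
        by (intro mult_right_mono) auto
      then have mN: "2 \<le> m" "m \<le> N"
        using m N by linarith+
      have "product_mean (profile \<rho> N (real k * \<delta>)) N (tasep_semigroup N (\<delta> * real N)
          (\<lambda>\<xi>. discrepancy N (\<lambda>x. of_bool (\<xi> x) - profile \<rho> N (real k * \<delta> + \<delta>) x))) \<le>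
        2 * real m + \<delta> * real N * (2 * \<alpha> + e') + real N * w N"
        unfolding w_def
        by (rule block_discrepancy[where \<epsilon> = \<epsilon>])
          (use N \<delta> \<alpha> \<theta> C sT mN m e' prob \<alpha>\<epsilon> r cons[OF N(1) _ sT] in auto)
      then have "product_mean (profile \<rho> N (real k * \<delta>)) N (tasep_semigroup N (\<delta> * real N)
          (\<lambda>\<xi>. discrepancy N (\<lambda>x. of_bool (\<xi> x) - profile \<rho> N (real k * \<delta> + \<delta>) x))) +
          product_mean (profile \<rho> N (real k * \<delta>)) N
            (\<lambda>\<xi>. discrepancy N (\<lambda>x. of_bool (\<xi> x) - profile \<rho> N (real k * \<delta>) x)) \<le> R N"
        using m lln[OF sT(1), of N B] N B unfolding R_def by simp
      moreover have "e N (real k * \<delta> + \<delta>) \<le> e N (real k * \<delta>) +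
          (product_mean (profile \<rho> N (real k * \<delta>)) N (tasep_semigroup N (\<delta> * real N)
            (\<lambda>\<xi>. discrepancy N (\<lambda>x. of_bool (\<xi> x) - profile \<rho> N (real k * \<delta> + \<delta>) x))) +
          product_mean (profile \<rho> N (real k * \<delta>)) N
            (\<lambda>\<xi>. discrepancy N (\<lambda>x. of_bool (\<xi> x) - profile \<rho> N (real k * \<delta>) x)))"
        unfolding e_def distrib_left[of "real N"] mult.commute[of "real N" \<delta>]
        by (rule chain_mean_discrepancy_step) (use N k\<delta> \<delta> chain[of N] prob sT in auto)
      moreover have "real (Suc k) * \<delta> = real k * \<delta> + \<delta>"
        by (simp add: algebra_simps)
      ultimately show ?thesis by simp
    qed
    have total: "e N (real k * \<delta>) \<le> (B * real N + real N * q B N) + real k * R N"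
      if N: "N0 \<le> N" "2 \<le> N" "2 \<le> \<epsilon> * \<delta> * real N" and k: "k \<le> K" for N k
      using k
    proof (induction k)
      case 0
      then show ?case using e0[of N B] N B by simp
    next
      case (Suc k)
      then show ?case using block[OF N, of k] by (simp add: algebra_simps)
    qed
    define E where "E = (\<lambda>N. 2 * real K / real N + (real K + 1) * q B N + real K * w N)"
    have "E \<longlonglongrightarrow> 2 * real K * 0 + (real K + 1) * 0 + real K * 0"
      unfolding E_def divide_inverse
      by (intro tendsto_intros q_lim[OF B(1)] w_lim lim_inverse_n)
    then have "eventually (\<lambda>N. E N < \<gamma> / 2) sequentially"
      using \<gamma> by (intro order_tendstoD(2)) auto
    moreover have "eventually (\<lambda>N. 2 \<le> \<epsilon> * \<delta> * real N) sequentially"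
    proof -
      have "0 < \<epsilon> * \<delta>" using \<epsilon> \<delta> by simp
      then show ?thesis by real_asymp
    qed
    ultimately show ?thesis
      using eventually_ge_at_top[of N0] eventually_ge_at_top[of 2]
    proof eventually_elim
      case (elim N)
      have N0: "0 < real N" using elim by simp
      have "e N t \<le> (B * real N + real N * q B N) + real K * R N"
        using total[of N K] elim by (simp add: K\<delta>)
      also have "\<dots> = real N * ((real K + 1) * B + (real K * \<delta>) * (2 * \<epsilon> + 2 * \<alpha> + e') + E N)"
        using N0 unfolding R_def E_def by (simp add: field_simps)
      also have "\<dots> \<le> real N * \<gamma>"
      proof (rule mult_left_mono)
        have "t * (2 * \<epsilon> + 2 * \<alpha> + e') \<le> 3 * \<gamma> / 8"
          using \<epsilon>(3) \<alpha>(3) e'(2) by (simp add: distrib_left)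
        then show "(real K + 1) * B + (real K * \<delta>) * (2 * \<epsilon> + 2 * \<alpha> + e') + E N \<le> \<gamma>"
          using elim B(2) unfolding K\<delta> by simp
      qed simp
      finally show ?case by (simp add: mult.commute)
    qed
  qed
  then show ?thesis by (simp add: e_def)
qed

theorem theorem6p1p1:
  fixes \<rho>\<^sub>0 :: "real \<Rightarrow> real" and \<rho>m \<rho>p T :: real and \<rho> :: "real \<Rightarrow> real \<Rightarrow> real"
    and M :: "nat \<Rightarrow> 'a measure" and \<eta> :: "nat \<Rightarrow> real \<Rightarrow> 'a \<Rightarrow> config"
    and t :: real and J :: "real \<Rightarrow> real"
  assumes "periodic1 \<rho>\<^sub>0" and "\<rho>\<^sub>0 C1_differentiable_on UNIV"
    and "0 < \<rho>m" and "\<rho>p < 1" and "\<And>u. \<rho>m \<le> \<rho>\<^sub>0 u \<and> \<rho>\<^sub>0 u \<le> \<rho>p"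
    and "0 < T" and "classical_solution T \<rho>\<^sub>0 \<rho>"
    and "\<And>s u. s \<in> {0..T} \<Longrightarrow> \<rho>m \<le> \<rho> s u \<and> \<rho> s u \<le> \<rho>p"
    and "\<And>N. 1 \<le> N \<Longrightarrow> tasep_from N \<rho>\<^sub>0 (M N) (\<eta> N)"
    and "t \<in> {0..T}"
    and "periodic1 J" and "continuous_on UNIV J"
  shows "converges_in_probability M
    (\<lambda>N \<omega>. LINT u|empirical_measure N (\<eta> N (real N * t) \<omega>). J u)
    (LBINT u=0..1. J u * \<rho> t u)"
  unfolding converges_in_probability_def
proof (intro allI impI)
  fix \<epsilon> :: real assume \<epsilon>: "0 < \<epsilon>"
  define c where "c = (LBINT u=0..1. J u * \<rho> t u)"
  define F where "F = (\<lambda>N \<xi>. (1 / real N) * (\<Sum>x<N. J (real x / real N) * of_bool (\<xi> x)))"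
  let ?p = "\<lambda>N. measure (M N) {\<omega> \<in> space (M N). \<bar>F N (\<eta> N (real N * t) \<omega>) - c\<bar> > \<epsilon>}"
  have bounds: "0 \<le> \<rho> t u \<and> \<rho> t u \<le> 1" for u
    using assms(3,4) assms(8)[OF assms(10), of u] by linarith
  obtain \<rho>u where "\<And>u. (\<rho> t has_real_derivative \<rho>u u) (at u)"
    using assms(7,10) unfolding classical_solution_def by blast
  then have "\<And>u. isCont (\<rho> t) u"
    by (rule DERIV_isCont)
  then have "continuous_on UNIV (\<rho> t)"
    by (simp add: continuous_at_imp_continuous_on)
  then have "continuous_on {0..1} (\<lambda>u. J u * \<rho> t u)" and J01: "continuous_on {0..1} J"
    using assms(12) by (auto intro!: continuous_on_mult intro: continuous_on_subset)
  then have riemann: "eventually (\<lambda>N. \<bar>(1 / real N) * (\<Sum>x<N. J (real x / real N) * profile \<rho> N t x) - c\<bar> \<le> \<epsilon> / 4) sequentially"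
    unfolding c_def profile_def using \<epsilon> by (intro riemann_sums_converge) auto
  obtain K where K: "0 \<le> K" "\<And>N g. 0 < N \<Longrightarrow> (\<And>x. x < N \<Longrightarrow> \<bar>g x\<bar> \<le> 1) \<Longrightarrow>
    \<bar>(1 / real N) * (\<Sum>x<N. J (real x / real N) * g x)\<bar> \<le> \<epsilon> / 4 + K * (discrepancy N g / real N)"
    using test_function_discrepancy[OF J01, of "\<epsilon> / 4"] \<epsilon> by auto
  have "?p \<longlonglongrightarrow> 0"
  proof (rule tendstoI)
    fix r :: real assume r: "0 < r"
    define \<gamma> where "\<gamma> = r * \<epsilon> / (4 * (K + 1))"
    have \<gamma>: "0 < \<gamma>" using r \<epsilon> K by (simp add: \<gamma>_def)
    have K\<gamma>: "2 * K / \<epsilon> * \<gamma> < r"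
    proof -
      have "2 * K / \<epsilon> * \<gamma> = r * (K / (K + 1)) / 2"
        using \<epsilon> K(1) by (simp add: \<gamma>_def field_simps)
      also have "\<dots> \<le> r * 1 / 2"
        using r K(1) by (intro divide_right_mono mult_left_mono) auto
      finally show ?thesis using r by simp
    qed
    have "eventually (\<lambda>N. chain_mean (M N) (\<eta> N) N (real N * t)
      (\<lambda>\<xi>. discrepancy N (\<lambda>x. of_bool (\<xi> x) - profile \<rho> N t x)) \<le> \<gamma> * real N) sequentially"
      using assms(3,4,7-10) \<gamma> by (intro expected_discrepancy_small) auto
    with riemann show "eventually (\<lambda>N. dist (?p N) 0 < r) sequentially"
      using eventually_ge_at_top[of 1]
    proof eventually_elim
      case (elim N)
      then have N: "0 < N" by simp
      let ?D = "\<lambda>\<xi>. discrepancy N (\<lambda>x. of_bool (\<xi> x) - profile \<rho> N t x)"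
      have chain: "markov_chain_with_generator (M N) (\<eta> N) (configs N) (tasep_generator N)"
        using assms(9)[of N] elim unfolding tasep_from_def by blast
      have "0 \<le> real N * t" using assms(10) by auto
      from prob_chain_eq_chain_mean[OF chain this, of "\<lambda>\<xi>. \<bar>F N \<xi> - c\<bar> > \<epsilon>"]
      have "?p N = chain_mean (M N) (\<eta> N) N (real N * t) (\<lambda>\<xi>. of_bool (\<bar>F N \<xi> - c\<bar> > \<epsilon>))" .
      also have "\<dots> \<le> chain_mean (M N) (\<eta> N) N (real N * t) (\<lambda>\<xi>. (2 * K / (\<epsilon> * real N)) * ?D \<xi>)"
      proof (rule chain_mean_mono)
        fix \<xi> :: config
        have "F N \<xi> - (1 / real N) * (\<Sum>x<N. J (real x / real N) * profile \<rho> N t x) =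
            (1 / real N) * (\<Sum>x<N. J (real x / real N) * (of_bool (\<xi> x) - profile \<rho> N t x))"
          unfolding F_def by (simp add: right_diff_distrib sum_subtractf del: sum_mult_of_bool_eq)
        moreover have "\<bar>of_bool (\<xi> x) - profile \<rho> N t x\<bar> \<le> 1" for x
          using bounds[of "real x / real N"] by (auto simp: profile_def of_bool_def)
        ultimately have "\<bar>F N \<xi> - (1 / real N) * (\<Sum>x<N. J (real x / real N) * profile \<rho> N t x)\<bar> \<le>
            \<epsilon> / 4 + K * (?D \<xi> / real N)"
          using K(2)[OF N, of "\<lambda>x. of_bool (\<xi> x) - profile \<rho> N t x"] by simp
        then have F: "\<bar>F N \<xi> - c\<bar> \<le> \<epsilon> / 2 + K * (?D \<xi> / real N)"
          using elim(1) by linarith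
        have D: "0 \<le> K * (?D \<xi> / real N)"
          using K(1) discrepancy_nonneg[OF N] by simp
        have eq: "(2 * K / (\<epsilon> * real N)) * ?D \<xi> = K * (?D \<xi> / real N) / (\<epsilon> / 2)"
          by (simp add: mult_ac)
        show "of_bool (\<bar>F N \<xi> - c\<bar> > \<epsilon>) \<le> (2 * K / (\<epsilon> * real N)) * ?D \<xi>"
        proof (cases "\<bar>F N \<xi> - c\<bar> > \<epsilon>")
          case True
          then have "\<epsilon> / 2 \<le> K * (?D \<xi> / real N)" using F by linarith
          then have "1 \<le> K * (?D \<xi> / real N) / (\<epsilon> / 2)"
            using \<epsilon> by (simp only: le_divide_eq_1_pos half_gt_zero)
          then show ?thesis using True unfolding eq by simp
        next
          case False
          moreover have "0 \<le> K * (?D \<xi> / real N) / (\<epsilon> / 2)"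
            using D \<epsilon> by (intro divide_nonneg_nonneg) auto
          ultimately show ?thesis unfolding eq by simp
        qed
      qed
      also have "\<dots> = (2 * K / (\<epsilon> * real N)) * chain_mean (M N) (\<eta> N) N (real N * t) ?D"
        by (rule chain_mean_cmult)
      also have "\<dots> \<le> (2 * K / (\<epsilon> * real N)) * (\<gamma> * real N)"
        using elim(2) K(1) \<epsilon> by (intro mult_left_mono) auto
      also have "\<dots> = 2 * K / \<epsilon> * \<gamma>"
        using N by simp
      finally show ?case using K\<gamma> by simp
    qed
  qed
  then show "(\<lambda>N. measure (M N) {\<omega> \<in> space (M N).
      \<bar>(LINT u|empirical_measure N (\<eta> N (real N * t) \<omega>). J u) - (LBINT u=0..1. J u * \<rho> t u)\<bar> > \<epsilon>}) \<longlonglongrightarrow> 0"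
    unfolding integral_empirical_measure[OF assms(12)] F_def c_def .
qed

end
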